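(* For any $s\geq 2$, the $s$-Club Contraction problem can be solved in $O(m^4n^3)$ time on AT-free graphs. This result holds even if $s$ is given as a part of the input.
   Context: For a positive integer $s$, the $s$-Club Contraction problem asks, given a graph $G$ and a positive integer $k$, whether there exists a graph $H$ with diameter at most $s$ such that $G$ is $k$-contractible to $H$, i.e., $H$ can be obtained from $G$ by contracting a set of at most $k$ edges. An asteroidal triple is a set of three non-adjacent vertices such that between each pair there is a path avoiding the neighborhood of the third; a graph is AT-free if it has no asteroidal triple. $n$ and $m$ denote the number of vertices and edges of the input graph. *)

theory Defs
  imports Main "HOL-Library.Extended_Nat"
begin

section \<open>Finite simple graphs\<close>

record 'a ugraph =
  verts :: "'a set"
  edges :: "'a set set"

definition simple_graph :: "'a ugraph \<Rightarrow> bool" where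
  "simple_graph G \<longleftrightarrow>
     finite (verts G) \<and> (\<forall>e\<in>edges G. e \<subseteq> verts G \<and> card e = 2)"

definition adj :: "'a ugraph \<Rightarrow> 'a \<Rightarrow> 'a \<Rightarrow> bool" where
  "adj G u v \<longleftrightarrow> {u, v} \<in> edges G"

definition nbhd :: "'a ugraph \<Rightarrow> 'a \<Rightarrow> 'a set" where
  "nbhd G v = {u \<in> verts G. adj G v u}"

definition path_between :: "'a ugraph \<Rightarrow> 'a \<Rightarrow> 'a list \<Rightarrow> 'a \<Rightarrow> bool" where
  "path_between G u p v \<longleftrightarrow>
     p \<noteq> [] \<and> hd p = u \<and> last p = v \<and> distinct p \<and>
     set p \<subseteq> verts G \<and> successively (adj G) p"

text \<open>Distances and diameters are extended naturals: the distance between vertices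
  in different connected components is \<open>\<infinity>\<close> (an infimum over the empty set).\<close>

definition vdist :: "'a ugraph \<Rightarrow> 'a \<Rightarrow> 'a \<Rightarrow> enat" where
  "vdist G u v = (INF p \<in> {p. path_between G u p v}. enat (length p - 1))"

definition graph_diameter :: "'a ugraph \<Rightarrow> enat" where
  "graph_diameter G = (SUP u \<in> verts G. SUP v \<in> verts G. vdist G u v)"

definition ugraph_iso :: "'a ugraph \<Rightarrow> 'b ugraph \<Rightarrow> bool" where
  "ugraph_iso G H \<longleftrightarrow>
     (\<exists>f. bij_betw f (verts G) (verts H) \<and>
          (\<forall>u\<in>verts G. \<forall>v\<in>verts G. adj G u v \<longleftrightarrow> adj H (f u) (f v)))"

section \<open>AT-free graphs\<close>

definition asteroidal_triple :: "'a ugraph \<Rightarrow> 'a set \<Rightarrow> bool" where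
  "asteroidal_triple G T \<longleftrightarrow>
     T \<subseteq> verts G \<and> card T = 3 \<and>
     (\<forall>x\<in>T. \<forall>y\<in>T. \<not> adj G x y) \<and>
     (\<forall>x\<in>T. \<forall>y\<in>T. \<forall>z\<in>T. x \<noteq> y \<and> y \<noteq> z \<and> x \<noteq> z \<longrightarrow>
        (\<exists>p. path_between G x p y \<and> set p \<inter> nbhd G z = {}))"

definition AT_free :: "'a ugraph \<Rightarrow> bool" where
  "AT_free G \<longleftrightarrow> (\<nexists>T. asteroidal_triple G T)"

section \<open>Contractions and the \<open>s\<close>-Club Contraction problem\<close>

text \<open>Contracting an edge set \<open>F\<close> merges each connected component of \<open>(verts G, F)\<close> into
  one vertex, named by its set of original vertices; loops and parallel edges disappear.\<close>

definition blob :: "'a ugraph \<Rightarrow> 'a set set \<Rightarrow> 'a \<Rightarrow> 'a set" where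
  "blob G F v = {u \<in> verts G. (v, u) \<in> {(a, b). {a, b} \<in> F}\<^sup>*}"

definition contract :: "'a ugraph \<Rightarrow> 'a set set \<Rightarrow> 'a set ugraph" where
  "contract G F =
     \<lparr> verts = blob G F ` verts G,
       edges = {{blob G F u, blob G F v} | u v. adj G u v \<and> blob G F u \<noteq> blob G F v} \<rparr>"

definition contractible_to :: "nat \<Rightarrow> 'a ugraph \<Rightarrow> 'b ugraph \<Rightarrow> bool" where
  "contractible_to k G H \<longleftrightarrow>
     (\<exists>F \<subseteq> edges G. card F \<le> k \<and> ugraph_iso (contract G F) H)"

text \<open>Taking \<open>H\<close> over the vertex type of \<open>G\<close> loses nothing, since a contraction of \<open>G\<close> has at
  most as many vertices as \<open>G\<close>.\<close>

definition s_club_contraction :: "nat \<Rightarrow> 'a ugraph \<Rightarrow> nat \<Rightarrow> bool" where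
  "s_club_contraction s G k \<longleftrightarrow>
     (\<exists>H :: 'a ugraph. simple_graph H \<and> graph_diameter H \<le> enat s \<and> contractible_to k G H)"

section \<open>A unit-cost word RAM\<close>

text \<open>Programs are structured; a program mentions finitely many registers and finitely many
  arrays (which a RAM with a single memory would interleave, at constant overhead).\<close>

datatype operand = Imm nat | Reg string

datatype arith_op = Add | Sub | Mul | Div

datatype test = Eq operand operand | Less operand operand | Leq operand operand

datatype prog =
    Skip
  | Assign string arith_op operand operand
  | Load string string operand
  | Store string operand operand
  | Seq prog prog
  | Cond test prog prog
  | While test prog

record state =
  regs :: "string \<Rightarrow> nat"
  arrs :: "string \<Rightarrow> nat \<Rightarrow> nat"

fun oval :: "state \<Rightarrow> operand \<Rightarrow> nat" where
  "oval \<sigma> (Imm n) = n"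
| "oval \<sigma> (Reg r) = regs \<sigma> r"

text \<open>Subtraction and division are those of \<open>nat\<close>: \<open>x - y = 0\<close> for \<open>x \<le> y\<close> and
  \<open>x div 0 = 0\<close>.\<close>

fun apply_op :: "arith_op \<Rightarrow> nat \<Rightarrow> nat \<Rightarrow> nat" where
  "apply_op Add x y = x + y"
| "apply_op Sub x y = x - y"
| "apply_op Mul x y = x * y"
| "apply_op Div x y = x div y"

fun tval :: "state \<Rightarrow> test \<Rightarrow> bool" where
  "tval \<sigma> (Eq a b) \<longleftrightarrow> oval \<sigma> a = oval \<sigma> b"
| "tval \<sigma> (Less a b) \<longleftrightarrow> oval \<sigma> a < oval \<sigma> b"
| "tval \<sigma> (Leq a b) \<longleftrightarrow> oval \<sigma> a \<le> oval \<sigma> b"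

text \<open>\<open>exec W c \<sigma> t \<tau>\<close>: started in \<open>\<sigma>\<close>, the program \<open>c\<close> halts in \<open>\<tau>\<close> after \<open>t\<close> steps. Every
  elementary instruction and every test costs one step. The machine gets stuck when a value
  exceeding \<open>W\<close>, the largest value of a machine word, would be written.\<close>

inductive exec :: "nat \<Rightarrow> prog \<Rightarrow> state \<Rightarrow> nat \<Rightarrow> state \<Rightarrow> bool" for W where
  Skip: "exec W Skip \<sigma> 1 \<sigma>"
| Assign: "v = apply_op f (oval \<sigma> a) (oval \<sigma> b) \<Longrightarrow> v \<le> W \<Longrightarrow>
    exec W (Assign r f a b) \<sigma> 1 (\<sigma>\<lparr>regs := (regs \<sigma>)(r := v)\<rparr>)"
| Load: "v = arrs \<sigma> A (oval \<sigma> i) \<Longrightarrow> v \<le> W \<Longrightarrow>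
    exec W (Load r A i) \<sigma> 1 (\<sigma>\<lparr>regs := (regs \<sigma>)(r := v)\<rparr>)"
| Store: "v = oval \<sigma> a \<Longrightarrow> v \<le> W \<Longrightarrow>
    exec W (Store A i a) \<sigma> 1
      (\<sigma>\<lparr>arrs := (arrs \<sigma>)(A := (arrs \<sigma> A)(oval \<sigma> i := v))\<rparr>)"
| Seq: "exec W c1 \<sigma> t1 \<sigma>' \<Longrightarrow> exec W c2 \<sigma>' t2 \<tau> \<Longrightarrow> exec W (Seq c1 c2) \<sigma> (t1 + t2) \<tau>"
| CondTrue: "tval \<sigma> b \<Longrightarrow> exec W c1 \<sigma> t \<tau> \<Longrightarrow> exec W (Cond b c1 c2) \<sigma> (Suc t) \<tau>"
| CondFalse: "\<not> tval \<sigma> b \<Longrightarrow> exec W c2 \<sigma> t \<tau> \<Longrightarrow> exec W (Cond b c1 c2) \<sigma> (Suc t) \<tau>"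
| WhileFalse: "\<not> tval \<sigma> b \<Longrightarrow> exec W (While b c) \<sigma> 1 \<sigma>"
| WhileTrue: "tval \<sigma> b \<Longrightarrow> exec W c \<sigma> t1 \<sigma>' \<Longrightarrow> exec W (While b c) \<sigma>' t2 \<tau> \<Longrightarrow>
    exec W (While b c) \<sigma> (Suc (t1 + t2)) \<tau>"

definition init_state :: "nat list \<Rightarrow> state" where
  "init_state xs =
     \<lparr> regs = (\<lambda>_. 0),
       arrs = (\<lambda>A i. if A = ''in'' \<and> i < length xs then xs ! i else 0) \<rparr>"

text \<open>Words of \<open>d * log\<^sub>2 N\<close> bits, where \<open>N\<close> bounds the length of the input and the numbers
  in it.\<close>

definition word_bound :: "nat \<Rightarrow> nat list \<Rightarrow> nat" where
  "word_bound d xs = (length xs + sum_list xs + 2) ^ d"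

definition decides_within :: "nat \<Rightarrow> prog \<Rightarrow> nat list \<Rightarrow> nat \<Rightarrow> bool \<Rightarrow> bool" where
  "decides_within d c xs T answer \<longleftrightarrow>
     (\<exists>t \<tau>. exec (word_bound d xs) c (init_state xs) t \<tau> \<and> t \<le> T \<and>
            regs \<tau> ''out'' = (if answer then 1 else 0))"

text \<open>A graph on the vertices \<open>0, \<dots>, n - 1\<close> is given by \<open>n\<close>, \<open>m\<close> and its edges, listed once each
  in an arbitrary order and with arbitrary orientation.\<close>

definition encodes :: "nat ugraph \<Rightarrow> nat list \<Rightarrow> bool" where
  "encodes G xs \<longleftrightarrow>
     (\<exists>n es. verts G = {..<n} \<and>
        distinct (map (\<lambda>(u, v). {u, v}) es) \<and> edges G = set (map (\<lambda>(u, v). {u, v}) es) \<and>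
        xs = n # length es # concat (map (\<lambda>(u, v). [u, v]) es))"

text \<open>The bound \<open>O(m\<^sup>4 n\<^sup>3)\<close>. An edgeless graph would have time bound 0, which no program meets;
  hence the maximum with 1, which has no effect when \<open>m \<ge> 1\<close>.\<close>

definition time_bound :: "nat \<Rightarrow> nat ugraph \<Rightarrow> nat" where
  "time_bound C G = C * max 1 (card (edges G) ^ 4 * card (verts G) ^ 3)"

end

theory Submission
  imports Defs
begin

text \<open>A graph can be contracted to diameter at most \<open>s\<close> with \<open>k\<close> edges iff some \<open>k\<close> edges can be made
  free such that any two vertices are joined by a walk with at most \<open>s\<close> non-free edges. The key fact
  is that on AT-free graphs only \<open>O(m\<^sup>4)\<close> edge sets have to be tried: four edges, possibly
  together with a shortest path from the second to the third of them.

  A connected AT-free graph has a dominating pair \<open>x\<close>, \<open>y\<close>: every \<open>x\<close>-\<open>y\<close> walk meets every closed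
  neighbourhood. Take a walk from \<open>x\<close> to \<open>y\<close> that is shortest when the edges of a solution are free.
  At most \<open>s\<close> of its edges are not free, so its length is at most \<open>k + s\<close>. It then suffices to make
  one block of at most \<open>k\<close> consecutive edges of the walk free, positioned such that the neighbours of \<open>x\<close> and
  of \<open>y\<close> are close enough to it. Only the first two and the last two edges of the block matter:
  between them, any shortest path does as well. The delicate cases are those in which the solution
  forms a block of \<open>k - 2\<close> edges at one end of the walk.

  Each of the \<open>16 m\<^sup>4\<close> quadruples of directed edges is tested in \<open>O(n\<^sup>3)\<close> steps by the
  Floyd-Warshall algorithm.\<close>

section \<open>Walks with free edges\<close>

text \<open>With \<open>k\<close> the size of the solution, a cheapest walk without repetitions has
  as many edges as it has solution edges plus its cost. If \<open>d x y + 2 \<le> k + s\<close>, the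
  solution is not consulted at all: a block at the start of any geodesic leaves a spare step for
  each end. Otherwise the count is tight: at most one solution edge is off the walk, and the walk
  costs \<open>s\<close> or \<open>s - 1\<close>. The obstacle is the neighbours of \<open>x\<close>
  and \<open>y\<close>. A vertex near an inner vertex of the walk is no farther from the block than
  the end of the walk is; a neighbour of \<open>x\<close> may be one step farther, which is too
  much. The solution shows where the block must begin: a neighbour of \<open>x\<close> also reaches
  \<open>y\<close> at cost \<open>s\<close>, so, if the walk costs \<open>s\<close> and no edge off
  it helps, its distance to some position of the walk is at most the number of paid edges before
  that position. As the walk is nearly shortest, at most two free edges precede the position, which
  is why two edges are fixed at each end of the block. If all paid edges lie on one side, no block
  with paid edges on both sides is available, and the candidate may have to be the solution
  itself.\<close>

text \<open>\<open>reach G F u c v\<close>: some \<open>u\<close>-\<open>v\<close> walk has at most \<open>c\<close> edges outside \<open>F\<close>.\<close>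

inductive reach :: "'a ugraph \<Rightarrow> 'a set set \<Rightarrow> 'a \<Rightarrow> nat \<Rightarrow> 'a \<Rightarrow> bool" for G F u where
  stay: "u \<in> verts G \<Longrightarrow> reach G F u c u"
| free: "reach G F u c v \<Longrightarrow> w \<in> verts G \<Longrightarrow> adj G v w \<Longrightarrow> {v, w} \<in> F \<Longrightarrow> reach G F u c w"
| pay: "reach G F u c v \<Longrightarrow> w \<in> verts G \<Longrightarrow> adj G v w \<Longrightarrow> reach G F u (Suc c) w"

lemma adj_commute: "adj G u v \<longleftrightarrow> adj G v u"
  by (simp add: adj_def insert_commute)

lemma reach_verts:
  assumes "reach G F u c v" shows "u \<in> verts G" "v \<in> verts G"
  using assms by (induction, auto)

lemma reach_mono:
  assumes "reach G F u c v" "c \<le> c'" "F \<subseteq> F'" shows "reach G F' u c' v"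
  using assms
proof (induction arbitrary: c' rule: reach.induct)
  case (stay c) then show ?case by (simp add: reach.stay)
next
  case (free c v w) then show ?case by (meson reach.free subsetD)
next
  case (pay c v w)
  then obtain c'' where "c' = Suc c''" "c \<le> c''" by (cases c') auto
  with pay show ?case by (meson reach.pay)
qed

lemma reach_trans:
  assumes "reach G F v c' w" "reach G F u c v" shows "reach G F u (c + c') w"
  using assms
proof (induction rule: reach.induct)
  case (stay c') then show ?case by (meson reach_mono le_add1 order_refl)
next
  case (free c v w) then show ?case by (blast intro: reach.free)
next
  case (pay c v w) then show ?case by (auto intro: reach.pay)
qed

lemma reach_sym:
  assumes "reach G F u c v" shows "reach G F v c u"
  using assms
proof (induction rule: reach.induct)
  case (stay c) then show ?case by (rule reach.stay)
next
  case (free c v w)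
  have "reach G F w 0 v"
    using free reach.free[OF reach.stay[of w G F 0], of v]
    by (metis adj_commute insert_commute reach_verts(2))
  from reach_trans[OF free.IH this] show ?case by simp
next
  case (pay c v w)
  have "reach G F w (Suc 0) v"
    using pay reach.pay[OF reach.stay[of w G F 0], of v]
    by (metis adj_commute reach_verts(2))
  from reach_trans[OF pay.IH this] show ?case by simp
qed

definition walk :: "'a ugraph \<Rightarrow> (nat \<Rightarrow> 'a) \<Rightarrow> nat \<Rightarrow> bool" where
  "walk G p l \<longleftrightarrow> (\<forall>i\<le>l. p i \<in> verts G) \<and> (\<forall>i<l. adj G (p i) (p (Suc i)))"

text \<open>Counting on prefixes makes the cost of a segment a difference of two values, and lets
  positions of a walk be compared with the number of paid edges before them.\<close>

definition gaps :: "'a set set \<Rightarrow> (nat \<Rightarrow> 'a) \<Rightarrow> nat \<Rightarrow> nat" where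
  "gaps F p j = card {i. i < j \<and> {p i, p (Suc i)} \<notin> F}"

lemma walkD: "walk G p l \<Longrightarrow> i \<le> l \<Longrightarrow> p i \<in> verts G"
  "walk G p l \<Longrightarrow> i < l \<Longrightarrow> adj G (p i) (p (Suc i))"
  by (auto simp: walk_def)

lemma gaps_0 [simp]: "gaps F p 0 = 0"
  by (simp add: gaps_def)

lemma gaps_Suc: "gaps F p (Suc j) = gaps F p j + (if {p j, p (Suc j)} \<in> F then 0 else 1)"
proof -
  have "{i. i < Suc j \<and> {p i, p (Suc i)} \<notin> F} =
    {i. i < j \<and> {p i, p (Suc i)} \<notin> F} \<union> (if {p j, p (Suc j)} \<in> F then {} else {j})"
    by (auto simp: less_Suc_eq)
  then show ?thesis by (simp add: gaps_def)
qed

lemma gaps_mono: "i \<le> j \<Longrightarrow> gaps F p i \<le> gaps F p j"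
  by (rule lift_Suc_mono_le[of "gaps F p"]) (auto simp: gaps_Suc)

lemma gaps_add: "gaps F p (i + n) \<le> gaps F p i + n"
  by (induction n) (auto simp: gaps_Suc)

lemma gaps_diff: "i \<le> j \<Longrightarrow> gaps F p j \<le> gaps F p i + (j - i)"
  using gaps_add[of F p i "j - i"] by simp

lemma gaps_le: "gaps F p j \<le> j"
  using gaps_diff[of 0 j F p] by simp

lemma gaps_empty [simp]: "gaps {} p j = j"
  by (induction j) (auto simp: gaps_Suc)

lemma gaps_mem: "i \<le> j \<Longrightarrow> gaps F p j = gaps F p i \<Longrightarrow> i \<le> t \<Longrightarrow> t < j \<Longrightarrow> {p t, p (Suc t)} \<in> F"
  using gaps_mono[of i t F p] gaps_mono[of "Suc t" j F p] gaps_Suc[of F p t]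
  by (auto split: if_splits)

lemma gaps_cong: "(\<And>i. i \<le> j \<Longrightarrow> p i = q i) \<Longrightarrow> gaps F p j = gaps F q j"
  unfolding gaps_def by (rule arg_cong[of _ _ card]) auto

lemma gaps_shift: "gaps F (\<lambda>t. p (i + t)) n + gaps F p i = gaps F p (i + n)"
  by (induction n) (auto simp: gaps_Suc)

lemma gaps_rev:
  assumes "j \<le> l"
  shows "gaps F (\<lambda>i. p (l - i)) j + gaps F p (l - j) = gaps F p l"
  using assms
proof (induction j)
  case (Suc j)
  have e: "l - j = Suc (l - Suc j)" using Suc.prems by simp
  have "gaps F p (l - j) = gaps F p (l - Suc j) + (if {p (l - j), p (l - Suc j)} \<in> F then 0 else 1)"
    unfolding e gaps_Suc by (simp add: insert_commute)
  with Suc show ?case by (auto simp: gaps_Suc)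
qed simp

lemma walk_rev: "walk G p l \<Longrightarrow> walk G (\<lambda>i. p (l - i)) l"
  unfolding walk_def
proof (intro conjI allI impI; elim conjE)
  fix i assume "\<forall>i<l. adj G (p i) (p (Suc i))" "i < l"
  then have "adj G (p (l - Suc i)) (p (Suc (l - Suc i)))" by auto
  moreover have "Suc (l - Suc i) = l - i" using \<open>i < l\<close> by simp
  ultimately show "adj G (p (l - i)) (p (l - Suc i))" by (simp add: adj_commute)
qed auto

lemma reach_walk:
  assumes "walk G p l" "i \<le> j" "j \<le> l"
  shows "reach G F (p i) (gaps F p j - gaps F p i) (p j)"
  using assms(2,3)
proof (induction j)
  case 0 then show ?case using walkD(1)[OF assms(1)] by (auto intro: reach.stay)
next
  case (Suc j)
  show ?case
  proof (cases "i = Suc j")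
    case True then show ?thesis using walkD(1)[OF assms(1)] Suc by (auto intro: reach.stay)
  next
    case False
    then have ij: "i \<le> j" using Suc.prems by simp
    then have r: "reach G F (p i) (gaps F p j - gaps F p i) (p j)" using Suc by simp
    have a: "adj G (p j) (p (Suc j))" "p (Suc j) \<in> verts G"
      using walkD[OF assms(1)] Suc.prems by auto
    show ?thesis
    proof (cases "{p j, p (Suc j)} \<in> F")
      case True then show ?thesis using reach.free[OF r a(2,1)] by (simp add: gaps_Suc)
    next
      case False
      then show ?thesis using reach.pay[OF r a(2,1)] gaps_mono[OF ij, of F p]
        by (simp add: gaps_Suc Suc_diff_le)
    qed
  qed
qed

lemma reach_imp_walk:
  assumes "reach G F u c v"
  shows "\<exists>p l. walk G p l \<and> p 0 = u \<and> p l = v \<and> gaps F p l \<le> c"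
  using assms
proof (induction rule: reach.induct)
  case (stay c)
  then have "walk G (\<lambda>_. u) 0" by (simp add: walk_def)
  then show ?case by (metis gaps_0 le0)
next
  case (free c v w)
  then obtain p l where p: "walk G p l" "p 0 = u" "p l = v" "gaps F p l \<le> c" by blast
  have "gaps F (p(Suc l := w)) l = gaps F p l" by (rule gaps_cong) simp
  then have "walk G (p(Suc l := w)) (Suc l) \<and> (p(Suc l := w)) 0 = u \<and> (p(Suc l := w)) (Suc l) = w \<and>
    gaps F (p(Suc l := w)) (Suc l) \<le> c"
    using p free by (auto simp: gaps_Suc walk_def less_Suc_eq le_Suc_eq)
  then show ?case by blast
next
  case (pay c v w)
  then obtain p l where p: "walk G p l" "p 0 = u" "p l = v" "gaps F p l \<le> c" by blast
  have "gaps F (p(Suc l := w)) l = gaps F p l" by (rule gaps_cong) simp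
  then have "walk G (p(Suc l := w)) (Suc l) \<and> (p(Suc l := w)) 0 = u \<and> (p(Suc l := w)) (Suc l) = w \<and>
    gaps F (p(Suc l := w)) (Suc l) \<le> Suc c"
    using p pay by (auto simp: gaps_Suc walk_def less_Suc_eq le_Suc_eq)
  then show ?case by blast
qed

text \<open>One crossing of the new free edge suffices: if the walk returns to the endpoint from
  which it first crossed, the excursion is dropped, and if it crosses in the same direction again,
  everything between the two crossings is dropped.\<close>

lemma reach_insert:
  assumes "reach G (insert {a, b} F) u c v"
  shows "reach G F u c v \<or>
    (\<exists>e f c1 c2. {e, f} = {a, b} \<and> reach G F u c1 e \<and> reach G F f c2 v \<and> c1 + c2 \<le> c)"
  using assms
proof (induction rule: reach.induct)
  case (stay c) then show ?case by (simp add: reach.stay)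
next
  case (free c v w)
  show ?case
  proof (cases "{v, w} \<in> F")
    case True
    with free show ?thesis by (meson reach.free)
  next
    case False
    then have vw: "{v, w} = {a, b}" using free by auto
    have w: "reach G F w 0 w" using free by (simp add: reach.stay)
    from free.IH show ?thesis
    proof (elim disjE exE conjE)
      assume "reach G F u c v"
      then show ?thesis using vw w by (intro disjI2 exI[of _ v] exI[of _ w] exI[of _ c] exI[of _ 0]) simp
    next
      fix e f c1 c2 assume e: "{e, f} = {a, b}" "reach G F u c1 e" "c1 + c2 \<le> c"
      show ?thesis
      proof (cases "w = e")
        case True then show ?thesis using e reach_mono[of G F u c1 e c F] by auto
      next
        case False
        then have "{e, w} = {a, b}" using e(1) vw by (auto simp: doubleton_eq_iff)
        then show ?thesis using e w by (intro disjI2 exI[of _ e] exI[of _ w] exI[of _ c1] exI[of _ 0]) simp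
      qed
    qed
  qed
next
  case (pay c v w)
  from pay.IH show ?case
  proof (elim disjE exE conjE)
    assume "reach G F u c v" then show ?thesis using pay by (blast intro: reach.pay)
  next
    fix e f c1 c2 assume "{e, f} = {a, b}" "reach G F u c1 e" "reach G F f c2 v" "c1 + c2 \<le> c"
    moreover then have "reach G F f (Suc c2) w" using pay by (blast intro: reach.pay)
    ultimately show ?thesis by (metis add_Suc_right Suc_le_mono)
  qed
qed

section \<open>Costs and distances in a connected graph\<close>

locale cgraph =
  fixes G :: "'a ugraph"
  assumes simple: "simple_graph G"
    and conn: "u \<in> verts G \<Longrightarrow> v \<in> verts G \<Longrightarrow> \<exists>c. reach G {} u c v"
begin

abbreviation "V \<equiv> verts G"

text \<open>Connectedness makes the least cost a natural number, so that the later estimates are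
  linear arithmetic. Without free edges it is the ordinary distance \<open>d\<close>.\<close>

definition h :: "'a set set \<Rightarrow> 'a \<Rightarrow> 'a \<Rightarrow> nat" where
  "h F u v = (LEAST c. reach G F u c v)"

abbreviation "d \<equiv> h {}"

lemma fin_V: "finite V" using simple by (simp add: simple_graph_def)

lemma fin_edges: "finite (edges G)"
  using simple by (auto simp: simple_graph_def intro: finite_subset[of _ "Pow V"])

lemma adj_V: "adj G u v \<Longrightarrow> u \<in> V" "adj G u v \<Longrightarrow> v \<in> V" "adj G u v \<Longrightarrow> u \<noteq> v"
  using simple by (fastforce simp: simple_graph_def adj_def)+

lemma h_le_iff: "u \<in> V \<Longrightarrow> v \<in> V \<Longrightarrow> h F u v \<le> c \<longleftrightarrow> reach G F u c v"
proof
  assume uv: "u \<in> V" "v \<in> V"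
  then obtain c0 where "reach G {} u c0 v" using conn by blast
  then have "reach G F u c0 v" by (rule reach_mono) auto
  then have "reach G F u (h F u v) v" unfolding h_def by (rule LeastI)
  moreover assume "h F u v \<le> c"
  ultimately show "reach G F u c v" by (auto intro: reach_mono)
next
  assume "reach G F u c v"
  then show "h F u v \<le> c" unfolding h_def by (rule Least_le)
qed

lemma h_reach: "u \<in> V \<Longrightarrow> v \<in> V \<Longrightarrow> reach G F u (h F u v) v"
  using h_le_iff by blast

lemma h_refl [simp]: "u \<in> V \<Longrightarrow> h F u u = 0"
  using h_le_iff[of u u F 0] by (simp add: reach.stay)

lemma h_sym: "u \<in> V \<Longrightarrow> v \<in> V \<Longrightarrow> h F u v = h F v u"
  by (meson h_le_iff h_reach reach_sym order_antisym)

lemma h_tri: "u \<in> V \<Longrightarrow> v \<in> V \<Longrightarrow> w \<in> V \<Longrightarrow> h F u w \<le> h F u v + h F v w"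
  by (meson h_le_iff h_reach reach_trans)

lemma h_mono: "u \<in> V \<Longrightarrow> v \<in> V \<Longrightarrow> F \<subseteq> F' \<Longrightarrow> h F' u v \<le> h F u v"
  by (meson h_le_iff h_reach reach_mono order_refl)

lemma h_adj: "adj G u v \<Longrightarrow> h F u v \<le> 1"
  using h_le_iff[of u v F 1] adj_V reach.pay[OF reach.stay[of u G F 0], of v] by auto

lemma h_free: "adj G u v \<Longrightarrow> {u, v} \<in> F \<Longrightarrow> h F u v = 0"
  using h_le_iff[of u v F 0] adj_V reach.free[OF reach.stay[of u G F 0], of v] by auto

lemma d_0: "u \<in> V \<Longrightarrow> v \<in> V \<Longrightarrow> d u v = 0 \<longleftrightarrow> u = v"
proof
  assume "u \<in> V" "v \<in> V" "d u v = 0"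
  then have "reach G {} u 0 v" using h_le_iff[of u v "{}" 0] by simp
  then show "u = v" by (cases rule: reach.cases) auto
qed simp

lemma d_1: "u \<in> V \<Longrightarrow> v \<in> V \<Longrightarrow> d u v \<le> 1 \<longleftrightarrow> u = v \<or> adj G u v"
proof
  assume uv: "u \<in> V" "v \<in> V" "d u v \<le> 1"
  then have "reach G {} u 1 v" using h_le_iff by blast
  then show "u = v \<or> adj G u v"
  proof (cases rule: reach.cases)
    case (pay c w)
    then have "d u w = 0" using h_le_iff uv reach_verts[OF pay(2)] by fastforce
    then show ?thesis using pay uv d_0 reach_verts[OF pay(2)] by auto
  qed auto
next
  assume "u \<in> V" "v \<in> V" "u = v \<or> adj G u v" then show "d u v \<le> 1" using h_adj by auto
qed

lemma h_walk:
  assumes "walk G p l" "i \<le> j" "j \<le> l"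
  shows "h F (p i) (p j) + gaps F p i \<le> gaps F p j"
  using h_le_iff[of "p i" "p j" F "gaps F p j - gaps F p i"] reach_walk[OF assms]
    walkD(1)[OF assms(1)] assms gaps_mono[OF assms(2), of F p] by auto

lemma d_walk: "walk G p l \<Longrightarrow> i \<le> j \<Longrightarrow> j \<le> l \<Longrightarrow> d (p i) (p j) + i \<le> j"
  using h_walk[of p l i j "{}"] by simp

lemma geodesic_ex:
  assumes "u \<in> V" "v \<in> V"
  shows "\<exists>p. walk G p (d u v) \<and> p 0 = u \<and> p (d u v) = v"
proof -
  obtain p l where p: "walk G p l" "p 0 = u" "p l = v" "l \<le> d u v"
    using reach_imp_walk[OF h_reach[OF assms, of "{}"]] by auto
  moreover have "d u v \<le> l" using d_walk[OF p(1), of 0 l] p by simp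
  ultimately show ?thesis by auto
qed

end

lemma finite_arg_max_ex:
  fixes f :: "'b \<Rightarrow> nat"
  assumes "finite A" "A \<noteq> {}"
  shows "\<exists>x\<in>A. \<forall>y\<in>A. f y \<le> f x"
proof -
  have "Max (f ` A) \<in> f ` A" using assms by simp
  then obtain x where "x \<in> A" "Max (f ` A) = f x" by blast
  moreover have "f y \<le> Max (f ` A)" if "y \<in> A" for y using assms that by simp
  ultimately show ?thesis by auto
qed

lemma successively_snoc: "successively P (xs @ [y]) \<longleftrightarrow> successively P xs \<and> (xs = [] \<or> P (last xs) y)"
  by (auto simp: successively_append_iff)

lemma path_reach:
  assumes "path_between H u p v"
  shows "reach H {} u (length p - 1) v"
proof -
  have "successively (adj H) p \<Longrightarrow> set p \<subseteq> verts H \<Longrightarrow> p \<noteq> [] \<Longrightarrow> reach H {} (hd p) (length p - 1) (last p)"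
  proof (induction p rule: rev_induct)
    case (snoc y ys)
    show ?case
    proof (cases "ys = []")
      case True then show ?thesis using snoc by (auto intro: reach.stay)
    next
      case False
      then have "reach H {} (hd ys) (length ys - 1) (last ys)" "adj H (last ys) y" "y \<in> verts H"
        using snoc by (auto simp: successively_snoc)
      then have "reach H {} (hd ys) (Suc (length ys - 1)) y" using reach.pay by metis
      then show ?thesis using False by simp
    qed
  qed simp
  then show ?thesis using assms by (auto simp: path_between_def)
qed

text \<open>When the walk returns to a vertex of the path built so far, the path is cut there; it
  stays free of repetitions and only gets shorter.\<close>

lemma reach_path:
  assumes "reach H {} u c v"
  shows "\<exists>p. path_between H u p v \<and> length p - 1 \<le> c"
  using assms
proof (induction rule: reach.induct)
  case (stay c)
  then have "path_between H u [u] u" by (simp add: path_between_def)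
  then show ?case by fastforce
next
  case (free c v w) then show ?case by simp
next
  case (pay c v w)
  then obtain p where p: "path_between H u p v" "length p - 1 \<le> c" by blast
  show ?case
  proof (cases "w \<in> set p")
    case True
    then obtain ys zs where yz: "p = ys @ w # zs" by (auto simp: in_set_conv_decomp)
    have "path_between H u (ys @ [w]) w"
      using p(1) unfolding path_between_def yz
      by (cases ys) (auto simp: successively_append_iff successively_Cons hd_append split: if_splits)
    moreover have "length (ys @ [w]) - 1 \<le> Suc c" using p(2) yz by simp
    ultimately show ?thesis by blast
  next
    case False
    then have "path_between H u (p @ [w]) w"
      using p(1) pay unfolding path_between_def by (auto simp: successively_snoc)
    moreover have "length (p @ [w]) - 1 \<le> Suc c" using p(2) by simp
    ultimately show ?thesis by blast
  qed
qed

section \<open>Walks avoiding a closed neighbourhood, and dominating pairs\<close>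

context cgraph
begin

definition near :: "'a \<Rightarrow> 'a \<Rightarrow> bool" where
  "near z v \<longleftrightarrow> z = v \<or> adj G z v"

lemma near_commute: "near z v \<longleftrightarrow> near v z"
  by (auto simp: near_def adj_commute)

lemma near_self [simp]: "near z z" by (simp add: near_def)

text \<open>Deleting the closed neighbourhood turns avoidance into plain reachability, so that the
  facts on \<open>reach\<close> apply to it.\<close>

definition miss :: "'a \<Rightarrow> 'a ugraph" where
  "miss z = \<lparr>verts = {v \<in> V. \<not> near z v}, edges = {e \<in> edges G. \<forall>v\<in>e. \<not> near z v}\<rparr>"

text \<open>\<open>av z u v\<close>: some \<open>u\<close>-\<open>v\<close> walk avoids the closed neighbourhood of \<open>z\<close>.\<close>

definition av :: "'a \<Rightarrow> 'a \<Rightarrow> 'a \<Rightarrow> bool" where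
  "av z u v \<longleftrightarrow> (\<exists>c. reach (miss z) {} u c v)"

lemma av_refl: "u \<in> V \<Longrightarrow> \<not> near z u \<Longrightarrow> av z u u"
  unfolding av_def by (intro exI[of _ 0] reach.stay) (simp add: miss_def)

lemma av_sym: "av z u v \<Longrightarrow> av z v u"
  unfolding av_def by (meson reach_sym)

lemma av_trans: "av z u v \<Longrightarrow> av z v w \<Longrightarrow> av z u w"
  unfolding av_def by (meson reach_trans)

lemma avD: assumes "av z u v" shows "u \<in> V" "v \<in> V" "\<not> near z u" "\<not> near z v"
  using assms reach_verts unfolding av_def by (fastforce simp: miss_def)+

lemma adj_miss: "adj (miss z) u v \<longleftrightarrow> adj G u v \<and> \<not> near z u \<and> \<not> near z v"
  by (auto simp: adj_def miss_def)

lemma av_step: "av z u v \<Longrightarrow> adj G v w \<Longrightarrow> \<not> near z w \<Longrightarrow> av z u w"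
proof -
  assume a: "av z u v" "adj G v w" "\<not> near z w"
  then obtain c where "reach (miss z) {} u c v" by (auto simp: av_def)
  moreover have "w \<in> verts (miss z)" using a adj_V(2)[of v w] by (simp add: miss_def)
  moreover have "adj (miss z) v w" using a avD(4)[OF a(1)] by (simp add: adj_miss)
  ultimately show "av z u w" unfolding av_def by (blast intro: reach.pay)
qed

lemma av_walk:
  assumes "walk G p l" "i \<le> j" "j \<le> l" "\<And>t. i \<le> t \<Longrightarrow> t \<le> j \<Longrightarrow> \<not> near z (p t)"
  shows "av z (p i) (p j)"
  using assms(2-4)
proof (induction j)
  case (Suc j)
  show ?case
  proof (cases "i = Suc j")
    case True then show ?thesis using Suc.prems walkD(1)[OF assms(1)] by (auto intro: av_refl)
  next
    case False
    then have "av z (p i) (p j)" using Suc by simp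
    then show ?thesis using av_step walkD(2)[OF assms(1), of j] Suc.prems by auto
  qed
qed (use walkD(1)[OF assms(1)] in \<open>auto intro: av_refl\<close>)

text \<open>The walk from \<open>z\<close> to \<open>x\<close> that avoids \<open>w\<close> must
  meet the closed neighbourhood of \<open>y\<close>, as otherwise it would avoid \<open>y\<close>
  too. A vertex where it does so is still joined to \<open>x\<close> within that walk.\<close>

lemma av_hit:
  assumes "av w z x" "\<not> av y z x"
  shows "\<exists>q. av w q x \<and> near y q"
proof -
  obtain c where "reach (miss w) {} z c x" using assms by (auto simp: av_def)
  then have "av y z x \<or> (\<exists>q. av w z q \<and> near y q)"
  proof (induction rule: reach.induct)
    case (stay c)
    then have "z \<in> V" "\<not> near w z" by (auto simp: miss_def)
    then show ?case using av_refl[of z] by (cases "near y z") auto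
  next
    case (free c v v') then show ?case by simp
  next
    case (pay c v v')
    then have "av w z v'" unfolding av_def by (blast intro: reach.pay)
    then show ?case using pay av_step[of y z v v'] by (auto simp: adj_miss)
  qed
  then show ?thesis using assms av_sym av_trans by blast
qed

lemma av_path: "av z u v \<Longrightarrow> \<exists>p. path_between G u p v \<and> set p \<inter> nbhd G z = {}"
proof -
  assume "av z u v"
  then obtain c where "reach (miss z) {} u c v" by (auto simp: av_def)
  then obtain p where p: "path_between (miss z) u p v" using reach_path by metis
  have "successively (adj G) p"
    by (rule successively_mono[of "adj (miss z)"]) (use p in \<open>auto simp: path_between_def adj_miss\<close>)
  then have "path_between G u p v \<and> set p \<inter> nbhd G z = {}"
    using p by (auto simp: path_between_def miss_def nbhd_def near_def)
  then show ?thesis by blast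
qed

text \<open>The connected component of \<open>z\<close> after deletion of the closed neighbourhood
  of \<open>x\<close>; it is empty if \<open>z\<close> is itself deleted.\<close>

definition comp :: "'a \<Rightarrow> 'a \<Rightarrow> 'a set" where
  "comp x z = {w. av x z w}"

text \<open>If walks from \<open>x\<close> to \<open>u\<close> and to \<open>v\<close> avoid the neighbourhoods of \<open>v\<close> and \<open>u\<close>, then passing from
  \<open>x\<close> to \<open>u\<close> adds \<open>x\<close> to the component of \<open>v\<close>; with powers of two as weights, this makes up for the
  loss of the component of \<open>u\<close>.\<close>

definition weight :: "'a \<Rightarrow> nat" where
  "weight x = (\<Sum>z \<in> {z \<in> V. \<not> near x z}. 2 ^ card (comp x z))"

lemma comp_sub: "comp x z \<subseteq> {z \<in> V. \<not> near x z}"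
  using avD by (auto simp: comp_def)

lemma fin_comp: "finite (comp x z)"
  using comp_sub fin_V by (auto intro: finite_subset)

lemma comp_eq: "w \<in> comp x z \<Longrightarrow> comp x w = comp x z"
  unfolding comp_def using av_sym av_trans by blast

text \<open>No vertex outside \<open>comp x u\<close> that survives the deletion around
  \<open>x\<close> is near \<open>u\<close>, so the other components persist, possibly enlarged,
  after the passage to \<open>u\<close>. That of \<open>v\<close> gains \<open>x\<close>, which at
  least doubles each of its terms; the surplus covers the loss of \<open>comp x u\<close>, which is
  no larger. The term of \<open>x\<close> itself makes the inequality strict.\<close>

lemma weight_less:
  assumes "av u v x" "av v u x" "\<not> av x u v" "card (comp x u) \<le> card (comp x v)"
  shows "weight x < weight u"
proof -
  let ?A = "{z \<in> V. \<not> near x z}" and ?B = "{z \<in> V. \<not> near u z}"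
  let ?cu = "card (comp x u)" and ?cv = "card (comp x v)"
  let ?R = "?A - comp x u - comp x v"
  have fin: "finite ?A" "finite ?B" using fin_V by auto
  have mem: "u \<in> ?A" "v \<in> ?A" "x \<in> ?B" using avD[OF assms(1)] avD[OF assms(2)] near_commute by blast+
  have in_u: "u \<in> comp x u" "v \<in> comp x v" using mem av_refl by (auto simp: comp_def)
  have dis: "comp x u \<inter> comp x v = {}"
    using assms(3) av_sym av_trans unfolding comp_def by blast
  have far: "\<not> near u w" if "w \<in> ?A" "w \<notin> comp x u" for w
    using that in_u(1) av_step[of x u u w] by (auto simp: near_def comp_def)
  have sub: "comp x z \<subseteq> comp u z" if z: "z \<in> ?A" "z \<notin> comp x u" for z
  proof
    fix w assume "w \<in> comp x z"
    then obtain c where "reach (miss x) {} z c w" by (auto simp: comp_def av_def)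
    then have "av u z w \<and> av x z w"
    proof (induction rule: reach.induct)
      case (stay c)
      then show ?case using z far[of z] by (auto intro: av_refl)
    next
      case (free c v w) then show ?case by simp
    next
      case (pay c v w)
      then have w: "av x z w" using av_step[of x z v w] by (auto simp: adj_miss)
      then have "w \<in> ?A" using avD[of x z w] by simp
      moreover have "w \<notin> comp x u"
        using z(2) w av_trans[of x u w z] av_sym[of x z w] by (auto simp: comp_def)
      ultimately show ?case using far[of w] w pay av_step[of u z v w] by (auto simp: adj_miss)
    qed
    then show "w \<in> comp u z" by (simp add: comp_def)
  qed
  have big: "Suc ?cv \<le> card (comp u z)" if z: "z \<in> comp x v" for z
  proof -
    have zA: "z \<in> ?A" "z \<notin> comp x u" using z dis comp_sub by blast+
    have "comp x z \<subseteq> comp u z" using sub[OF zA] .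
    moreover have "comp x z = comp x v" using comp_eq[OF z] .
    moreover have "av u z x"
    proof -
      have "v \<in> comp u z" using sub[OF zA] comp_eq[OF z] in_u(2) by blast
      then show ?thesis using av_trans[of u z v x] assms(1) by (simp add: comp_def)
    qed
    ultimately have "insert x (comp x v) \<subseteq> comp u z" by (auto simp: comp_def)
    moreover have "x \<notin> comp x v" using avD(4)[of x v x] by (auto simp: comp_def)
    ultimately show ?thesis using card_mono[OF fin_comp, of "insert x (comp x v)" u z] fin_comp by simp
  qed
  have split: "?A = ?R \<union> comp x u \<union> comp x v" using comp_sub by blast
  have "weight x = (\<Sum>z\<in>?R. 2 ^ card (comp x z)) + (\<Sum>z\<in>comp x u. 2 ^ card (comp x z))
      + (\<Sum>z\<in>comp x v. 2 ^ card (comp x z))"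
  proof -
    have "weight x = (\<Sum>z\<in>?R \<union> comp x u \<union> comp x v. 2 ^ card (comp x z))"
      unfolding weight_def by (rule sum.cong[OF split refl])
    also have "\<dots> = (\<Sum>z\<in>?R \<union> comp x u. 2 ^ card (comp x z)) + (\<Sum>z\<in>comp x v. 2 ^ card (comp x z))"
      by (rule sum.union_disjoint) (use fin fin_comp dis in blast)+
    also have "(\<Sum>z\<in>?R \<union> comp x u. 2 ^ card (comp x z)) =
        (\<Sum>z\<in>?R. 2 ^ card (comp x z)) + (\<Sum>z\<in>comp x u. 2 ^ card (comp x z) :: nat)"
      by (rule sum.union_disjoint) (use fin fin_comp in blast)+
    finally show ?thesis .
  qed
  also have "(\<Sum>z\<in>comp x u. 2 ^ card (comp x z)) = (\<Sum>z\<in>comp x u. 2 ^ ?cu)"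
    by (rule sum.cong) (auto simp: comp_eq)
  also have "(\<Sum>z\<in>comp x v. 2 ^ card (comp x z)) = (\<Sum>z\<in>comp x v. 2 ^ ?cv)"
    by (rule sum.cong) (auto simp: comp_eq)
  finally have wx: "weight x = (\<Sum>z\<in>?R. 2 ^ card (comp x z)) + ?cu * 2 ^ ?cu + ?cv * 2 ^ ?cv" by simp
  have "(\<Sum>z\<in>?R. 2 ^ card (comp x z)) \<le> (\<Sum>z\<in>?R. 2 ^ card (comp u z) :: nat)"
    by (intro sum_mono power_increasing card_mono fin_comp sub) auto
  moreover have "?cu * 2 ^ ?cu \<le> ?cv * 2 ^ ?cv" using assms(4) by (intro mult_mono) auto
  moreover have "2 * (?cv * 2 ^ ?cv) \<le> (\<Sum>z\<in>comp x v. 2 ^ card (comp u z))"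
  proof -
    have "(\<Sum>z\<in>comp x v. 2 ^ Suc ?cv) \<le> (\<Sum>z\<in>comp x v. 2 ^ card (comp u z) :: nat)"
      by (intro sum_mono power_increasing big) auto
    moreover have "(\<Sum>z\<in>comp x v. 2 ^ Suc ?cv) = 2 * (?cv * 2 ^ ?cv)" by (simp only: sum_constant power_Suc of_nat_id mult_ac)
    ultimately show ?thesis by simp
  qed
  moreover have "(0::nat) < 2 ^ card (comp u x)" by simp
  ultimately have "weight x < (\<Sum>z\<in>?R. 2 ^ card (comp u z)) + (\<Sum>z\<in>comp x v. 2 ^ card (comp u z))
      + 2 ^ card (comp u x)"
    unfolding wx by linarith
  also have "\<dots> = (\<Sum>z\<in>insert x (?R \<union> comp x v). 2 ^ card (comp u z))"
  proof -
    have "x \<notin> ?R \<union> comp x v" using avD(4)[of x v x] by (auto simp: comp_def)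
    then have "(\<Sum>z\<in>insert x (?R \<union> comp x v). 2 ^ card (comp u z)) =
      2 ^ card (comp u x) + (\<Sum>z\<in>?R \<union> comp x v. 2 ^ card (comp u z) :: nat)"
      by (intro sum.insert) (use fin fin_comp in blast)+
    also have "(\<Sum>z\<in>?R \<union> comp x v. 2 ^ card (comp u z) :: nat) =
      (\<Sum>z\<in>?R. 2 ^ card (comp u z)) + (\<Sum>z\<in>comp x v. 2 ^ card (comp u z))"
      by (intro sum.union_disjoint) (use fin fin_comp in blast)+
    finally show ?thesis by simp
  qed
  also have "\<dots> \<le> weight u"
    unfolding weight_def
  proof (rule sum_mono2)
    show "insert x (?R \<union> comp x v) \<subseteq> ?B"
      using mem far dis comp_sub by blast
  qed (use fin in auto)
  finally show ?thesis .
qed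

end

locale atgraph = cgraph +
  assumes AT: "AT_free G" and ne: "verts G \<noteq> {}"
begin

lemma no_AT: "\<not> (av z x y \<and> av y x z \<and> av x y z)"
proof
  assume *: "av z x y \<and> av y x z \<and> av x y z"
  let ?T = "{x, y, z}"
  have dist: "x \<noteq> y" "y \<noteq> z" "x \<noteq> z" and na: "\<not> adj G x y" "\<not> adj G y z" "\<not> adj G x z"
    using * avD unfolding near_def by (metis adj_commute)+
  have "?T \<subseteq> V" using * avD by blast
  moreover have "card ?T = 3" using dist by simp
  moreover have "\<forall>x\<in>?T. \<forall>y\<in>?T. \<not> adj G x y" using na adj_V(3) by (auto simp: adj_commute)
  moreover have "\<forall>a\<in>?T. \<forall>b\<in>?T. \<forall>c\<in>?T. a \<noteq> b \<and> b \<noteq> c \<and> a \<noteq> c \<longrightarrow>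
        (\<exists>p. path_between G a p b \<and> set p \<inter> nbhd G c = {})"
    using * av_sym av_path by (metis insertE singletonD)
  ultimately have "asteroidal_triple G ?T" unfolding asteroidal_triple_def by blast
  then show False using AT by (auto simp: AT_free_def)
qed

text \<open>A vertex of maximal weight qualifies. For a violating pair \<open>u\<close>,
  \<open>v\<close>, the absence of asteroidal triples puts \<open>u\<close> and \<open>v\<close>
  into different components around \<open>x\<close>, and passing to the one with the smaller
  component would increase the weight.\<close>

lemma admissible_ex: "\<exists>x\<in>V. \<forall>u v. \<not> (av u v x \<and> av v u x)"
proof -
  obtain x where x: "x \<in> V" "\<And>y. y \<in> V \<Longrightarrow> weight y \<le> weight x"
    using finite_arg_max_ex[OF fin_V ne, of weight] by blast
  have False if "av u v x" "av v u x" for u v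
  proof -
    have n: "\<not> av x u v" using no_AT[of x u v] that av_sym by blast
    then have n': "\<not> av x v u" using av_sym by blast
    have "u \<in> V" "v \<in> V" using that avD by blast+
    then show False
      using weight_less[OF that n] weight_less[OF that(2,1) n'] x(2)[of u] x(2)[of v] by linarith
  qed
  with x(1) show ?thesis by blast
qed

text \<open>With \<open>x\<close> admissible, \<open>y\<close> is chosen so that as many closed
  neighbourhoods as possible meet all \<open>y\<close>-\<open>x\<close> walks. If that of some
  \<open>z\<close> is missed, then \<open>z\<close> in place of \<open>y\<close> keeps all of them
  and adds its own, contradicting maximality.\<close>

lemma dominating_pair: "\<exists>x\<in>V. \<exists>y\<in>V. \<forall>z\<in>V. \<not> av z x y"
proof -
  obtain x where "x \<in> V" and adm: "\<forall>u v. \<not> (av u v x \<and> av v u x)"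
    using admissible_ex by (rule bexE)
  have x: "x \<in> V" by fact
  have adm: "\<not> av v u x" if "av u v x" for u v using adm that by simp
  define D where "D y = {z \<in> V. \<not> av z y x}" for y
  have finD: "finite (D y)" for y using fin_V by (simp add: D_def)
  obtain y where y: "y \<in> V" "\<And>z. z \<in> V \<Longrightarrow> card (D z) \<le> card (D y)"
    using finite_arg_max_ex[OF fin_V ne, of "\<lambda>y. card (D y)"] by blast
  have "\<not> av z y x" if "z \<in> V" for z
  proof
    assume zy: "av z y x"
    have yz: "\<not> av y z x" using adm[OF zy] .
    have "D y \<subseteq> D z"
    proof
      fix w assume w: "w \<in> D y"
      show "w \<in> D z"
      proof (rule ccontr)
        assume "w \<notin> D z"
        then have wz: "av w z x" using w by (auto simp: D_def)
        have zw: "\<not> av z w x" using adm[OF wz] .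
        \<comment> \<open>The walk from \<open>z\<close> to \<open>x\<close> avoids \<open>w\<close>
          but has to come near \<open>y\<close>. Were \<open>w\<close> not near \<open>y\<close>, it
          could be entered from \<open>y\<close>, against \<open>w \<in> D y\<close>. So
          \<open>w\<close> is adjacent to \<open>y\<close> and reaches \<open>x\<close> through
          \<open>y\<close> without coming near \<open>z\<close>, which admissibility
          forbids.\<close>
        obtain q where q: "av w q x" "near y q" using av_hit[OF wz yz] by blast
        have "near w y"
        proof (rule ccontr)
          assume "\<not> near w y"
          then have "av w x y"
            using av_step[OF av_sym[OF q(1)], of y] av_sym[OF q(1)] q(2)
            by (auto simp: near_def adj_commute)
          then have "av w y x" by (rule av_sym)
          then show False using w by (simp add: D_def)
        qed
        moreover have "w \<noteq> y" using wz yz by blast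
        ultimately have "adj G y w" by (simp add: near_def adj_commute)
        moreover have "\<not> near z w" using avD(3)[OF wz] near_commute by blast
        ultimately have "av z w x" using av_step[OF av_sym[OF zy], of w] av_sym by simp
        then show False using zw by blast
      qed
    qed
    moreover have "z \<in> D z" "z \<notin> D y" using that zy avD(3)[of z z x] by (auto simp: D_def)
    ultimately have "card (D y) < card (D z)" using finD by (intro psubset_card_mono) auto
    then show False using y(2)[OF that] by simp
  qed
  then show ?thesis using x y(1) av_sym by (meson)
qed

end

section \<open>Edge sets of walks\<close>

definition pe :: "'a \<times> 'a \<Rightarrow> 'a set" where
  "pe g = {fst g, snd g}"

definition pedges :: "(nat \<Rightarrow> 'a) \<Rightarrow> nat \<Rightarrow> 'a set set" where
  "pedges q l = (\<lambda>i. {q i, q (Suc i)}) ` {..<l}"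

lemma pedgesI: "i < l \<Longrightarrow> {q i, q (Suc i)} \<in> pedges q l"
  by (auto simp: pedges_def)

lemma gaps_0I: "(\<And>i. i < l \<Longrightarrow> {q i, q (Suc i)} \<in> F) \<Longrightarrow> gaps F q l = 0"
  by (induction l) (auto simp: gaps_Suc)

lemma card_pedges: "card (pedges q l) \<le> l"
  unfolding pedges_def using card_image_le[of "{..<l}"] by fastforce

lemma inj_pedge:
  assumes "inj_on q {..l}" "i < l" "j < l" "{q i, q (Suc i)} = {q j, q (Suc j)}"
  shows "i = j"
proof -
  have "q i = q j \<longleftrightarrow> i = j" "q i = q (Suc j) \<longleftrightarrow> i = Suc j" "q (Suc i) = q j \<longleftrightarrow> Suc i = j"
    using assms(1-3) by (auto simp: inj_on_eq_iff)
  then show ?thesis using assms(4) by (auto simp: doubleton_eq_iff)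
qed

text \<open>Without repeated vertices, positions of the walk correspond one to one to its edges, so
  solution edges can be counted by positions.\<close>

lemma card_pedges_gaps:
  assumes "inj_on q {..l}"
  shows "card (F \<inter> pedges q l) + gaps F q l = l"
proof -
  have "F \<inter> pedges q l = (\<lambda>i. {q i, q (Suc i)}) ` {i. i < l \<and> {q i, q (Suc i)} \<in> F}"
    by (auto simp: pedges_def)
  then have "card (F \<inter> pedges q l) = card {i. i < l \<and> {q i, q (Suc i)} \<in> F}"
    using inj_pedge[OF assms] by (simp add: card_image inj_on_def)
  moreover have "card {i. i < l \<and> {q i, q (Suc i)} \<in> F} + card {i. i < l \<and> {q i, q (Suc i)} \<notin> F} =
    card ({i. i < l \<and> {q i, q (Suc i)} \<in> F} \<union> {i. i < l \<and> {q i, q (Suc i)} \<notin> F})"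
    by (subst card_Un_disjoint) auto
  moreover have "{i. i < l \<and> {q i, q (Suc i)} \<in> F} \<union> {i. i < l \<and> {q i, q (Suc i)} \<notin> F} = {..<l}"
    by auto
  ultimately show ?thesis by (simp add: gaps_def)
qed

lemma pedges_rev: "pedges (\<lambda>i. q (l - i)) l = pedges q l"
proof -
  have sub: "pedges (\<lambda>i. r (l - i)) l \<subseteq> pedges r l" for r :: "nat \<Rightarrow> 'a"
  proof
    fix e assume "e \<in> pedges (\<lambda>i. r (l - i)) l"
    then obtain i where i: "i < l" "e = {r (l - i), r (l - Suc i)}" by (auto simp: pedges_def)
    then have "e = {r (l - Suc i), r (Suc (l - Suc i))}" by (auto simp: Suc_diff_Suc)
    then show "e \<in> pedges r l" using i by (metis pedgesI diff_Suc_less less_nat_zero_code not_gr_zero)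
  qed
  have "pedges q l = pedges (\<lambda>i. q (l - (l - i))) l"
    unfolding pedges_def by (rule image_cong) auto
  then show ?thesis using sub[of q] sub[of "\<lambda>i. q (l - i)"] by blast
qed

lemma small_set:
  assumes "finite F" "F \<noteq> {}" "card F \<le> 4"
  shows "\<exists>e1 e2 e3 e4. F = {e1, e2, e3, e4}"
proof -
  obtain f where f: "F = f ` {i::nat. i < card F}"
    using assms(1) finite_imp_nat_seg_image_inj_on[OF assms(1)]
    by (metis card_Collect_less_nat card_image)
  have "card F > 0" using assms by (simp add: card_gt_0_iff)
  \<comment> \<open>Indices beyond the last one are clamped to it, so a smaller set is listed with
    repetitions.\<close>
  have "F = {f 0, f (min 1 (card F - 1)), f (min 2 (card F - 1)), f (min 3 (card F - 1))}" (is "_ = ?R")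
  proof
    show "?R \<subseteq> F" using \<open>card F > 0\<close> by (subst (3) f) (auto intro!: imageI)
    show "F \<subseteq> ?R"
    proof
      fix e assume "e \<in> F"
      then obtain i where "i < card F" "e = f i" using f by blast
      moreover from this assms(3) have "i = 0 \<or> i = 1 \<or> i = 2 \<or> i = 3" by linarith
      ultimately show "e \<in> ?R" by (auto simp: min_def)
    qed
  qed
  then show ?thesis by blast
qed

section \<open>Cheapest walks and their first free edge\<close>

context cgraph
begin

lemma near_d: "u \<in> V \<Longrightarrow> v \<in> V \<Longrightarrow> near u v \<longleftrightarrow> d u v \<le> 1"
  using d_1[of u v] by (simp add: near_def)

text \<open>A cheap walk is cut at its first edge from \<open>F0\<close>; up to there only edges of
  \<open>F\<close> have been free. With \<open>F\<close> empty, the first part is measured by the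
  plain distance, which is how geometry enters the cost estimates.\<close>

lemma first_free_split:
  assumes "h (F0 \<union> F) u v \<le> c" "u \<in> V" "v \<in> V"
  shows "h F u v \<le> c \<or>
    (\<exists>a b. {a, b} \<in> F0 \<and> adj G a b \<and> h F u a + h (F0 \<union> F) b v \<le> c)"
proof -
  let ?H = "F0 \<union> F"
  have "reach G ?H u c v" using assms h_le_iff by blast
  then show ?thesis
  proof (induction rule: reach.induct)
    case (stay c) then show ?case by simp
  next
    case (free c v w)
    have v: "v \<in> V" "u \<in> V" using free reach_verts by metis+
    have w: "h ?H v w = 0" using h_free free by blast
    from free.IH show ?case
    proof (elim disjE exE conjE)
      assume hv: "h F u v \<le> c"
      show ?thesis
      proof (cases "{v, w} \<in> F0")
        case True then show ?thesis using free hv by (intro disjI2 exI[of _ v] exI[of _ w]) auto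
      next
        case False
        then have "h F v w = 0" using free h_free by blast
        then show ?thesis using h_tri[of u v w F] v free hv by auto
      qed
    next
      fix a b assume "{a, b} \<in> F0" "adj G a b" "h F u a + h ?H b v \<le> c"
      moreover have "h ?H b w \<le> h ?H b v + h ?H v w"
        using h_tri calculation(2) adj_V free v by metis
      ultimately show ?thesis using w by (intro disjI2 exI[of _ a] exI[of _ b]) auto
    qed
  next
    case (pay c v w)
    have v: "v \<in> V" "u \<in> V" using pay reach_verts by metis+
    from pay.IH show ?case
    proof (elim disjE exE conjE)
      assume "h F u v \<le> c" then show ?thesis
        using h_tri[of u v w F] h_adj[OF pay(3), of F] pay v by auto
    next
      fix a b assume "{a, b} \<in> F0" "adj G a b" "h F u a + h ?H b v \<le> c"
      moreover have "h ?H b w \<le> h ?H b v + h ?H v w"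
        using h_tri calculation(2) adj_V pay v by metis
      ultimately show ?thesis using h_adj[OF pay(3), of ?H]
        by (intro disjI2 exI[of _ a] exI[of _ b]) auto
    qed
  qed
qed

lemma first_free:
  assumes "h F u v \<le> c" "u \<in> V" "v \<in> V"
  shows "d u v \<le> c \<or> (\<exists>a b. {a, b} \<in> F \<and> adj G a b \<and> d u a + h F b v \<le> c)"
  using first_free_split[of F "{}" u v c] assms by simp

lemma h_insert:
  assumes "h (insert {a, b} F) u v \<le> c" "u \<in> V" "v \<in> V"
  shows "h F u v \<le> c \<or> (\<exists>e f. {e, f} = {a, b} \<and> e \<in> V \<and> f \<in> V \<and> h F u e + h F f v \<le> c)"
proof -
  have "reach G (insert {a, b} F) u c v" using assms h_le_iff by blast
  from reach_insert[OF this] show ?thesis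
  proof (elim disjE exE conjE)
    assume "reach G F u c v" then show ?thesis using assms h_le_iff by blast
  next
    fix e f c1 c2 assume *: "{e, f} = {a, b}" "reach G F u c1 e" "reach G F f c2 v" "c1 + c2 \<le> c"
    then have "e \<in> V" "f \<in> V" using reach_verts by metis+
    moreover have "h F u e \<le> c1" "h F f v \<le> c2" using * calculation assms h_le_iff by blast+
    ultimately show ?thesis using * by (intro disjI2 exI[of _ e] exI[of _ f]) auto
  qed
qed

text \<open>The new edge is crossed at most once, so paying for it adds at most one.\<close>

lemma h_insert_le:
  assumes "adj G a b" "u \<in> V" "v \<in> V"
  shows "h F u v \<le> h (insert {a, b} F) u v + 1"
  using h_insert[of a b F u v, OF order_refl assms(2,3)]
proof (elim disjE exE conjE)
  fix e f assume *: "{e, f} = {a, b}" "e \<in> V" "f \<in> V" "h F u e + h F f v \<le> h (insert {a, b} F) u v"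
  then have "adj G e f" using assms(1) by (simp add: adj_def)
  then have "h F e f \<le> 1" by (rule h_adj)
  moreover have "h F u v \<le> h F u e + h F e v" "h F e v \<le> h F e f + h F f v" using h_tri * assms by blast+
  ultimately show ?thesis using * by linarith
qed auto

text \<open>A cheaper way between two positions of the walk would make the whole walk
  cheaper.\<close>

lemma h_opt:
  assumes "walk G p l" "h F (p 0) (p l) = gaps F p l" "i \<le> j" "j \<le> l"
  shows "h F (p i) (p j) + gaps F p i = gaps F p j"
proof -
  have "h F (p 0) (p l) \<le> h F (p 0) (p i) + h F (p i) (p l)"
    "h F (p i) (p l) \<le> h F (p i) (p j) + h F (p j) (p l)"
    by (intro h_tri walkD(1)[OF assms(1)]; use assms in simp)+
  moreover have "h F (p 0) (p i) \<le> gaps F p i" "h F (p j) (p l) + gaps F p j \<le> gaps F p l"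
    "h F (p i) (p j) + gaps F p i \<le> gaps F p j"
    using h_walk[OF assms(1), of 0 i F] h_walk[OF assms(1), of j l F] h_walk[OF assms(1), of i j F] assms
    by auto
  ultimately show ?thesis using assms(2) by linarith
qed

text \<open>Among the cheapest walks a shortest one is taken. Cutting out the stretch between two
  visits of a vertex does not raise the cost, so there is no repetition.\<close>

lemma opt_walk:
  assumes "x \<in> V" "y \<in> V"
  shows "\<exists>W l. walk G W l \<and> W 0 = x \<and> W l = y \<and> gaps F W l = h F x y \<and> inj_on W {..l}"
proof -
  let ?P = "\<lambda>l. \<exists>W. walk G W l \<and> W 0 = x \<and> W l = y \<and> gaps F W l \<le> h F x y"
  obtain W0 l0 where "walk G W0 l0 \<and> W0 0 = x \<and> W0 l0 = y \<and> gaps F W0 l0 \<le> h F x y"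
    using reach_imp_walk[OF h_reach[OF assms, of F]] by blast
  then have "?P l0" by blast
  define l where "l = (LEAST l. ?P l)"
  have "?P l" unfolding l_def using \<open>?P l0\<close> by (rule LeastI)
  then obtain W where W: "walk G W l" "W 0 = x" "W l = y" "gaps F W l \<le> h F x y" by blast
  have min: "l \<le> l'" if "?P l'" for l' unfolding l_def using that by (rule Least_le)
  have "h F x y \<le> gaps F W l" using h_walk[OF W(1), of 0 l F] W by simp
  then have "gaps F W l = h F x y" using W by simp
  moreover have "inj_on W {..l}"
  proof (rule linorder_inj_onI)
    fix i j assume ij: "i < j" "i \<in> {..l}" "j \<in> {..l}"
    show "W i \<noteq> W j"
    proof
      assume eq: "W i = W j"
      define q where "q t = (if t \<le> i then W t else W (j + (t - i)))" for t
      let ?m = "i + (l - j)"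
      have q0: "q 0 = x" using W by (simp add: q_def)
      have shift: "q (i + t) = W (j + t)" for t using eq by (auto simp: q_def)
      have ql: "q ?m = y" using shift[of "l - j"] W ij by simp
      have "walk G q ?m"
        unfolding walk_def
      proof (intro conjI allI impI)
        fix t assume "t \<le> ?m" then show "q t \<in> V" using walkD(1)[OF W(1)] ij by (auto simp: q_def)
      next
        fix t assume t: "t < ?m"
        show "adj G (q t) (q (Suc t))"
        proof (cases "t < i")
          case True then show ?thesis using walkD(2)[OF W(1), of t] ij by (auto simp: q_def)
        next
          case False
          then obtain r where r: "t = i + r" by (metis le_add_diff_inverse not_less)
          then have "q t = W (j + r)" "q (Suc t) = W (Suc (j + r))" using shift[of r] shift[of "Suc r"] by auto
          then show ?thesis using walkD(2)[OF W(1), of "j + r"] t r by simp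
        qed
      qed
      moreover have "gaps F q ?m \<le> gaps F W l"
      proof -
        have "gaps F q i = gaps F W i" by (rule gaps_cong) (simp add: q_def)
        moreover have "gaps F (\<lambda>t. q (i + t)) (l - j) = gaps F (\<lambda>t. W (j + t)) (l - j)"
          by (simp add: shift)
        ultimately show ?thesis
          using gaps_shift[of F q i "l - j"] gaps_shift[of F W j "l - j"] gaps_mono[of i j F W] ij
          by simp
      qed
      ultimately have "?P ?m" using q0 ql W(4) by (intro exI[of _ q]) auto
      then show False using min[of ?m] ij by simp
    qed
  qed auto
  ultimately show ?thesis using W by blast
qed

section \<open>Diameter bounds from a dominating walk with a free block\<close>

definition good :: "nat \<Rightarrow> 'a set set \<Rightarrow> bool" where
  "good s F \<longleftrightarrow> (\<forall>u\<in>V. \<forall>v\<in>V. h F u v \<le> s)"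

definition dom :: "'a \<Rightarrow> 'a \<Rightarrow> bool" where
  "dom x y \<longleftrightarrow> x \<in> V \<and> y \<in> V \<and> (\<forall>z\<in>V. \<not> av z x y)"

lemma dom_sym: "dom x y \<Longrightarrow> dom y x"
  unfolding dom_def using av_sym by blast

text \<open>\<open>B\<close> is a connected set of mutual cost 0 that replaces the walk between
  positions \<open>a\<close> and \<open>b\<close>. By domination every vertex is near
  \<open>B\<close>, near the walk before \<open>a\<close>, or near the walk after \<open>b\<close>;
  its distance to \<open>B\<close> is then at most 1, \<open>A\<close> or \<open>R\<close>,
  respectively. Two vertices from different classes meet through \<open>B\<close>.\<close>

lemma good_if:
  assumes "dom x y" and W: "walk G W l" "W 0 = x" "W l = y" and ab: "a \<le> l" "b \<le> l"
    and B: "B \<subseteq> V" "W a \<in> B" "W b \<in> B" and zero: "\<And>u v. u \<in> B \<Longrightarrow> v \<in> B \<Longrightarrow> h F u v = 0"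
    and link: "\<And>z. z \<in> V \<Longrightarrow> (\<And>v. v \<in> B \<Longrightarrow> \<not> near z v) \<Longrightarrow> av z (W a) (W b)"
    and AR: "a \<le> A" "l - b \<le> R" "1 \<le> A" "1 \<le> R" "A + R \<le> s"
    and left: "\<And>u. adj G x u \<Longrightarrow> \<exists>v\<in>B. d u v \<le> A"
    and right: "\<And>u. adj G y u \<Longrightarrow> \<exists>v\<in>B. d u v \<le> R"
  shows "good s F"
proof -
  have inV: "W i \<in> V" if "i \<le> l" for i using walkD(1)[OF W(1)] that .
  define L where "L z \<longleftrightarrow> (\<exists>i<a. d z (W i) \<le> 1) \<and> (\<exists>v\<in>B. d z v \<le> A)" for z
  define R' where "R' z \<longleftrightarrow> (\<exists>i. b < i \<and> i \<le> l \<and> d z (W i) \<le> 1) \<and> (\<exists>v\<in>B. d z v \<le> R)" for z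
  have cls: "(\<exists>v\<in>B. d z v \<le> 1) \<or> L z \<or> R' z" if z: "z \<in> V" for z
  proof (rule ccontr)
    assume no: "\<not> ?thesis"
    then have nB: "\<not> near z v" if "v \<in> B" for v using near_d B z that by blast
    have nL: "\<not> near z (W i)" if i: "i < a" for i
    proof
      assume n: "near z (W i)"
      then have d1: "d z (W i) \<le> 1" using near_d z inV i ab by auto
      have "\<exists>v\<in>B. d z v \<le> A"
      \<comment> \<open>For \<open>i > 0\<close> the step from \<open>z\<close> to the walk is made
        up for by the shorter way from \<open>W i\<close> to \<open>W a\<close>. The case
        \<open>i = 0\<close> is the one that calls for the hypothesis \<open>left\<close>.\<close>
      proof (cases "i = 0")
        case True
        show ?thesis
        proof (cases "z = x")
          case True
          then have "d z (W a) \<le> a" using d_walk[OF W(1), of 0 a] ab W by simp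
          then show ?thesis using AR B by (intro bexI[of _ "W a"]) auto
        next
          case False then show ?thesis using left n W \<open>i = 0\<close> by (auto simp: near_def adj_commute)
        qed
      next
        case False
        then have "d z (W a) \<le> 1 + (a - i)"
          using h_tri[of z "W i" "W a" "{}"] d_walk[OF W(1), of i a] z inV ab i d1 by simp
        then show ?thesis using AR B i False by (intro bexI[of _ "W a"]) auto
      qed
      then show False using no d1 i unfolding L_def by blast
    qed
    have nR: "\<not> near z (W i)" if i: "b < i" "i \<le> l" for i
    proof
      assume n: "near z (W i)"
      then have d1: "d z (W i) \<le> 1" using near_d z inV i ab by auto
      have sym: "d (W j) (W b) = d (W b) (W j)" if "j \<le> l" for j using h_sym inV ab that by blast
      have "\<exists>v\<in>B. d z v \<le> R"
      proof (cases "i = l")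
        case True
        show ?thesis
        proof (cases "z = y")
          case True
          then have "d z (W b) \<le> l - b" using d_walk[OF W(1), of b l] ab W sym[of l] by simp
          then show ?thesis using AR B by (intro bexI[of _ "W b"]) auto
        next
          case False then show ?thesis using right n W \<open>i = l\<close> by (auto simp: near_def adj_commute)
        qed
      next
        case False
        then have "d z (W b) \<le> 1 + (i - b)"
          using h_tri[of z "W i" "W b" "{}"] d_walk[OF W(1), of b i] sym[of i] z inV ab i d1 by simp
        then show ?thesis using AR B i False by (intro bexI[of _ "W b"]) auto
      qed
      then show False using no d1 i unfolding R'_def by blast
    qed
    have "av z (W 0) (W a)"
      using nL nB B ab by (intro av_walk[OF W(1)]) (auto simp: le_less)
    moreover have "av z (W b) (W l)"
      using nR nB B ab by (intro av_walk[OF W(1)]) (auto simp: le_less)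
    ultimately have "av z x y" using link[OF z nB] W av_trans by blast
    then show False using assms(1) z by (auto simp: dom_def)
  qed
  have via: "h F z z' \<le> i + j" if "z \<in> V" "z' \<in> V" "v \<in> B" "v' \<in> B" "d z v \<le> i" "d z' v' \<le> j" for z z' v v' i j
  proof -
    have "v \<in> V" "v' \<in> V" using B that by auto
    then have "h F z z' \<le> h F z v + h F v z'" "h F v z' \<le> h F v v' + h F v' z'"
      "h F z v \<le> d z v" "h F v' z' \<le> d v' z'" "d v' z' = d z' v'"
      using that h_tri[of z v z' F] h_tri[of v v' z' F] h_mono[of z v "{}" F] h_mono[of v' z' "{}" F] h_sym[of v' z' "{}"] by auto
    then show ?thesis using zero[of v v'] that by linarith
  qed
  have same: "h F z z' \<le> 2 + (max i j - min i j)"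
    if "z \<in> V" "z' \<in> V" "i \<le> l" "j \<le> l" "d z (W i) \<le> 1" "d z' (W j) \<le> 1" for z z' i j
  proof -
    have "d (W i) (W j) \<le> max i j - min i j"
      using d_walk[OF W(1), of i j] d_walk[OF W(1), of j i] h_sym[of "W i" "W j"] inV that by (cases "i \<le> j") auto
    moreover have "d z z' \<le> d z (W i) + d (W i) z'" "d (W i) z' \<le> d (W i) (W j) + d (W j) z'"
      "d (W j) z' = d z' (W j)" "h F z z' \<le> d z z'"
      using that h_tri[of z "W i" z' "{}"] h_tri[of "W i" "W j" z' "{}"] inV h_mono[of z z' "{}" F] h_sym[of "W j" z' "{}"] by auto
    ultimately show ?thesis using that by linarith
  qed
  show ?thesis
    unfolding good_def
  proof (intro ballI)
    fix z z' assume z: "z \<in> V" "z' \<in> V"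
    from cls[OF z(1)] cls[OF z(2)] show "h F z z' \<le> s"
    proof (elim disjE bexE)
      fix v v' assume "v \<in> B" "d z v \<le> 1" "v' \<in> B" "d z' v' \<le> 1"
      then show ?thesis using via[OF z] AR by fastforce
    next
      fix v assume "v \<in> B" "d z v \<le> 1" "L z'"
      then obtain v' where "v' \<in> B" "d z' v' \<le> A" by (auto simp: L_def)
      then show ?thesis using via[OF z \<open>v \<in> B\<close> \<open>v' \<in> B\<close> \<open>d z v \<le> 1\<close>] AR by fastforce
    next
      fix v assume "v \<in> B" "d z v \<le> 1" "R' z'"
      then obtain v' where "v' \<in> B" "d z' v' \<le> R" by (auto simp: R'_def)
      then show ?thesis using via[OF z \<open>v \<in> B\<close> \<open>v' \<in> B\<close> \<open>d z v \<le> 1\<close>] AR by fastforce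
    next
      fix v' assume "v' \<in> B" "d z' v' \<le> 1" "L z"
      then obtain v where "v \<in> B" "d z v \<le> A" by (auto simp: L_def)
      then show ?thesis using via[OF z \<open>v \<in> B\<close> \<open>v' \<in> B\<close> _ \<open>d z' v' \<le> 1\<close>] AR by fastforce
    next
      fix v' assume "v' \<in> B" "d z' v' \<le> 1" "R' z"
      then obtain v where "v \<in> B" "d z v \<le> R" by (auto simp: R'_def)
      then show ?thesis using via[OF z \<open>v \<in> B\<close> \<open>v' \<in> B\<close> _ \<open>d z' v' \<le> 1\<close>] AR by fastforce
    next
      \<comment> \<open>Passing through the block could cost \<open>2 * A\<close>. Two vertices on
        the same side are joined along the walk instead, at cost at most \<open>2 + (a - 1)\<close>,
        which is at most \<open>A + R\<close>.\<close>
      assume "L z" "L z'"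
      then obtain i j where "i < a" "j < a" "d z (W i) \<le> 1" "d z' (W j) \<le> 1" by (auto simp: L_def)
      then have "h F z z' \<le> 2 + (max i j - min i j)" using same[OF z, of i j] ab by auto
      moreover have "max i j - min i j \<le> a - 1" using \<open>i < a\<close> \<open>j < a\<close> by auto
      ultimately show ?thesis using AR \<open>i < a\<close> by linarith
    next
      assume "R' z" "R' z'"
      then obtain i j where *: "b < i" "b < j" "i \<le> l" "j \<le> l" "d z (W i) \<le> 1" "d z' (W j) \<le> 1" by (auto simp: R'_def)
      then have "h F z z' \<le> 2 + (max i j - min i j)" using same[OF z, of i j] by auto
      moreover have "max i j - min i j + 1 \<le> l - b" using * by auto
      ultimately show ?thesis using AR by linarith
    next
      assume "L z" "R' z'"
      then obtain v v' where "v \<in> B" "d z v \<le> A" "v' \<in> B" "d z' v' \<le> R" by (auto simp: L_def R'_def)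
      then show ?thesis using via[OF z] AR by fastforce
    next
      assume "R' z" "L z'"
      then obtain v v' where "v \<in> B" "d z v \<le> R" "v' \<in> B" "d z' v' \<le> A" by (auto simp: L_def R'_def)
      then show ?thesis using via[OF z] AR by fastforce
    qed
  qed
qed

end

section \<open>Candidate edge sets, and walks with room to spare\<close>

context atgraph
begin

definition dedge :: "'a \<times> 'a \<Rightarrow> bool" where
  "dedge g \<longleftrightarrow> adj G (fst g) (snd g)"

text \<open>The edge sets tried by the program. The shortest path is arbitrary, since the program cannot
  choose among several ones.\<close>

definition found :: "nat \<Rightarrow> nat \<Rightarrow> bool" where
  "found k s \<longleftrightarrow> (\<exists>g1 g2 g3 g4. dedge g1 \<and> dedge g2 \<and> dedge g3 \<and> dedge g4 \<and>
     (let E = {pe g1, pe g2, pe g3, pe g4} in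
        card E \<le> k \<and> good s E \<or>
        (\<forall>q l. walk G q l \<and> q 0 = snd g2 \<and> q l = fst g3 \<and> l = d (snd g2) (fst g3) \<longrightarrow>
           card (E \<union> pedges q l) \<le> k \<and> good s (E \<union> pedges q l))))"

lemma found_mono: "found k s \<Longrightarrow> k \<le> k' \<Longrightarrow> found k' s"
  unfolding found_def Let_def by (meson order_trans)

lemma found_walkI:
  assumes "dedge g1" "dedge g2" "dedge g3" "dedge g4"
    "\<And>q l. walk G q l \<Longrightarrow> q 0 = snd g2 \<Longrightarrow> q l = fst g3 \<Longrightarrow> l = d (snd g2) (fst g3) \<Longrightarrow>
      card ({pe g1, pe g2, pe g3, pe g4} \<union> pedges q l) \<le> k \<and>
      good s ({pe g1, pe g2, pe g3, pe g4} \<union> pedges q l)"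
  shows "found k s"
  unfolding found_def Let_def using assms by blast

lemma edge_dedge: "e \<in> edges G \<Longrightarrow> \<exists>g. dedge g \<and> pe g = e"
proof -
  assume e: "e \<in> edges G"
  then obtain a b where "e = {a, b}" using simple unfolding simple_graph_def by (metis card_2_iff)
  then show ?thesis using e by (intro exI[of _ "(a, b)"]) (auto simp: dedge_def pe_def adj_def)
qed

lemma found_small:
  assumes "F \<subseteq> edges G" "F \<noteq> {}" "card F \<le> 4" "card F \<le> k" "good s F"
  shows "found k s"
proof -
  have "finite F" using assms fin_edges finite_subset by blast
  from small_set[OF this assms(2,3)] obtain e1 e2 e3 e4 where F: "F = {e1, e2, e3, e4}" by (elim exE)
  obtain g1 g2 where "dedge g1 \<and> pe g1 = e1" "dedge g2 \<and> pe g2 = e2"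
    using assms(1) F edge_dedge[of e1] edge_dedge[of e2] by auto
  moreover obtain g3 g4 where "dedge g3 \<and> pe g3 = e3" "dedge g4 \<and> pe g4 = e4"
    using assms(1) F edge_dedge[of e3] edge_dedge[of e4] by auto
  ultimately show ?thesis
    unfolding found_def Let_def using assms F by (intro exI[of _ g1] exI[of _ g2] exI[of _ g3] exI[of _ g4]) auto
qed

lemma card4: "card {a, b, c, e :: 'b} \<le> 4"
  using card_length[of "[a, b, c, e]"] by simp

text \<open>Makes the edges of \<open>W\<close> between positions \<open>a\<close> and \<open>c + 2\<close> free, up to replacing the middle part
  by another shortest path.\<close>

lemma found_walk:
  assumes dom: "dom x y" and W: "walk G W l" "W 0 = x" "W l = y"
    and ac: "a + 2 \<le> c" "c + 2 \<le> l" "c + 2 \<le> a + k"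
    and AR: "a \<le> A" "l - (c + 2) \<le> R" "1 \<le> A" "1 \<le> R" "A + R \<le> s"
    and left: "\<And>u. adj G x u \<Longrightarrow> \<exists>t. a \<le> t \<and> t \<le> a + 2 \<and> d u (W t) \<le> A"
    and right: "\<And>u. adj G y u \<Longrightarrow> \<exists>t. c \<le> t \<and> t \<le> c + 2 \<and> d u (W t) \<le> R"
  shows "found k s"
proof (rule found_walkI[of "(W a, W (a + 1))" "(W (a + 1), W (a + 2))" "(W c, W (c + 1))" "(W (c + 1), W (c + 2))"])
  have A: "adj G (W i) (W (i + 1))" if "i < l" for i using walkD(2)[OF W(1) that] by simp
  have inV: "W i \<in> V" if "i \<le> l" for i using walkD(1)[OF W(1) that] .
  show "dedge (W a, W (a + 1))" "dedge (W (a + 1), W (a + 2))" "dedge (W c, W (c + 1))"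
    "dedge (W (c + 1), W (c + 2))"
    using A[of a] A[of "a + 1"] A[of c] A[of "c + 1"] ac by (auto simp: dedge_def)
  fix q m assume q: "walk G q m" "q 0 = snd (W (a + 1), W (a + 2))" "q m = fst (W c, W (c + 1))"
    and m: "m = d (snd (W (a + 1), W (a + 2))) (fst (W c, W (c + 1)))"
  let ?E = "{pe (W a, W (a + 1)), pe (W (a + 1), W (a + 2)), pe (W c, W (c + 1)), pe (W (c + 1), W (c + 2))}"
  let ?F = "?E \<union> pedges q m"
  \<comment> \<open>The walk itself joins the two inner ends, so a shortest path between them has at
    most \<open>c - (a + 2)\<close> edges. With the four fixed edges this is no more than the length
    of the stretch from \<open>a\<close> to \<open>c + 2\<close>.\<close>
  have m: "m + (a + 2) \<le> c" using d_walk[OF W(1), of "a + 2" c] ac m by simp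
  have "card ?F \<le> 4 + m"
    by (rule order_trans[OF card_Un_le add_mono[OF card4 card_pedges]])
  then have card: "card ?F \<le> k" using m ac by simp
  \<comment> \<open>The first three and the last three vertices of the stretch belong to the block
    whatever path is chosen; this is why \<open>left\<close> and \<open>right\<close> refer to them
    only.\<close>
  let ?B = "W ` {a..a + 2} \<union> q ` {..m} \<union> W ` {c..c + 2}"
  have BV: "?B \<subseteq> V" using inV ac walkD(1)[OF q(1)] by auto
  have zq: "h ?F (q 0) (q i) = 0" if "i \<le> m" for i
    using h_walk[OF q(1), of 0 i ?F] gaps_0I[of i q ?F] pedgesI[of _ m q] that by auto
  have e: "h ?F (W i) (W (Suc i)) = 0" if "i \<in> {a, a + 1, c, c + 1}" for i
    using that A[of i] ac by (intro h_free) (auto simp: pe_def)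
  have za: "h ?F (W (a + 2)) (W i) = 0" if i: "a \<le> i" "i \<le> a + 2" for i
  proof -
    have "h ?F (W i) (W (a + 2)) \<le> gaps ?F W (a + 2) - gaps ?F W i"
      using h_walk[OF W(1), of i "a + 2" ?F] i ac by auto
    moreover have "gaps ?F W (a + 2) = gaps ?F W a"
      by (simp add: gaps_Suc pe_def numeral_2_eq_2)
    moreover have "gaps ?F W a \<le> gaps ?F W i" by (rule gaps_mono) fact
    ultimately show ?thesis using h_sym[of "W i" "W (a + 2)"] inV i ac by auto
  qed
  have zc: "h ?F (W c) (W i) = 0" if i: "c \<le> i" "i \<le> c + 2" for i
  proof -
    have "h ?F (W c) (W i) \<le> gaps ?F W i - gaps ?F W c"
      using h_walk[OF W(1), of c i ?F] i ac by auto
    moreover have "gaps ?F W (c + 2) = gaps ?F W c"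
      by (simp add: gaps_Suc pe_def numeral_2_eq_2)
    moreover have "gaps ?F W i \<le> gaps ?F W (c + 2)" by (rule gaps_mono) fact
    ultimately show ?thesis by auto
  qed
  have c0: "W (a + 2) \<in> V" using inV ac by simp
  have z0: "h ?F (W (a + 2)) v = 0" if "v \<in> ?B" for v
  proof -
    have "h ?F (W (a + 2)) (W i) = 0" if i: "c \<le> i" "i \<le> c + 2" for i
      using h_tri[OF c0, of "W c" "W i" ?F] zc[OF i] zq[of m] q inV i ac by simp
    then show ?thesis using that za zq q by auto
  qed
  have "good s ?F"
  proof (rule good_if[OF dom W, of a "c + 2" ?B ?F A R])
    fix u v assume uv: "u \<in> ?B" "v \<in> ?B"
    have "h ?F u v \<le> h ?F u (W (a + 2)) + h ?F (W (a + 2)) v" using uv BV c0 by (intro h_tri) auto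
    also have "h ?F u (W (a + 2)) = h ?F (W (a + 2)) u" using uv BV c0 by (intro h_sym) auto
    finally show "h ?F u v = 0" using z0 uv by simp
  next
    fix z assume "z \<in> V" and n: "\<And>v. v \<in> ?B \<Longrightarrow> \<not> near z v"
    have "av z (W a) (W (a + 2))" by (rule av_walk[OF W(1)]) (use ac n in auto)
    moreover have "av z (q 0) (q m)" by (rule av_walk[OF q(1)]) (use n in auto)
    moreover have "av z (W c) (W (c + 2))" by (rule av_walk[OF W(1)]) (use ac n in auto)
    ultimately show "av z (W a) (W (c + 2))"
      using q av_trans[of z "W a" "W (a + 2)" "W c"] av_trans[of z "W a" "W c" "W (c + 2)"] by simp
  next
    fix u assume "adj G x u"
    then obtain t where "a \<le> t" "t \<le> a + 2" "d u (W t) \<le> A" using left by blast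
    then show "\<exists>v\<in>?B. d u v \<le> A" by (intro bexI[of _ "W t"]) auto
  next
    fix u assume "adj G y u"
    then obtain t where "c \<le> t" "t \<le> c + 2" "d u (W t) \<le> R" using right by blast
    then show "\<exists>v\<in>?B. d u v \<le> R" by (intro bexI[of _ "W t"]) auto
  qed (use BV ac AR in auto)
  with card show "card ?F \<le> k \<and> good s ?F" by blast
qed

lemma d_adj: "adj G u v \<Longrightarrow> d u v \<le> 1"
  using h_adj[of u v "{}"] by simp

text \<open>A slack of two pays one extra step at each end. The block begins at \<open>x\<close>, so
  the neighbours of \<open>x\<close> are at distance 1 from it, and those of \<open>y\<close> are
  one step farther from its end than \<open>y\<close>. If the geodesic has fewer than four edges,
  all of them are made free.\<close>

lemma found_near_pair:
  assumes dom: "dom x y" and "x \<noteq> y" "d x y + 2 \<le> k + s" "2 \<le> s" "5 \<le> k"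
  shows "found k s"
proof -
  have xy: "x \<in> V" "y \<in> V" using dom by (auto simp: dom_def)
  define D where "D = d x y"
  have "D \<noteq> 0" using d_0 xy assms by (simp add: D_def)
  obtain p where p: "walk G p D" "p 0 = x" "p D = y" using geodesic_ex[OF xy] by (auto simp: D_def)
  have inV: "p i \<in> V" if "i \<le> D" for i using walkD(1)[OF p(1) that] .
  show ?thesis
  proof (cases "4 \<le> D")
    case True
    \<comment> \<open>A geodesic with at most \<open>k\<close> edges is made free entirely. In
      either case \<open>4 \<le> b\<close>, so that the two edges at each end of the block do not
      overlap.\<close>
    define b where "b = min k D"
    have b: "4 \<le> b" "b \<le> D" "b \<le> k" "D + 2 \<le> b + s" using True assms by (auto simp: b_def D_def)
    show ?thesis
    proof (rule found_walk[OF dom p, of 0 "b - 2" k 1 "D - b + 1"])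
      fix u assume u: "adj G x u"
      then show "\<exists>t\<ge>0. t \<le> 0 + 2 \<and> d u (p t) \<le> 1" using d_adj[of u x] p by (auto simp: adj_commute)
    next
      fix u assume u: "adj G y u"
      have "d u (p b) \<le> d u y + d y (p b)" using u adj_V inV b xy by (intro h_tri) auto
      also have "d y (p b) = d (p b) y" using xy inV b by (intro h_sym) auto
      also have "d (p b) y \<le> D - b" using d_walk[OF p(1), of b D] b p by simp
      finally have "d u (p b) \<le> D - b + 1" using d_adj[of u y] u by (simp add: adj_commute)
      then show "\<exists>t\<ge>b - 2. t \<le> b - 2 + 2 \<and> d u (p t) \<le> D - b + 1" using b by (intro exI[of _ b]) auto
    qed (use b in auto)
  next
    case False
    have "good s (pedges p D)"
    proof (rule good_if[OF dom p, of 0 D "p ` {..D}" _ 1 1])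
      fix u v assume "u \<in> p ` {..D}" "v \<in> p ` {..D}"
      then obtain i j where ij: "u = p i" "v = p j" "i \<le> D" "j \<le> D" by auto
      have g: "gaps (pedges p D) p D = 0" by (rule gaps_0I) (auto intro: pedgesI)
      have z: "h (pedges p D) (p i) (p j) = 0" if "i \<le> j" "j \<le> D" for i j
        using h_walk[OF p(1) that, of "pedges p D"] gaps_mono[OF that(2), of "pedges p D" p] g by simp
      show "h (pedges p D) u v = 0"
        using z[of i j] z[of j i] h_sym[of u v] ij inV by (cases "i \<le> j") auto
    next
      fix z assume "z \<in> V" and n: "\<And>v. v \<in> p ` {..D} \<Longrightarrow> \<not> near z v"
      show "av z (p 0) (p D)" by (rule av_walk[OF p(1)]) (use n in auto)
    next
      fix u assume "adj G x u" then show "\<exists>v\<in>p ` {..D}. d u v \<le> 1"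
        using d_adj[of u x] p by (intro bexI[of _ x]) (auto simp: adj_commute image_iff)
    next
      fix u assume "adj G y u" then show "\<exists>v\<in>p ` {..D}. d u v \<le> 1"
        using d_adj[of u y] p by (intro bexI[of _ y]) (auto simp: adj_commute image_iff)
    qed (use assms inV in auto)
    moreover have "pedges p D \<subseteq> edges G" using walkD(2)[OF p(1)] by (auto simp: pedges_def adj_def)
    moreover have "pedges p D \<noteq> {}" using \<open>D \<noteq> 0\<close> by (auto simp: pedges_def)
    moreover have "card (pedges p D) \<le> 4" "card (pedges p D) \<le> k" using card_pedges[of p D] False assms by auto
    ultimately show ?thesis using found_small by blast
  qed
qed

text \<open>Making \<open>k\<close> edges of a walk of length \<open>k + s - 1\<close> free leaves
  \<open>s - 1\<close> paid ones. The one spare step is spent at \<open>y\<close>: its neighbours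
  are within \<open>s - a\<close> of the block in any case, and the neighbours of \<open>x\<close>
  remain as the only condition.\<close>

lemma found_slack:
  assumes dom: "dom x y" and p: "walk G p D" "p 0 = x" "p D = y" and D: "D + 1 = k + s" and k: "5 \<le> k"
    and a: "1 \<le> a" "a + 1 \<le> s"
    and left: "\<And>u. adj G x u \<Longrightarrow> \<exists>t. a \<le> t \<and> t \<le> a + 1 \<and> d u (p t) \<le> a"
  shows "found k s"
proof (rule found_walk[OF dom p, of a "a + k - 2" k a "s - a"])
  fix u assume "adj G x u"
  from left[OF this] obtain t where "a \<le> t" "t \<le> a + 1" "d u (p t) \<le> a" by blast
  then show "\<exists>t\<ge>a. t \<le> a + 2 \<and> d u (p t) \<le> a" by (intro exI[of _ t]) auto
next
  fix u assume u: "adj G y u"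
  have V: "u \<in> V" "y \<in> V" "p (a + k) \<in> V" using adj_V[OF u] walkD(1)[OF p(1), of "a + k"] D a by auto
  have "d u (p (a + k)) \<le> d u y + d y (p (a + k))" using V by (intro h_tri) auto
  also have "d y (p (a + k)) = d (p (a + k)) y" using V by (intro h_sym)
  also have "d (p (a + k)) y \<le> D - (a + k)" using d_walk[OF p(1), of "a + k" D] D a p by simp
  finally have "d u (p (a + k)) \<le> s - a" using d_adj[of u y] u D a by (simp add: adj_commute)
  then show "\<exists>t\<ge>a + k - 2. t \<le> a + k - 2 + 2 \<and> d u (p t) \<le> s - a" using k by (intro exI[of _ "a + k"]) auto
qed (use D a k in auto)

text \<open>The number of paid edges before the last position \<open>t\<close> with at most one free
  edge before it is the natural start of the block. A neighbour of \<open>x\<close> that meets the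
  geodesic at position \<open>r\<close> with distance at most \<open>gaps F p r\<close> satisfies
  \<open>r \<le> gaps F p r + 1\<close>, as otherwise it would shorten the geodesic; hence
  \<open>r \<le> t\<close>. Placing the block there fails only if \<open>s\<close> paid edges
  precede \<open>t\<close>, which is the second alternative.\<close>

lemma found_or_one_free_edge:
  assumes dom: "dom x y" and p: "walk G p D" "p 0 = x" "p D = y" and D: "D + 1 = k + s" "d x y = D"
    and k: "5 \<le> k" and s: "2 \<le> s" and M: "gaps F p D + 2 \<le> D"
    and left: "\<And>u. adj G x u \<Longrightarrow> \<exists>t\<le>D. d u (p t) \<le> gaps F p t"
  shows "found k s \<or> (\<exists>t<D. t = Suc (gaps F p t) \<and> s \<le> gaps F p t)"
proof -
  let ?N = "gaps F p"
  let ?T = "{t. t \<le> D \<and> t \<le> ?N t + 1}"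
  define t where "t = Max ?T"
  have fin: "finite ?T" by simp
  have "0 \<in> ?T" by simp
  then have "?T \<noteq> {}" by blast
  then have "t \<in> ?T" unfolding t_def by (rule Max_in[OF fin])
  then have t: "t \<le> D" "t \<le> ?N t + 1" by auto
  have tmax: "j \<le> t" if "j \<le> D" "j \<le> ?N j + 1" for j unfolding t_def using fin that by (intro Max_ge) auto
  have "t < D" using t M by (cases "t = D") auto
  moreover have "t = Suc (?N t)"
  proof -
    have "\<not> Suc t \<le> ?N (Suc t) + 1" using tmax[of "Suc t"] \<open>t < D\<close> by auto
    then show ?thesis using t gaps_mono[of t "Suc t" F p] by auto
  qed
  moreover have "found k s" if Ns: "?N t < s"
  proof -
    \<comment> \<open>The maximum with 1 keeps \<open>A\<close> positive when the geodesic starts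
      with free edges; \<open>t \<le> a + 1\<close> still holds.\<close>
    define a where "a = max 1 (?N t)"
    have a: "1 \<le> a" "a + 1 \<le> s" "?N t \<le> a" "t \<le> a + 1" using Ns s \<open>t = Suc (?N t)\<close> by (auto simp: a_def)
    have aD: "a + 1 \<le> D" using a D k by simp
    show ?thesis
    proof (rule found_slack[OF dom p D(1) k a(1,2)])
      fix u assume u: "adj G x u"
      from left[OF u] obtain r where r: "r \<le> D" "d u (p r) \<le> ?N r" by blast
      have V: "u \<in> V" "x \<in> V" "y \<in> V" "p r \<in> V" "p a \<in> V"
        using adj_V[OF u] dom walkD(1)[OF p(1)] r aD by (auto simp: dom_def)
      have "D \<le> d x u + (d u (p r) + d (p r) y)"
        using h_tri[of x u y "{}"] h_tri[of u "p r" y "{}"] V D by simp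
      moreover have "d x u \<le> 1" using d_adj u by blast
      moreover have "d (p r) y + r \<le> D" using d_walk[OF p(1), of r D] r p by simp
      ultimately have "r \<le> ?N r + 1" using r by simp
      then have rt: "r \<le> t" using tmax r by blast
      show "\<exists>t\<ge>a. t \<le> a + 1 \<and> d u (p t) \<le> a"
      proof (cases "a \<le> r")
        case True
        then show ?thesis using rt a r gaps_mono[OF rt, of F p] by (intro exI[of _ r]) auto
      next
        case False
        have "d u (p a) \<le> d u (p r) + d (p r) (p a)" using V by (intro h_tri)
        moreover have "d (p r) (p a) + r \<le> a" using d_walk[OF p(1), of r a] False aD by simp
        ultimately have "d u (p a) \<le> a" using r gaps_le[of F p r] by linarith
        then show ?thesis by (intro exI[of _ a]) auto
      qed
    qed
  qed
  ultimately show ?thesis by (meson not_less)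
qed

end

section \<open>Tight cases: the dominating pair at distance at least
  \<open>k + s - 1\<close>\<close>

context atgraph
begin

lemma pedges_vertex:
  assumes "{a, b} \<in> pedges W l"
  shows "\<exists>i\<le>l. a = W i"
proof -
  obtain i where "i < l" "{a, b} = {W i, W (Suc i)}" using assms by (auto simp: pedges_def)
  then have "a = W i \<or> a = W (Suc i)" by (auto simp: doubleton_eq_iff)
  then show ?thesis using \<open>i < l\<close> by (metis Suc_leI less_imp_le)
qed

lemma h_free_tri: "adj G a b \<Longrightarrow> {a, b} \<in> F \<Longrightarrow> v \<in> V \<Longrightarrow> h F a v \<le> h F b v"
  using h_tri[of a b v F] h_free[of a b F] adj_V by fastforce

lemma h_le_d: "u \<in> V \<Longrightarrow> v \<in> V \<Longrightarrow> h F u v \<le> d u v"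
  using h_mono[of u v "{}" F] by simp

text \<open>The first free edge of a cheap route from \<open>u\<close> starts at a vertex of the
  walk, and the route up to it is an ordinary walk. From there on the cost is at least that of the
  rest of the optimal walk.\<close>

lemma first_free_walk:
  assumes W: "walk G W l" "W l = y" and F: "F' \<subseteq> F" "F' \<subseteq> pedges W l"
    and opt: "h F (W 0) y = gaps F W l"
    and u: "u \<in> V" "h F' u y \<le> c" "c < d u y"
  shows "\<exists>t\<le>l. d u (W t) + gaps F W l \<le> c + gaps F W t"
proof -
  have y: "y \<in> V" using walkD(1)[OF W(1), of l] W by simp
  obtain a b where ab: "{a, b} \<in> F'" "adj G a b" "d u a + h F' b y \<le> c"
    using first_free[OF u(2,1) y] u(3) by auto
  then obtain t where t: "t \<le> l" "a = W t" using pedges_vertex[of a b W l] F by blast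
  have b: "b \<in> V" using adj_V ab by blast
  have "h F a y \<le> h F b y" using h_free_tri ab F y by blast
  moreover have "h F b y \<le> h F' b y" by (rule h_mono[OF b y F(1)])
  moreover have "h F (W t) y + gaps F W t = gaps F W l"
    using h_opt[OF W(1), of F t l] opt W t by simp
  ultimately show ?thesis using ab t by (intro exI[of _ t]) auto
qed

lemma d_pred: "dom x y \<Longrightarrow> adj G x u \<Longrightarrow> d x y \<le> d u y + 1"
  using h_tri[of x u y "{}"] d_adj[of x u] adj_V[of x u] by (auto simp: dom_def)

text \<open>It suffices that one end has only neighbours that meet the geodesic early enough. If a
  neighbour \<open>u\<close> of \<open>x\<close> and a neighbour \<open>v\<close> of
  \<open>y\<close> both fail, their cheap connection enters and leaves the geodesic at free edges;
  each end then pays at least one more than the corresponding end of the geodesic, which gives at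
  least \<open>gaps F P D + 2\<close>, that is \<open>s + 1\<close>.\<close>

lemma found_all_on_path:
  assumes dom: "dom x y" and P: "walk G P D" "P 0 = x" "P D = y" and D: "D + 1 = k + s" "d x y = D"
    and F: "F \<subseteq> pedges P D" and opt: "h F x y = gaps F P D" "gaps F P D + 1 = s"
    and gd: "good s F" and k: "5 \<le> k" and s: "2 \<le> s"
  shows "found k s"
proof -
  let ?N = "gaps F P" and ?Q = "\<lambda>i. P (D - i)"
  have Q: "walk G ?Q D" "?Q 0 = y" "?Q D = x" using walk_rev P by auto
  have inV: "P i \<in> V" if "i \<le> D" for i using walkD(1)[OF P(1) that] .
  have xy: "x \<in> V" "y \<in> V" using dom by (auto simp: dom_def)
  have rev: "gaps F ?Q j + ?N (D - j) = ?N D" if "j \<le> D" for j by (rule gaps_rev[OF that])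
  show ?thesis
  proof (cases "\<forall>u. adj G x u \<longrightarrow> (\<exists>t\<le>D. d u (P t) \<le> ?N t)")
    case True
    then have "found k s \<or> (\<exists>t<D. t = Suc (?N t) \<and> s \<le> ?N t)"
      using D opt k s by (intro found_or_one_free_edge[OF dom P]) auto
    moreover have "?N t < s" if "t < D" for t using gaps_mono[of t D F P] that opt by simp
    ultimately show ?thesis by (meson not_less)
  next
    case nl: False
    show ?thesis
    proof (cases "\<forall>u. adj G y u \<longrightarrow> (\<exists>t\<le>D. d u (?Q t) \<le> gaps F ?Q t)")
      case True
      have "d y x = D" using D h_sym xy by metis
      then have "found k s \<or> (\<exists>t<D. t = Suc (gaps F ?Q t) \<and> s \<le> gaps F ?Q t)"
        using True D opt k s rev[of D] by (intro found_or_one_free_edge[OF dom_sym[OF dom] Q]) auto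
      moreover have "gaps F ?Q t < s" if "t < D" for t using rev[of t] that opt by simp
      ultimately show ?thesis by (meson not_less)
    next
      case False
      then obtain v where v: "adj G y v" "\<forall>t\<le>D. \<not> d v (?Q t) \<le> gaps F ?Q t" by blast
      from nl obtain u where u: "adj G x u" "\<forall>t\<le>D. \<not> d u (P t) \<le> ?N t" by blast
      have v': "?N D < d v (P t) + ?N t" if "t \<le> D" for t
        using v(2)[rule_format, of "D - t"] rev[of "D - t"] that by simp
      have V: "u \<in> V" "v \<in> V" using adj_V u v by blast+
      have "d x y \<le> d u y + 1" by (rule d_pred[OF dom u(1)])
      moreover have "d u y \<le> d u v + d v y" using V xy by (intro h_tri)
      moreover have "d v y \<le> 1" using d_adj v(1) by (simp add: adj_commute)
      \<comment> \<open>Here \<open>d u v \<ge> D - 2\<close> and \<open>D = k + s - 1\<close>, so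
        \<open>5 \<le> k\<close> gives a distance above \<open>s\<close>; the connection has to use
        a free edge.\<close>
      ultimately have far: "s < d u v" using D k by simp
      have "h F u v \<le> s" using gd V by (simp add: good_def)
      then obtain a b where ab: "{a, b} \<in> F" "adj G a b" "d u a + h F b v \<le> s"
        using first_free[of F u v s] V far by auto
      then obtain \<alpha> where \<alpha>: "\<alpha> \<le> D" "a = P \<alpha>" using pedges_vertex[of a b P D] F by blast
      have "h F a v \<le> h F b v" using h_free_tri ab V by blast
      moreover have "h F v a = h F a v" using h_sym V adj_V(1)[OF ab(2)] by blast
      ultimately have c: "d u a + h F v a \<le> s" using ab by simp
      from first_free[of F v a, OF order_refl V(2) adj_V(1)[OF ab(2)]] show ?thesis
      proof (elim disjE exE conjE)
        assume "d v a \<le> h F v a"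
        then have "d u v \<le> s"
          using h_tri[of u a v "{}"] h_sym[of a v "{}"] V adj_V(1)[OF ab(2)] c by simp
        then show ?thesis using far by simp
      next
        fix a' b' assume ab': "{a', b'} \<in> F" "adj G a' b'" "d v a' + h F b' a \<le> h F v a"
        then obtain \<beta> where \<beta>: "\<beta> \<le> D" "a' = P \<beta>" using pedges_vertex[of a' b' P D] F by blast
        have "h F a' a \<le> h F b' a" using h_free_tri ab' adj_V(1)[OF ab(2)] by blast
        moreover have "?N \<beta> \<le> ?N \<alpha> + h F a' a"
        proof (cases "\<alpha> \<le> \<beta>")
          case True
          then have "h F (P \<alpha>) (P \<beta>) + ?N \<alpha> = ?N \<beta>" using h_opt[OF P(1), of F \<alpha> \<beta>] opt P \<beta> by simp
          then show ?thesis using h_sym[of "P \<alpha>" "P \<beta>" F] inV \<alpha> \<beta> by simp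
        next
          case False then show ?thesis using gaps_mono[of \<beta> \<alpha> F P] by simp
        qed
        ultimately show ?thesis using u(2)[rule_format, OF \<alpha>(1)] v'[OF \<beta>(1)] c ab' \<alpha> \<beta> opt by simp
      qed
    qed
  qed
qed

text \<open>Here the solution itself is a candidate: the first and the last edge of its initial
  block and its two remaining edges are fixed. What has to be shown is that every shortest path
  between the inner ends of the block follows \<open>P\<close>, since the program may find any of
  them.\<close>

lemma found_initial_block:
  assumes dom: "dom x y" and P: "walk G P D" "P 0 = x" "P D = y" and D: "k + s \<le> D + 1" "d x y = D"
    and F: "F = pedges P (k - 2) \<union> {{a1, a2}, {P i0, P (Suc i0)}}" and i0: "k - 2 \<le> i0" "i0 < D"
    and a: "adj G a1 a2" and card: "card F \<le> k" and gd: "good s F" and hs: "s \<le> h F x y"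
    and k: "5 \<le> k" and s: "2 \<le> s"
    and D': "D + 1 = k + s \<or> a1 \<in> P ` {..D} \<and> a2 \<in> P ` {..D}"
  shows "found k s"
proof -
  let ?F2 = "{{a1, a2}, {P i0, P (Suc i0)}}"
  have inV: "P i \<in> V" if "i \<le> D" for i using walkD(1)[OF P(1) that] .
  have xy: "x \<in> V" "y \<in> V" using dom by (auto simp: dom_def)
  have lev: "d x (P i) = i" "d (P i) y + i = D" if "i \<le> D" for i
    using d_walk[OF P(1), of 0 i] d_walk[OF P(1), of i D] h_tri[of x "P i" y "{}"] inV[OF that] xy that P D by auto
  have g0: "gaps F P (k - 2) = 0" by (rule gaps_0I) (auto simp: F pedges_def)
  \<comment> \<open>The two edges outside the block save at most 2, so a vertex \<open>z\<close> at
    distance at least \<open>s + 3\<close> from \<open>y\<close> must use the block to get to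
    \<open>y\<close> at cost \<open>s\<close>. From the block on, the full cost \<open>s\<close> is
    still due, hence the way from \<open>z\<close> to the block is free.\<close>
  have blob: "h F z x = 0" if z: "z \<in> V" "s + 3 \<le> d z y" for z
  proof -
    have "h {} z y \<le> h {{P i0, P (Suc i0)}} z y + 1"
      using h_insert_le[of "P i0" "P (Suc i0)" z y "{}"] walkD(2)[OF P(1) i0(2)] z xy by simp
    moreover have "h {{P i0, P (Suc i0)}} z y \<le> h ?F2 z y + 1"
      using h_insert_le[OF a, of z y "{{P i0, P (Suc i0)}}"] z xy by simp
    ultimately have "s < h ?F2 z y" using z by simp
    moreover have "h (pedges P (k - 2) \<union> ?F2) z y \<le> s" using gd z xy unfolding F good_def by blast
    ultimately obtain c e where ce: "{c, e} \<in> pedges P (k - 2)" "adj G c e" "h ?F2 z c + h F e y \<le> s"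
      using first_free_split[of "pedges P (k - 2)" ?F2 z y s] z xy F by auto
    have ceV: "c \<in> V" "e \<in> V" using adj_V ce by blast+
    have zero: "h F x v = 0" if v: "{v, w} \<in> pedges P (k - 2)" for v w
    proof -
      obtain t where t: "t \<le> k - 2" "v = P t" using pedges_vertex[OF v] by blast
      have "gaps F P t \<le> gaps F P (k - 2)" by (rule gaps_mono) fact
      then have "h F (P 0) (P t) = 0" using h_walk[OF P(1), of 0 t F] t g0 i0 by simp
      then show ?thesis using t P by simp
    qed
    have "h F x e = 0" using zero[of e c] ce by (simp add: insert_commute)
    then have "s \<le> h F e y" using h_tri[of x e y F] xy ceV hs by simp
    then have "h ?F2 z c = 0" using ce by simp
    moreover have "h F z c \<le> h ?F2 z c" using z ceV by (intro h_mono) (auto simp: F)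
    moreover have "h F c x = 0" using zero[OF ce(1)] h_sym xy ceV by metis
    ultimately show ?thesis using h_tri[of z c x F] z xy ceV by simp
  qed
  have endpoint: "z \<in> P ` {..D} \<or> z \<in> {a1, a2}" if z: "z \<in> V" "h F z x = 0" for z
  proof -
    have "reach G F x 0 z" using h_le_iff[of x z F 0] h_sym[of z x F] z xy by simp
    then have "z = x \<or> (\<exists>v. {v, z} \<in> F)" by (cases rule: reach.cases) auto
    then show ?thesis
    proof (elim disjE exE)
      assume "z = x" then show ?thesis using P by auto
    next
      fix v assume "{v, z} \<in> F"
      then have "{z, v} \<in> F" by (simp add: insert_commute[of z v])
      then have "{z, v} \<in> pedges P (k - 2) \<or> {z, v} = {a1, a2} \<or> {z, v} = {P i0, P (Suc i0)}"
        unfolding F by (simp only: Un_iff insert_iff empty_iff HOL.simp_thms)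
      then consider "{z, v} \<in> pedges P (k - 2)" | "{z, v} = {a1, a2}" | "{z, v} = {P i0, P (Suc i0)}"
        by (elim disjE)
      then show ?thesis
      proof cases
        case 1
        from pedges_vertex[OF this] obtain t where "t \<le> k - 2" "z = P t" by blast
        then show ?thesis using i0 by auto
      next
        case 2 then show ?thesis by auto
      next
        case 3 then have "z = P i0 \<or> z = P (Suc i0)" by auto
        then show ?thesis using i0 by auto
      qed
    qed
  qed
  show ?thesis
  \<comment> \<open>If every neighbour of \<open>x\<close> is within 1 of \<open>P 1\<close>, a
    block starting at position 1 works for \<open>D = k + s - 1\<close>. Otherwise there is a
    neighbour of \<open>x\<close> far from \<open>P 1\<close>, to be used against paths that leave
    \<open>P\<close>.\<close>
  proof (cases "D + 1 = k + s \<and> (\<forall>u. adj G x u \<longrightarrow> d u (P 1) \<le> 1)")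
    case True
    show ?thesis
    proof (rule found_slack[OF dom P _ k, of s 1])
      fix u assume "adj G x u"
      then show "\<exists>t\<ge>1. t \<le> 1 + 1 \<and> d u (P t) \<le> 1" using True by (intro exI[of _ 1]) auto
    qed (use True s in auto)
  next
    case bad: False
    have k4: "k - 3 = Suc (k - 4)" using k by simp
    have k3: "k - 3 < D" "Suc (k - 3) = k - 2" using i0 k by auto
    have adjP: "adj G (P i) (P (Suc i))" if "i < D" for i using walkD(2)[OF P(1) that] .
    show ?thesis
    proof (rule found_walkI[of "(a1, a2)" "(P 0, P 1)" "(P (k - 3), P (k - 2))" "(P i0, P (Suc i0))"])
      show "dedge (a1, a2)" "dedge (P 0, P 1)" "dedge (P (k - 3), P (k - 2))" "dedge (P i0, P (Suc i0))"
        using a adjP[of 0] adjP[of i0] adjP[of "k - 3"] i0 k k3 by (auto simp: dedge_def)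
      fix q l assume q: "walk G q l" "q 0 = snd (P 0, P 1)" "q l = fst (P (k - 3), P (k - 2))"
        and l: "l = d (snd (P 0, P 1)) (fst (P (k - 3), P (k - 2)))"
      have l: "l = k - 4"
      proof -
        have "d (P 1) (P (k - 3)) + 1 \<le> k - 3" using d_walk[OF P(1), of 1 "k - 3"] k k3 by simp
        moreover have "d x (P (k - 3)) \<le> d x (P 1) + d (P 1) (P (k - 3))"
          using xy inV k k3 by (intro h_tri) auto
        ultimately show ?thesis using k4 lev(1)[of 1] lev(1)[of "k - 3"] l k k3 by simp
      qed
      have lev1: "d x (P 1) = 1" "d x (P (k - 3)) = k - 3" using lev(1) k k3 by auto
      have qP: "q i = P (Suc i)" if i: "i \<le> l" for i
      proof (cases "i = l")
        case True then show ?thesis using q l k4 by simp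
      next
        case False
        show ?thesis
        proof (cases "i = 0")
          case True then show ?thesis using q by simp
        next
          case i0': False
          let ?z = "q i"
          have zV: "?z \<in> V" using walkD(1)[OF q(1) i] .
          have z1: "d (P 1) ?z \<le> i" using d_walk[OF q(1), of 0 i] i q by simp
          have z2: "d ?z (P (k - 3)) + i \<le> l" using d_walk[OF q(1), of i l] i q by simp
          have P13: "P 1 \<in> V" "P (k - 3) \<in> V" using inV k k3 by auto
          have "d x ?z \<le> d x (P 1) + d (P 1) ?z" using xy P13 zV by (intro h_tri)
          moreover have "d x (P (k - 3)) \<le> d x ?z + d ?z (P (k - 3))" using xy P13 zV by (intro h_tri)
          ultimately have dz: "d x ?z = Suc i" using z1 z2 lev1 l k4 by linarith
          have "d x y \<le> d x ?z + d ?z y" using xy zV by (intro h_tri)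
          moreover have "k = l + 4" "i < l" using l k i False by auto
          \<comment> \<open>An inner vertex of the path is at distance at most \<open>k - 4\<close>
            from \<open>x\<close>; subtracting this from \<open>D \<ge> k + s - 1\<close> leaves
            exactly \<open>s + 3\<close>.\<close>
          ultimately have "s + 3 \<le> d ?z y" using dz D by linarith
          then have zero: "h F ?z x = 0" by (rule blob[OF zV])
          \<comment> \<open>A vertex merged with \<open>x\<close> is an endpoint of a solution edge.
            Off \<open>P\<close> it can only be an end of \<open>{a1, a2}\<close>, and so can the
            neighbour \<open>u\<close> of \<open>x\<close> far from \<open>P 1\<close>. Then both
            ends of this edge are off \<open>P\<close>, so it forms a component of the solution that
            does not contain \<open>x\<close>.\<close>
          have zP: "?z \<in> P ` {..D}"
          proof (rule ccontr)
            assume nP: "?z \<notin> P ` {..D}"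
            then have za: "?z \<in> {a1, a2}" using endpoint[OF zV zero] by blast
            then have Dk: "D + 1 = k + s" using D' nP by auto
            then obtain u where u: "adj G x u" "1 < d u (P 1)" using bad by (auto simp: not_le)
            have uV: "u \<in> V" using adj_V u by blast
            have "d x y \<le> d u y + 1" by (rule d_pred[OF dom u(1)])
            then have "s + 3 \<le> d u y" using D Dk k by simp
            then have uzero: "h F u x = 0" by (rule blob[OF uV])
            have du: "d x u = 1" using d_adj[OF u(1)] d_0[OF xy(1) uV] adj_V(3)[OF u(1)] by simp
            have uP: "u \<notin> P ` {..D}"
            proof
              assume "u \<in> P ` {..D}"
              then obtain j where "j \<le> D" "u = P j" by auto
              then have "j = 1" using lev(1)[of j] du by simp
              then show False using u \<open>u = P j\<close> uV by simp
            qed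
            then have "u \<in> {a1, a2}" using endpoint[OF uV uzero] by blast
            moreover have "u \<noteq> ?z" using du dz i0' by auto
            ultimately have uz: "{a1, a2} = {u, ?z}" using za by auto
            have step: "w \<in> {u, ?z}" if "{v, w} \<in> F" "v \<in> {u, ?z}" for v w
            proof -
              have vP: "v \<notin> P ` {..D}" using that(2) uP nP by (metis insertE singletonD)
              have "{v, w} \<notin> pedges P (k - 2)"
              proof
                assume "{v, w} \<in> pedges P (k - 2)"
                from pedges_vertex[OF this] obtain t where "t \<le> k - 2" "v = P t" by blast
                then have "v \<in> P ` {..D}" using i0 by (intro image_eqI[of _ _ t]) auto
                then show False using vP by blast
              qed
              moreover have "{v, w} \<noteq> {P i0, P (Suc i0)}"
              proof
                assume "{v, w} = {P i0, P (Suc i0)}"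
                then have "v = P i0 \<or> v = P (Suc i0)" by blast
                moreover have "P i0 \<in> P ` {..D}" "P (Suc i0) \<in> P ` {..D}" using i0 by auto
                ultimately show False using vP by (elim disjE) (simp_all only: not_True_eq_False)
              qed
              ultimately have "{v, w} = {u, ?z}"
                using that(1) uz unfolding F by (simp only: Un_iff insert_iff empty_iff HOL.simp_thms)
              then show ?thesis by blast
            qed
            have "w \<in> {u, ?z}" if "reach G F u c w" "c = 0" for c w
              using that by (induction rule: reach.induct) (use step in blast)+
            then have "x \<in> {u, ?z}" using h_le_iff[of u x F 0] uzero uV xy by blast
            moreover have "x \<in> P ` {..D}" using P(2) by (intro image_eqI[of _ _ 0]) auto
            ultimately show False using uP nP by (metis insertE singletonD)
          qed
          then obtain j where "j \<le> D" "?z = P j" by auto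
          then show ?thesis using dz lev(1)[of j] by simp
        qed
      qed
      have "{pe (a1, a2), pe (P 0, P 1), pe (P (k - 3), P (k - 2)), pe (P i0, P (Suc i0))} \<union> pedges q l = F"
      proof -
        have "pedges q l = (\<lambda>i. {P i, P (Suc i)}) ` {1..<k - 3}"
        proof -
          have "pedges q l = (\<lambda>i. {P i, P (Suc i)}) ` (Suc ` {..<l})"
            unfolding pedges_def image_image using qP by (intro image_cong) auto
          also have "Suc ` {..<l} = {1..<k - 3}" by (simp add: l k4 lessThan_atLeast0 image_Suc_atLeastLessThan)
          finally show ?thesis .
        qed
        moreover have "{..<k - 2} = insert 0 (insert (k - 3) {1..<k - 3})" using k by auto
        ultimately have "pedges P (k - 2) = insert {P 0, P 1} (insert {P (k - 3), P (k - 2)} (pedges q l))"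
          using k3(2) by (simp add: pedges_def)
        then show ?thesis unfolding F pe_def fst_conv snd_conv by blast
      qed
      then show "card ({pe (a1, a2), pe (P 0, P 1), pe (P (k - 3), P (k - 2)), pe (P i0, P (Suc i0))} \<union> pedges q l) \<le> k \<and>
        good s ({pe (a1, a2), pe (P 0, P 1), pe (P (k - 3), P (k - 2)), pe (P i0, P (Suc i0))} \<union> pedges q l)"
        using card gd by simp
    qed
  qed
qed

end

lemma card_free:
  assumes "q \<le> l"
  shows "card {i. q \<le> i \<and> i < l \<and> {p i, p (Suc i)} \<in> F} + gaps F p l = l - q + gaps F p q"
  using assms
proof (induction l rule: dec_induct)
  case base
  have "{i. q \<le> i \<and> i < q \<and> {p i, p (Suc i)} \<in> F} = {}" by auto
  then show ?case by simp
next
  case (step l)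
  have "{i. q \<le> i \<and> i < Suc l \<and> {p i, p (Suc i)} \<in> F} =
    {i. q \<le> i \<and> i < l \<and> {p i, p (Suc i)} \<in> F} \<union> (if {p l, p (Suc l)} \<in> F then {l} else {})"
    using step(1) by (auto simp: less_Suc_eq)
  then show ?case using step by (auto simp: gaps_Suc)
qed

context atgraph
begin

text \<open>The geodesic has \<open>k + s - 1\<close> edges, \<open>s\<close> of them paid, hence
  \<open>k - 1\<close> free ones. As the first \<open>k - 2\<close> are free, there is exactly one
  more, and the edge off the path is the last piece of the solution.\<close>

lemma found_initial_block_off_path:
  assumes dom: "dom x y" and P: "walk G P D" "P 0 = x" "P D = y" and D: "D + 1 = k + s" "d x y = D"
    and F: "F = insert {e1, e2} F1" "F1 \<subseteq> pedges P D" and e: "adj G e1 e2"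
    and g: "gaps F P D = s" "s \<le> h F x y" "gaps F P (k - 2) = 0"
    and card: "card F \<le> k" and gd: "good s F" and k: "5 \<le> k" and s: "2 \<le> s"
  shows "found k s"
proof -
  have kD: "k - 2 \<le> D" using D s by simp
  have "card {i. k - 2 \<le> i \<and> i < D \<and> {P i, P (Suc i)} \<in> F} = 1"
    using card_free[OF kD, of P F] g D k kD by simp
  then obtain i0 where i0: "{i. k - 2 \<le> i \<and> i < D \<and> {P i, P (Suc i)} \<in> F} = {i0}"
    by (auto simp: card_1_singleton_iff)
  then have i0': "k - 2 \<le> i0" "i0 < D" "{P i0, P (Suc i0)} \<in> F" by auto
  have first: "{P i, P (Suc i)} \<in> F" if "i < k - 2" for i
    using gaps_mem[of 0 "k - 2" F P i] g that by simp
  have "F = pedges P (k - 2) \<union> {{e1, e2}, {P i0, P (Suc i0)}}"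
  proof
    show "pedges P (k - 2) \<union> {{e1, e2}, {P i0, P (Suc i0)}} \<subseteq> F"
      using first i0' F(1) by (auto simp: pedges_def)
    show "F \<subseteq> pedges P (k - 2) \<union> {{e1, e2}, {P i0, P (Suc i0)}}"
    proof
      fix f assume f: "f \<in> F"
      show "f \<in> pedges P (k - 2) \<union> {{e1, e2}, {P i0, P (Suc i0)}}"
      proof (cases "f = {e1, e2}")
        case False
        then have "f \<in> pedges P D" using f F by auto
        then obtain i where i: "i < D" "f = {P i, P (Suc i)}" by (auto simp: pedges_def)
        show ?thesis
        proof (cases "i < k - 2")
          case True then show ?thesis using i pedgesI by blast
        next
          case False
          then have "i \<in> {i. k - 2 \<le> i \<and> i < D \<and> {P i, P (Suc i)} \<in> F}" using i f by simp
          then show ?thesis using i0 i by simp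
        qed
      qed simp
    qed
  qed
  then show ?thesis
    using found_initial_block[OF dom P _ D(2) _ i0'(1,2) e card gd g(2) k s] D by simp
qed

text \<open>The first free edge on a cheap route from \<open>u\<close> to \<open>y\<close> cannot be
  on the geodesic, since every vertex of it is too far from \<open>u\<close>. So it is
  \<open>{e, f}\<close>, reached at the plain distance; beyond \<open>f\<close> the route has to
  return to the geodesic at some position \<open>t\<close>, and comparison with the optimal rest
  from there bounds both distances by the paid edges before \<open>t\<close>.\<close>

lemma detour:
  assumes P: "walk G P D" "P D = y" and F: "F = insert {e1, e2} F1" "F1 \<subseteq> pedges P D"
    and e: "adj G e1 e2" and opt: "h F (P 0) y = gaps F P D" "gaps F P D = s"
    and u: "u \<in> V" "h F u y \<le> s" "s < d u y" and bad: "\<forall>t\<le>D. \<not> d u (P t) \<le> gaps F P t"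
  shows "\<exists>e f t. {e, f} = {e1, e2} \<and> adj G e f \<and> t \<le> D \<and> d u e + d f (P t) \<le> gaps F P t"
proof -
  have y: "y \<in> V" using walkD(1)[OF P(1), of D] P by simp
  have F1: "F1 \<subseteq> F" using F by auto
  have hP: "h F (P t) y + gaps F P t = s" if "t \<le> D" for t
    using h_opt[OF P(1), of F t D] opt P that by simp
  have no: False if ab: "{a, b} \<in> F1" "adj G a b" "d u a + h F b y \<le> s" for a b
  proof -
    obtain t where t: "t \<le> D" "a = P t" using pedges_vertex[of a b P D] ab F by blast
    have "h F a y \<le> h F b y" using h_free_tri ab F1 y by blast
    then show False using hP[OF t(1)] ab t bad[rule_format, OF t(1)] by simp
  qed
  have "h F1 u y \<le> s \<or> (\<exists>e f. {e, f} = {e1, e2} \<and> e \<in> V \<and> f \<in> V \<and> h F1 u e + h F1 f y \<le> s)"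
    using h_insert[of e1 e2 F1 u y s] u y F(1) by simp
  then show ?thesis
  proof (elim disjE exE conjE)
    assume "h F1 u y \<le> s"
    from first_free[OF this u(1) y] u(3) obtain a b
      where ab: "{a, b} \<in> F1" "adj G a b" "d u a + h F1 b y \<le> s" by auto
    moreover have "h F b y \<le> h F1 b y" using ab adj_V y F1 by (intro h_mono) auto
    ultimately show ?thesis using no[of a b] by simp
  next
    fix e f assume ef: "{e, f} = {e1, e2}" "e \<in> V" "f \<in> V" "h F1 u e + h F1 f y \<le> s"
    have adj: "adj G e f" using ef(1) e by (simp add: adj_def)
    have fy: "h F f y \<le> h F1 f y" using ef y F1 by (intro h_mono) auto
    have "{e, f} \<in> F" using ef F by simp
    then have ey: "h F e y \<le> h F f y" using h_free_tri adj y by blast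
    have "d u e \<le> h F1 u e"
    proof (rule ccontr)
      assume "\<not> d u e \<le> h F1 u e"
      with first_free[OF order_refl u(1) ef(2), of F1] obtain a b
        where ab: "{a, b} \<in> F1" "adj G a b" "d u a + h F1 b e \<le> h F1 u e" by auto
      have "h F b e \<le> h F1 b e" using ab adj_V ef F1 by (intro h_mono) auto
      moreover have "h F b y \<le> h F b e + h F e y" using ab adj_V ef y by (intro h_tri) auto
      ultimately show False using no[OF ab(1,2)] ab ef fy ey by simp
    qed
    moreover from first_free[OF order_refl ef(3) y, of F1]
    have "\<exists>t\<le>D. d f (P t) + s \<le> h F1 f y + gaps F P t"
    proof (elim disjE exE conjE)
      \<comment> \<open>The route uses no further free edge; then it joins the geodesic at its end
        \<open>y\<close>, with all \<open>s\<close> paid edges behind it.\<close>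
      assume "d f y \<le> h F1 f y" then show ?thesis using P opt by (intro exI[of _ D]) simp
    next
      fix a b assume ab: "{a, b} \<in> F1" "adj G a b" "d f a + h F1 b y \<le> h F1 f y"
      obtain t where t: "t \<le> D" "a = P t" using pedges_vertex[of a b P D] ab F by blast
      have "h F a y \<le> h F b y" using h_free_tri ab F1 y by blast
      moreover have "h F b y \<le> h F1 b y" using ab adj_V y F1 by (intro h_mono) auto
      ultimately show ?thesis using hP[OF t(1)] ab t by (intro exI[of _ t]) simp
    qed
    then obtain t where "t \<le> D" "d f (P t) + s \<le> h F1 f y + gaps F P t" by blast
    ultimately show ?thesis using ef adj by (intro exI[of _ e] exI[of _ f] exI[of _ t]) simp
  qed
qed

text \<open>At each end either all neighbours meet the geodesic early enough, or some neighbour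
  depends on the edge off the path. If both ends have such a neighbour, \<open>u\<close> and
  \<open>v\<close> both use this edge and are thereby too close to each other for the distance of
  \<open>x\<close> and \<open>y\<close>.\<close>

lemma found_one_off_path:
  assumes dom: "dom x y" and P: "walk G P D" "P 0 = x" "P D = y" and D: "D + 1 = k + s" "d x y = D"
    and F: "F = insert {e1, e2} F1" "F1 \<subseteq> pedges P D" and e: "adj G e1 e2"
    and opt: "h F x y = gaps F P D" "gaps F P D = s"
    and card: "card F \<le> k" and gd: "good s F" and k: "5 \<le> k" and s: "2 \<le> s"
  shows "found k s"
proof -
  let ?N = "gaps F P" and ?Q = "\<lambda>i. P (D - i)"
  have Q: "walk G ?Q D" "?Q 0 = y" "?Q D = x" using walk_rev P by auto
  have FQ: "F1 \<subseteq> pedges ?Q D" using F pedges_rev by metis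
  have inV: "P i \<in> V" if "i \<le> D" for i using walkD(1)[OF P(1) that] .
  have xy: "x \<in> V" "y \<in> V" using dom by (auto simp: dom_def)
  have rev: "gaps F ?Q j + ?N (D - j) = s" if "j \<le> D" for j using gaps_rev[OF that, of F P] opt by simp
  have dyx: "d y x = D" and hyx: "h F y x = gaps F ?Q D" and gQ: "gaps F ?Q D = s"
    using D opt h_sym xy rev[of D] by (metis, simp_all add: h_sym[OF xy(2,1)])
  have NP: "?N t \<le> s" if "t \<le> D" for t using gaps_mono[OF that, of F P] opt by simp
  have NQ: "gaps F ?Q t \<le> s" if "t \<le> D" for t using rev[OF that] by simp
  show ?thesis
  proof (cases "\<forall>u. adj G x u \<longrightarrow> (\<exists>t\<le>D. d u (P t) \<le> ?N t)")
    case True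
    then have "found k s \<or> (\<exists>t<D. t = Suc (?N t) \<and> s \<le> ?N t)"
      using D opt k s by (intro found_or_one_free_edge[OF dom P]) auto
    then show ?thesis
    proof (elim disjE exE conjE)
      \<comment> \<open>All \<open>s\<close> paid edges are among the first \<open>s + 1\<close>, so
        the last \<open>D - (s + 1) = k - 2\<close> edges are free: an initial block of the reversed
        geodesic.\<close>
      fix t assume t: "t < D" "t = Suc (?N t)" "s \<le> ?N t"
      then have "?N t = s" using NP[of t] by simp
      then have "t = Suc s" using t by simp
      then have "D - (k - 2) = t" "k - 2 \<le> D" using D k t(1) by auto
      then have "gaps F ?Q (k - 2) = 0" using rev[of "k - 2"] \<open>?N t = s\<close> by simp
      then show ?thesis
        using found_initial_block_off_path[OF dom_sym[OF dom] Q D(1) dyx F(1) FQ e gQ _ _ card gd k s] hyx gQ by simp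
    qed
  next
    case nl: False
    show ?thesis
    proof (cases "\<forall>u. adj G y u \<longrightarrow> (\<exists>t\<le>D. d u (?Q t) \<le> gaps F ?Q t)")
      case True
      then have "found k s \<or> (\<exists>t<D. t = Suc (gaps F ?Q t) \<and> s \<le> gaps F ?Q t)"
        using D gQ k s dyx by (intro found_or_one_free_edge[OF dom_sym[OF dom] Q]) auto
      then show ?thesis
      proof (elim disjE exE conjE)
        fix t assume t: "t < D" "t = Suc (gaps F ?Q t)" "s \<le> gaps F ?Q t"
        then have "gaps F ?Q t = s" using NQ[of t] by simp
        then have "t = Suc s" using t by simp
        then have "D - t = k - 2" "t \<le> D" using D k by auto
        then have "?N (k - 2) = 0" using rev[of t] \<open>gaps F ?Q t = s\<close> by simp
        then show ?thesis
          using found_initial_block_off_path[OF dom P D F e opt(2) _ _ card gd k s] opt by simp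
      qed
    next
      case False
      then obtain v where v: "adj G y v" "\<forall>t\<le>D. \<not> d v (?Q t) \<le> gaps F ?Q t" by blast
      from nl obtain u where u: "adj G x u" "\<forall>t\<le>D. \<not> d u (P t) \<le> ?N t" by blast
      have V: "u \<in> V" "v \<in> V" using adj_V u v by blast+
      have uy: "D \<le> d u y + 1" using d_pred[OF dom u(1)] D by simp
      have vx: "D \<le> d v x + 1" using d_pred[OF dom_sym[OF dom] v(1)] dyx by simp
      have "d u y \<le> d u v + d v y" using V xy by (intro h_tri)
      moreover have "d v y \<le> 1" using d_adj v(1) by (simp add: adj_commute)
      ultimately have far: "D \<le> d u v + 2" using uy by simp
      have hs: "h F u y \<le> s" "h F v x \<le> s" using gd V xy by (auto simp: good_def)
      have "h F (P 0) y = ?N D" "h F (?Q 0) x = gaps F ?Q D" using opt P hyx by auto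
      then obtain p f t p' f' t' where
        a: "{p, f} = {e1, e2}" "adj G p f" "t \<le> D" "d u p + d f (P t) \<le> ?N t" and
        b: "{p', f'} = {e1, e2}" "adj G p' f'" "t' \<le> D" "d v p' + d f' (?Q t') \<le> gaps F ?Q t'"
        using detour[OF P(1,3) F e _ opt(2) V(1) hs(1) _ u(2)]
          detour[OF Q(1,3) F(1) FQ e _ gQ V(2) hs(2) _ v(2)] uy vx D k by auto
      define r where "r = D - t'"
      have r: "r \<le> D" "d v p' + d f' (P r) + ?N r \<le> s" using b rev[OF b(3)] by (auto simp: r_def)
      have pV: "p \<in> V" "f \<in> V" "P t \<in> V" "P r \<in> V" using adj_V a(2) inV a(3) r(1) by auto
      \<comment> \<open>The detours from \<open>u\<close> and from \<open>v\<close> cross the common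
        edge in opposite directions or in the same one.\<close>
      consider "p' = f" "f' = p" | "p' = p" "f' = f" using a(1) b(1) by (auto simp: doubleton_eq_iff)
      then show ?thesis
      proof cases
        case 1
        have "{p, f} \<in> F" using a F by simp
        then have "h F p f = 0" using h_free a by blast
        moreover have "h F x (P r) \<le> ?N r" using h_walk[OF P(1), of 0 r F] r P by simp
        moreover have "h F (P t) y + ?N t \<le> s" using h_walk[OF P(1), of t D F] a(3) P opt by simp
        moreover have "h F x y \<le> h F x (P r) + h F (P r) y" "h F (P r) y \<le> h F (P r) p + h F p y"
          "h F p y \<le> h F p f + h F f y" "h F f y \<le> h F f (P t) + h F (P t) y"
          using xy pV by (intro h_tri; simp)+
        moreover have "h F (P r) p \<le> d p (P r)" "h F f (P t) \<le> d f (P t)"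
          using h_le_d[of p "P r" F] h_sym[of p "P r" F] h_le_d[of f "P t" F] pV by auto
        \<comment> \<open>Going from \<open>x\<close> along the geodesic to \<open>P r\<close>, then
          through \<open>p\<close>, \<open>f\<close> and \<open>P t\<close> to \<open>y\<close>,
          cannot be cheaper than the geodesic. Added to the two detour bounds this gives
          \<open>d u v \<le> s + 1\<close>, while
          \<open>d u v \<ge> D - 2 \<ge> s + 2\<close>.\<close>
        ultimately have "?N t \<le> ?N r + d p (P r) + d f (P t)" using opt by linarith
        then have "d u p + d v f \<le> s" using a(4) r(2) 1 by simp
        moreover have "d u v \<le> d u p + d p v" "d p v \<le> d p f + d f v" using V pV by (intro h_tri; simp)+
        moreover have "d p f \<le> 1" "d f v = d v f" using d_adj[OF a(2)] h_sym[of f v "{}"] pV V by auto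
        ultimately show ?thesis using far D k by linarith
      next
        case 2
        have "d u v \<le> d u p + d p v" "d (P r) (P t) \<le> d (P r) f + d f (P t)" using V pV by (intro h_tri; simp)+
        moreover have "d p v = d v p" "d (P r) f = d f (P r)" using h_sym[of p v "{}"] h_sym[of "P r" f "{}"] pV V by auto
        moreover have "?N t \<le> ?N r + d (P r) (P t)"
        proof (cases "r \<le> t")
          case True
          then have "h F (P r) (P t) + ?N r = ?N t" using h_opt[OF P(1), of F r t] opt P a(3) by simp
          then show ?thesis using h_le_d[of "P r" "P t" F] pV by simp
        next
          case False then show ?thesis using gaps_mono[of t r F P] by simp
        qed
        ultimately have "d u v \<le> s" using a(4) r(2) 2 by simp
        then show ?thesis using far D k by simp
      qed
    qed
  qed
qed

lemma two_free_edges: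
  assumes dom: "dom x y" and W: "walk G W l" "W 0 = x" "W l = y" and l: "l = k + s" "l \<le> d x y + 1"
    and F: "F \<subseteq> pedges W l" and opt: "h F x y = gaps F W l" "gaps F W l = s"
    and gd: "good s F" and k: "5 \<le> k"
  shows "\<exists>t\<le>l. t = gaps F W t + 2 \<and> (\<forall>u. adj G x u \<longrightarrow> (\<exists>r\<le>t. d u (W r) \<le> gaps F W r))"
proof -
  let ?N = "gaps F W"
  let ?T = "{t. t \<le> l \<and> t \<le> ?N t + 2}"
  define t where "t = Max ?T"
  have fin: "finite ?T" by simp
  have "0 \<in> ?T" by simp
  then have "?T \<noteq> {}" by blast
  then have "t \<in> ?T" unfolding t_def by (rule Max_in[OF fin])
  then have t: "t \<le> l" "t \<le> ?N t + 2" by auto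
  have tmax: "j \<le> t" if "j \<le> l" "j \<le> ?N j + 2" for j unfolding t_def using fin that by (intro Max_ge) auto
  have "t < l" using t l opt k by (cases "t = l") auto
  moreover have "\<not> Suc t \<le> ?N (Suc t) + 2" using tmax[of "Suc t"] \<open>t < l\<close> by auto
  then have "t = ?N t + 2" using t gaps_mono[of t "Suc t" F W] by auto
  moreover have "\<exists>r\<le>t. d u (W r) \<le> ?N r" if u: "adj G x u" for u
  proof -
    have V: "u \<in> V" "x \<in> V" "y \<in> V" using adj_V u dom by (auto simp: dom_def)
    have uy: "d x y \<le> d u y + 1" by (rule d_pred[OF dom u])
    have "h F (W 0) y = ?N l" using opt W by simp
    moreover have "h F u y \<le> s" using gd V by (auto simp: good_def)
    ultimately obtain r where r: "r \<le> l" "d u (W r) + ?N l \<le> s + ?N r"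
      using first_free_walk[OF W(1,3) order_refl F, of u s] V uy l k by auto
    have "W r \<in> V" using walkD(1)[OF W(1) r(1)] .
    then have "d u y \<le> d u (W r) + d (W r) y" using V by (intro h_tri)
    moreover have "d (W r) y + r \<le> l" using d_walk[OF W(1), of r l] r W by simp
    ultimately have "r \<le> ?N r + 2" using r opt l uy by linarith
    then show ?thesis using tmax r opt by auto
  qed
  ultimately show ?thesis using t(1) by blast
qed

text \<open>If the walk is a geodesic, the solution is an initial block with two further edges of
  the walk, and it is itself a candidate. If the distance is one smaller, a geodesic has the slack
  of one step, and the free start of the walk confines the neighbours of \<open>x\<close> so much
  that a block starting at position 1 works.\<close>

lemma found_block_walk:
  assumes dom: "dom x y" and W: "walk G W l" "W 0 = x" "W l = y" and l: "l = k + s" "l \<le> d x y + 1"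
    and F: "F \<subseteq> pedges W l" and opt: "h F x y = gaps F W l" "gaps F W l = s" "gaps F W (k - 2) = 0"
    and card: "card F \<le> k" and gd: "good s F" and k: "5 \<le> k" and s: "2 \<le> s"
  shows "found k s"
proof (cases "d x y = l")
  case True
  have kl: "k - 2 \<le> l" using l by simp
  have "card {i. k - 2 \<le> i \<and> i < l \<and> {W i, W (Suc i)} \<in> F} = 2"
    using card_free[OF kl, of W F] opt l k by simp
  then obtain i0 i1 where i: "{i. k - 2 \<le> i \<and> i < l \<and> {W i, W (Suc i)} \<in> F} = {i0, i1}"
    by (auto simp: card_2_iff)
  then have i0: "k - 2 \<le> i0" "i0 < l" "{W i0, W (Suc i0)} \<in> F"
    and i1: "k - 2 \<le> i1" "i1 < l" "{W i1, W (Suc i1)} \<in> F" by auto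
  have first: "{W i, W (Suc i)} \<in> F" if "i < k - 2" for i
    using gaps_mem[of 0 "k - 2" F W i] opt that by simp
  have "F = pedges W (k - 2) \<union> {{W i1, W (Suc i1)}, {W i0, W (Suc i0)}}"
  proof
    show "pedges W (k - 2) \<union> {{W i1, W (Suc i1)}, {W i0, W (Suc i0)}} \<subseteq> F"
      using first i0 i1 by (auto simp: pedges_def)
    show "F \<subseteq> pedges W (k - 2) \<union> {{W i1, W (Suc i1)}, {W i0, W (Suc i0)}}"
    proof
      fix f assume f: "f \<in> F"
      then obtain j where j: "j < l" "f = {W j, W (Suc j)}" using F by (auto simp: pedges_def)
      show "f \<in> pedges W (k - 2) \<union> {{W i1, W (Suc i1)}, {W i0, W (Suc i0)}}"
      proof (cases "j < k - 2")
        case True then show ?thesis using j pedgesI by blast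
      next
        case False
        then have "j \<in> {i. k - 2 \<le> i \<and> i < l \<and> {W i, W (Suc i)} \<in> F}" using j f by simp
        then show ?thesis using i j by auto
      qed
    qed
  qed
  then show ?thesis
    using found_initial_block[OF dom W _ True _ i0(1,2) walkD(2)[OF W(1) i1(2)] card gd _ k s] l opt i1 by auto
next
  case False
  have xy: "x \<in> V" "y \<in> V" using dom by (auto simp: dom_def)
  have "d x y \<le> l" using d_walk[OF W(1), of 0 l] W by simp
  then have D: "d x y + 1 = k + s" using False l by simp
  obtain p where p: "walk G p (d x y)" "p 0 = x" "p (d x y) = y" using geodesic_ex[OF xy] by blast
  obtain t where t: "t = gaps F W t + 2"
    "\<And>u. adj G x u \<Longrightarrow> \<exists>r\<le>t. d u (W r) \<le> gaps F W r" "t \<le> l"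
    using two_free_edges[OF dom W l F opt(1,2) gd k] by blast
  \<comment> \<open>Exactly two of the first \<open>t\<close> edges are free, while all of the first
    \<open>k - 2 \<ge> 3\<close> edges are.\<close>
  have tk: "t \<le> k - 2"
  proof (rule ccontr)
    assume "\<not> t \<le> k - 2"
    then show False using gaps_diff[of "k - 2" t F W] opt(3) t(1) k by simp
  qed
  \<comment> \<open>Nothing is paid before position \<open>k - 2\<close>, so the neighbour lies on
    the walk itself. As the walk is only one longer than the distance, it is at position 1 or 2;
    these two vertices are adjacent, and the second vertex of the geodesic is one of them.\<close>
  have on: "\<exists>j\<in>{1, 2}. u = W j" if u: "adj G x u" for u
  proof -
    obtain r where r: "r \<le> t" "d u (W r) \<le> gaps F W r" using t(2)[OF u] by blast
    then have "gaps F W r = 0" using gaps_mono[of r "k - 2" F W] tk opt by simp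
    have V: "u \<in> V" "W r \<in> V" using adj_V u walkD(1)[OF W(1)] r t by auto
    then have ur: "u = W r" using d_0 r \<open>gaps F W r = 0\<close> by simp
    have "d x y \<le> d x u + d u y" using xy V by (intro h_tri)
    moreover have "d u y + r \<le> l" using d_walk[OF W(1), of r l] ur W r t by simp
    ultimately have "r \<le> 2" using d_adj[OF u] l by linarith
    moreover have "r \<noteq> 0" using ur W adj_V(3)[OF u] by (cases "r = 0") auto
    ultimately show ?thesis using ur by (intro bexI[of _ r]) auto
  qed
  show ?thesis
  proof (rule found_slack[OF dom p D k, of 1])
    fix u assume u: "adj G x u"
    have "adj G x (p 1)" using walkD(2)[OF p(1), of 0] p D k by simp
    from on[OF u] on[OF this] have "u = p 1 \<or> adj G u (p 1)"
      using walkD(2)[OF W(1), of 1] l k by (auto simp: adj_commute numeral_2_eq_2)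
    then have "d u (p 1) \<le> 1" using d_adj adj_V(2)[OF u] by auto
    then show "\<exists>t\<ge>1. t \<le> 1 + 1 \<and> d u (p t) \<le> 1" by (intro exI[of _ 1]) auto
  qed (use s in auto)
qed

text \<open>Both ends restrict the block \<open>a, ..., a + k\<close>: neighbours of
  \<open>x\<close> meet the walk by position \<open>gaps F W t + 2\<close>, those of
  \<open>y\<close> not before \<open>k - 2 + gaps F W t'\<close>. Any \<open>a\<close> between these
  two numbers of paid edges meets both restrictions.\<close>

lemma found_free_walk:
  assumes dom: "dom x y" and W: "walk G W l" "W 0 = x" "W l = y" and l: "l = k + s" "l \<le> d x y + 1"
    and F: "F \<subseteq> pedges W l" and opt: "h F x y = gaps F W l" "gaps F W l = s"
    and card: "card F \<le> k" and gd: "good s F" and k: "5 \<le> k" and s: "2 \<le> s"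
  shows "found k s"
proof -
  let ?N = "gaps F W" and ?Q = "\<lambda>i. W (l - i)"
  have Q: "walk G ?Q l" "?Q 0 = y" "?Q l = x" using walk_rev W by auto
  have FQ: "F \<subseteq> pedges ?Q l" using F pedges_rev by metis
  have xy: "x \<in> V" "y \<in> V" using dom by (auto simp: dom_def)
  have rev: "gaps F ?Q j + ?N (l - j) = s" if "j \<le> l" for j using gaps_rev[OF that, of F W] opt by simp
  have lQ: "l \<le> d y x + 1" and oQ: "h F y x = gaps F ?Q l" "gaps F ?Q l = s"
    using l opt rev[of l] h_sym[OF xy] by simp_all
  obtain t where t: "t \<le> l" "t = ?N t + 2" "\<And>u. adj G x u \<Longrightarrow> \<exists>r\<le>t. d u (W r) \<le> ?N r"
    using two_free_edges[OF dom W l F opt gd k] by blast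
  obtain t2 where t2: "t2 \<le> l" "t2 = gaps F ?Q t2 + 2" "\<And>u. adj G y u \<Longrightarrow> \<exists>r\<le>t2. d u (?Q r) \<le> gaps F ?Q r"
    using two_free_edges[OF dom_sym[OF dom] Q l(1) lQ FQ oQ gd k] by blast
  define t' where "t' = l - t2"
  have t': "t' \<le> l" "t' + 2 = k + ?N t'" using rev[OF t2(1)] t2(1,2) l k by (auto simp: t'_def)
  have right: "\<exists>r\<ge>t'. r \<le> l \<and> d u (W r) + ?N r \<le> s" if u: "adj G y u" for u
  proof -
    obtain r where r: "r \<le> t2" "d u (?Q r) \<le> gaps F ?Q r" using t2(3)[OF u] by blast
    then show ?thesis using rev[of r] t2(1) by (intro exI[of _ "l - r"]) (auto simp: t'_def)
  qed
  have "t \<le> t'"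
  proof (rule ccontr)
    assume "\<not> t \<le> t'"
    then show False using gaps_diff[of t' t F W] t(2) t' k by simp
  qed
  then have N: "?N t \<le> ?N t'" by (rule gaps_mono)
  have Nl: "?N j \<le> s" if "j \<le> l" for j using gaps_mono[OF that, of F W] opt by simp
  \<comment> \<open>A start \<open>a\<close> with \<open>1 \<le> a < s\<close> is required. It does
    not exist between the two bounds if no edge is paid before \<open>t'\<close> or all
    \<open>s\<close> are paid before \<open>t\<close>; then \<open>k - 2\<close> free edges stand at
    the beginning or at the end.\<close>
  consider "?N t' = 0" | "?N t = s" | "?N t' \<noteq> 0" "?N t < s" using Nl[OF t(1)] by linarith
  then show ?thesis
  proof cases
    case 1
    then have "t' = k - 2" using t' by simp
    then show ?thesis using found_block_walk[OF dom W l F opt _ card gd k s] 1 by simp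
  next
    case 2
    then have "gaps F ?Q (k - 2) = 0" using rev[of "l - t"] t l k by simp
    then show ?thesis using found_block_walk[OF dom_sym[OF dom] Q l(1) lQ FQ oQ _ card gd k s] by simp
  next
    case 3
    define a where "a = max 1 (?N t)"
    have a: "1 \<le> a" "a + 1 \<le> s" "?N t \<le> a" "a \<le> ?N t'" using 3 s N by (auto simp: a_def)
    have al: "a + k \<le> l" using a l by simp
    show ?thesis
    proof (rule found_walk[OF dom W, of a "a + k - 2" k a "s - a"])
      fix u assume u: "adj G x u"
      obtain r where r: "r \<le> t" "d u (W r) \<le> ?N r" using t(3)[OF u] by blast
      have V: "u \<in> V" "W r \<in> V" "W a \<in> V" using adj_V u walkD(1)[OF W(1)] r t(1) al by auto
      show "\<exists>t\<ge>a. t \<le> a + 2 \<and> d u (W t) \<le> a"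
      proof (cases "a \<le> r")
        case True
        then show ?thesis using r t(2) a gaps_mono[OF r(1), of F W] by (intro exI[of _ r]) auto
      next
        case False
        have "d u (W a) \<le> d u (W r) + d (W r) (W a)" using V by (intro h_tri)
        moreover have "d (W r) (W a) + r \<le> a" using d_walk[OF W(1), of r a] False al by simp
        ultimately have "d u (W a) \<le> a" using r gaps_le[of F W r] by linarith
        then show ?thesis by (intro exI[of _ a]) auto
      qed
    next
      fix u assume u: "adj G y u"
      obtain r where r: "t' \<le> r" "r \<le> l" "d u (W r) + ?N r \<le> s" using right[OF u] by blast
      have V: "u \<in> V" "W r \<in> V" "W (a + k) \<in> V" using adj_V u walkD(1)[OF W(1)] r al by auto
      show "\<exists>t\<ge>a + k - 2. t \<le> a + k - 2 + 2 \<and> d u (W t) \<le> s - a"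
      proof (cases "r \<le> a + k")
        case True
        then show ?thesis using r t'(2) a gaps_mono[OF r(1), of F W] k by (intro exI[of _ r]) auto
      next
        case False
        have "d u (W (a + k)) \<le> d u (W r) + d (W r) (W (a + k))" using V by (intro h_tri)
        moreover have "d (W r) (W (a + k)) = d (W (a + k)) (W r)" using V by (intro h_sym)
        moreover have "d (W (a + k)) (W r) + (a + k) \<le> r" using d_walk[OF W(1), of "a + k" r] False r by simp
        moreover have "s \<le> ?N r + (l - r)" using gaps_diff[OF r(2), of F W] opt by simp
        ultimately have "d u (W (a + k)) \<le> s - a" using r l by linarith
        then show ?thesis using k by (intro exI[of _ "a + k"]) auto
      qed
    qed (use a al l k in auto)
  qed
qed

theorem found_if_good:
  assumes F: "F \<subseteq> edges G" "card F \<le> k" "good s F" and no: "\<not> good s {}" and s: "2 \<le> s"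
  shows "found k s"
proof -
  have fin: "finite F" using F fin_edges finite_subset by blast
  have "F \<noteq> {}" using F no by auto
  \<comment> \<open>With the exact size of the solution in place of \<open>k\<close>, the edge count
    along the walk becomes an equation; the result for \<open>m\<close> carries over to larger
    \<open>k\<close>.\<close>
  define m where "m = card F"
  have "found m s"
  proof (cases "m \<le> 4")
    case True
    then show ?thesis using found_small[OF F(1) \<open>F \<noteq> {}\<close> _ _ F(3), of m] by (simp add: m_def)
  next
    case False
    then have k: "5 \<le> m" by simp
    obtain x y where dom: "dom x y" using dominating_pair unfolding dom_def by blast
    then have xy: "x \<in> V" "y \<in> V" by (auto simp: dom_def)
    \<comment> \<open>A vertex dominating alone would be near every vertex; any two vertices would
      then be at distance at most \<open>2 \<le> s\<close>, with nothing to contract.\<close>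
    have "x \<noteq> y"
    proof
      assume "x = y"
      have near: "d z x \<le> 1" if z: "z \<in> V" for z
        using dom z av_refl[OF xy(1), of z] near_d[OF z xy(1)] \<open>x = y\<close> by (auto simp: dom_def)
      have "d u v \<le> s" if "u \<in> V" "v \<in> V" for u v
        using h_tri[of u x v "{}"] h_sym[of x v "{}"] near[OF that(1)] near[OF that(2)] that xy s by simp
      then show False using no by (auto simp: good_def)
    qed
    show ?thesis
    proof (cases "d x y + 2 \<le> m + s")
      case True then show ?thesis using found_near_pair[OF dom \<open>x \<noteq> y\<close> _ s k] by blast
    next
      case far: False
      obtain W l where W: "walk G W l" "W 0 = x" "W l = y" and g: "gaps F W l = h F x y" and inj: "inj_on W {..l}"
        using opt_walk[OF xy] by blast
      have hs: "h F x y \<le> s" using F(3) xy by (simp add: good_def)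
      let ?I = "F \<inter> pedges W l"
      have cI: "card ?I + h F x y = l" using card_pedges_gaps[OF inj, of F] g by simp
      have Im: "card ?I \<le> m" unfolding m_def using fin by (intro card_mono) auto
      have dl: "d x y \<le> l" using d_walk[OF W(1), of 0 l] W by simp
      have sub: "F \<subseteq> pedges W l" if "card ?I = m"
      proof -
        have "?I = F" using fin that by (intro card_subset_eq) (auto simp: m_def)
        then show ?thesis by blast
      qed
      \<comment> \<open>The sum of solution edges on the walk and cost is
        \<open>l \<ge> d x y \<ge> m + s - 1\<close>, while the summands are at most
        \<open>m\<close> and \<open>s\<close>. So at most one of them falls short, and by one
        only.\<close>
      consider "card ?I = m" "h F x y = s" | "card ?I = m" "h F x y + 1 = s" | "card ?I + 1 = m" "h F x y = s"
        using cI Im hs dl far by linarith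
      then show ?thesis
      proof cases
        case 1
        then show ?thesis
          using found_free_walk[OF dom W _ _ sub[OF 1(1)] _ _ _ F(3) k s] g cI far dl by (simp add: m_def)
      next
        case 2
        then show ?thesis
          using found_all_on_path[OF dom W _ _ sub[OF 2(1)] _ _ F(3) k s] g cI far dl by simp
      next
        case 3
        have "card (F - ?I) = 1" using 3 fin by (simp add: card_Diff_subset m_def)
        then obtain e where e: "F - ?I = {e}" by (auto simp: card_1_singleton_iff)
        then have "e \<in> edges G" using F by blast
        then obtain e1 e2 where e12: "e = {e1, e2}" "adj G e1 e2"
          using edge_dedge[of e] by (auto simp: dedge_def pe_def)
        have "F = insert {e1, e2} ?I" using e e12 by blast
        then show ?thesis
          using found_one_off_path[OF dom W _ _ _ _ e12(2) _ _ _ F(3) k s, of ?I] g cI far dl 3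
          by (simp add: m_def)
      qed
    qed
  qed
  then show ?thesis using found_mono F(2) by (simp add: m_def)
qed

end

section \<open>Contractions and free edges\<close>

text \<open>A finite bound excludes the empty infimum, which is infinite; an infimum of a nonempty
  set of extended naturals is attained.\<close>

lemma vdist_le_iff: "vdist H u v \<le> enat c \<longleftrightarrow> reach H {} u c v"
proof
  let ?A = "{p. path_between H u p v}"
  assume le: "vdist H u v \<le> enat c"
  have "?A \<noteq> {}"
  proof
    assume "?A = {}"
    then have "vdist H u v = \<infinity>" unfolding vdist_def by (simp add: top_enat_def)
    then show False using le by simp
  qed
  then have "(INF p \<in> ?A. enat (length p - 1)) \<in> (\<lambda>p. enat (length p - 1)) ` ?A"
    unfolding Inf_enat_def by (auto intro: LeastI)
  then obtain p where "path_between H u p v" "vdist H u v = enat (length p - 1)"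
    unfolding vdist_def by auto
  then show "reach H {} u c v" using le reach_mono[OF path_reach] by simp
next
  assume "reach H {} u c v"
  from reach_path[OF this] obtain p where "path_between H u p v" "length p - 1 \<le> c" by blast
  then have "vdist H u v \<le> enat (length p - 1)" unfolding vdist_def by (intro INF_lower) simp
  also have "\<dots> \<le> enat c" using \<open>length p - 1 \<le> c\<close> by simp
  finally show "vdist H u v \<le> enat c" .
qed

lemma diameter_le_iff: "graph_diameter H \<le> enat c \<longleftrightarrow> (\<forall>u\<in>verts H. \<forall>v\<in>verts H. reach H {} u c v)"
  unfolding graph_diameter_def by (simp add: SUP_le_iff vdist_le_iff)

lemma iso_diameter_le:
  assumes "bij_betw f (verts G) (verts H)"
    and "\<forall>u\<in>verts G. \<forall>v\<in>verts G. adj G u v \<longleftrightarrow> adj H (f u) (f v)"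
  shows "graph_diameter G \<le> enat c \<longleftrightarrow> graph_diameter H \<le> enat c"
proof -
  have into: "f u \<in> verts H" if "u \<in> verts G" for u using assms(1) that by (auto simp: bij_betw_def)
  have onto: "\<exists>u\<in>verts G. f u = w" if "w \<in> verts H" for w
  proof -
    have "w \<in> f ` verts G" using bij_betw_imp_surj_on[OF assms(1)] that by simp
    then show ?thesis by blast
  qed
  have inj: "u = v" if "u \<in> verts G" "v \<in> verts G" "f u = f v" for u v
    using assms(1) that by (auto simp: bij_betw_def inj_on_def)
  have fwd: "reach H {} (f u) c (f v)" if "reach G {} u c v" for u c v
    using that
  proof (induction rule: reach.induct)
    case (stay c) then show ?case using into by (auto intro: reach.stay)
  next
    case (free c v w) then show ?case by simp
  next
    case (pay c v w)
    then have "adj H (f v) (f w)" "f w \<in> verts H" using assms(2) into reach_verts(2) by metis+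
    then show ?case using pay by (blast intro: reach.pay)
  qed
  have bwd: "\<forall>v\<in>verts G. f v = b \<longrightarrow> reach G {} u c v" if "reach H {} (f u) c b" "u \<in> verts G" for u c b
    using that
  proof (induction rule: reach.induct)
    case (stay c) then show ?case using inj by (auto intro: reach.stay)
  next
    case (free c v w) then show ?case by simp
  next
    case (pay c b b')
    show ?case
    proof (intro ballI impI)
      fix v' assume v': "v' \<in> verts G" "f v' = b'"
      obtain v where v: "v \<in> verts G" "f v = b" using onto reach_verts(2) pay by metis
      then have "adj G v v'" using assms(2) v' pay by auto
      then show "reach G {} u (Suc c) v'" using pay v v' by (blast intro: reach.pay)
    qed
  qed
  show ?thesis
    unfolding diameter_le_iff
  proof
    assume "\<forall>u\<in>verts G. \<forall>v\<in>verts G. reach G {} u c v"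
    then show "\<forall>u\<in>verts H. \<forall>v\<in>verts H. reach H {} u c v" using fwd onto by metis
  next
    assume "\<forall>u\<in>verts H. \<forall>v\<in>verts H. reach H {} u c v"
    then show "\<forall>u\<in>verts G. \<forall>v\<in>verts G. reach G {} u c v" using bwd into by metis
  qed
qed

section \<open>Distances in a contraction as costs in the graph\<close>

context
  fixes G :: "'a ugraph" and F :: "'a set set"
  assumes simple: "simple_graph G" and F: "F \<subseteq> edges G"
begin

lemma blob_reach:
  assumes "u \<in> verts G"
  shows "v \<in> blob G F u \<longleftrightarrow> reach G F u 0 v"
proof
  assume "v \<in> blob G F u"
  then have "(u, v) \<in> {(a, b). {a, b} \<in> F}\<^sup>*" by (simp add: blob_def)
  then show "reach G F u 0 v"
  proof (induction rule: rtrancl_induct)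
    case base then show ?case using assms by (rule reach.stay)
  next
    case (step y z)
    then have "{y, z} \<in> edges G" using F by auto
    then have "adj G y z" "z \<in> verts G" using simple by (auto simp: adj_def simple_graph_def)
    then show ?case using step by (auto intro: reach.free)
  qed
next
  assume "reach G F u 0 v"
  moreover have "c = 0 \<longrightarrow> (u, v) \<in> {(a, b). {a, b} \<in> F}\<^sup>*" if "reach G F u c v" for c v
    using that by (induction rule: reach.induct) (auto intro: rtrancl.rtrancl_into_rtrancl)
  ultimately show "v \<in> blob G F u" using reach_verts by (fastforce simp: blob_def)
qed

lemma blob_eq_iff:
  assumes "u \<in> verts G" "v \<in> verts G"
  shows "blob G F u = blob G F v \<longleftrightarrow> reach G F u 0 v"
proof
  assume "blob G F u = blob G F v"
  then show "reach G F u 0 v" using blob_reach assms reach.stay by metis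
next
  assume r: "reach G F u 0 v"
  show "blob G F u = blob G F v"
    using blob_reach[OF assms(1)] blob_reach[OF assms(2)] reach_trans[OF _ r] reach_trans[OF _ reach_sym[OF r]]
    by auto
qed

lemma adj_contract:
  "adj (contract G F) A B \<longleftrightarrow> A \<noteq> B \<and> (\<exists>u v. adj G u v \<and> A = blob G F u \<and> B = blob G F v)"
proof
  assume "adj (contract G F) A B"
  then obtain u v where uv: "{A, B} = {blob G F u, blob G F v}" "adj G u v" "blob G F u \<noteq> blob G F v"
    by (auto simp: adj_def contract_def)
  then have "A \<noteq> B \<and> (A = blob G F u \<and> B = blob G F v \<or> A = blob G F v \<and> B = blob G F u)"
    by (metis doubleton_eq_iff)
  then show "A \<noteq> B \<and> (\<exists>u v. adj G u v \<and> A = blob G F u \<and> B = blob G F v)"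
    using uv adj_commute by metis
qed (auto simp: adj_def contract_def)

text \<open>Moving inside a blob is free, and leaving it pays one edge. Back from the contraction,
  the induction speaks of all vertices of the blob reached, because the next edge may leave the blob
  at a vertex other than the one at which it was entered.\<close>

lemma reach_contract:
  assumes "u \<in> verts G" "v \<in> verts G"
  shows "reach (contract G F) {} (blob G F u) c (blob G F v) \<longleftrightarrow> reach G F u c v"
proof
  assume "reach G F u c v"
  then show "reach (contract G F) {} (blob G F u) c (blob G F v)"
  proof (induction rule: reach.induct)
    case (stay c) then show ?case by (intro reach.stay) (auto simp: contract_def)
  next
    case (free c v w)
    have v: "v \<in> verts G" using reach_verts free by metis
    have "reach G F v 0 w" using free v by (auto intro: reach.free reach.stay)
    then have "blob G F v = blob G F w" using blob_eq_iff v free by blast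
    then show ?case using free by simp
  next
    case (pay c v w)
    show ?case
    proof (cases "blob G F v = blob G F w")
      case True
      have "reach (contract G F) {} (blob G F u) (Suc c) (blob G F v)"
        by (rule reach_mono[OF pay.IH]) auto
      then show ?thesis using True by simp
    next
      case False
      then have "adj (contract G F) (blob G F v) (blob G F w)" using pay adj_contract by blast
      moreover have "blob G F w \<in> verts (contract G F)" using pay by (simp add: contract_def)
      ultimately show ?thesis using pay by (blast intro: reach.pay)
    qed
  qed
next
  assume "reach (contract G F) {} (blob G F u) c (blob G F v)"
  moreover have "\<forall>v\<in>verts G. blob G F v = B \<longrightarrow> reach G F u c v"
    if "reach (contract G F) {} (blob G F u) c B" for B c
    using that
  proof (induction rule: reach.induct)
    case (stay c)
    show ?case
    proof (intro ballI impI)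
      fix v assume "v \<in> verts G" "blob G F v = blob G F u"
      then have "reach G F u 0 v" using blob_eq_iff[OF assms(1), of v] by simp
      then show "reach G F u c v" by (rule reach_mono) auto
    qed
  next
    case (free c v w) then show ?case by simp
  next
    case (pay c B B')
    obtain a b where ab: "adj G a b" "B = blob G F a" "B' = blob G F b" using pay(3)[unfolded adj_contract] by blast
    then have V: "a \<in> verts G" "b \<in> verts G" using simple by (auto simp: adj_def simple_graph_def)
    have "reach G F u c a" using pay.IH V(1) ab(2) by simp
    then have r: "reach G F u (Suc c) b" using V(2) ab(1) by (rule reach.pay)
    show ?case
    proof (intro ballI impI)
      fix w assume w: "w \<in> verts G" "blob G F w = B'"
      then have "reach G F b 0 w" using blob_eq_iff[OF V(2) w(1)] ab by simp
      from reach_trans[OF this r] show "reach G F u (Suc c) w" by simp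
    qed
  qed
  ultimately show "reach G F u c v" using assms by blast
qed

lemma contract_diameter_le:
  "graph_diameter (contract G F) \<le> enat c \<longleftrightarrow> (\<forall>u\<in>verts G. \<forall>v\<in>verts G. reach G F u c v)"
proof -
  have "verts (contract G F) = blob G F ` verts G" by (simp add: contract_def)
  then show ?thesis unfolding diameter_le_iff using reach_contract by auto
qed

text \<open>Naming every blob by one of its vertices gives a copy of the contraction over the
  vertex type of \<open>G\<close>.\<close>

lemma contract_copy: "\<exists>H :: 'a ugraph. simple_graph H \<and> ugraph_iso (contract G F) H"
proof -
  let ?C = "contract G F"
  define f where "f B = (SOME u. u \<in> B)" for B :: "'a set"
  define H where "H = \<lparr>verts = f ` verts ?C, edges = {{f A, f B} | A B. adj ?C A B}\<rparr>"
  have vC: "verts ?C = blob G F ` verts G" by (simp add: contract_def)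
  have fin: "f (blob G F u) \<in> blob G F u" if "u \<in> verts G" for u
    unfolding f_def using blob_reach[OF that] reach.stay[OF that] by (metis someI)
  have "inj_on f (verts ?C)"
  proof (rule inj_onI)
    fix A B assume AB: "A \<in> verts ?C" "B \<in> verts ?C" "f A = f B"
    then obtain u v where uv: "u \<in> verts G" "v \<in> verts G" "A = blob G F u" "B = blob G F v" using vC by auto
    have "reach G F u 0 (f A)" using fin[OF uv(1)] blob_reach[OF uv(1)] uv(3) by simp
    moreover have "reach G F v 0 (f B)" using fin[OF uv(2)] blob_reach[OF uv(2)] uv(4) by simp
    ultimately have "reach G F u 0 v" using reach_trans[OF reach_sym, of G F v 0 "f B" u 0] AB by simp
    then show "A = B" using blob_eq_iff[OF uv(1,2)] uv(3,4) by simp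
  qed
  then have bij: "bij_betw f (verts ?C) (verts H)" by (simp add: H_def inj_on_imp_bij_betw)
  have adjV: "A \<in> verts ?C \<and> B \<in> verts ?C" if a: "adj ?C A B" for A B
  proof -
    obtain u v where "adj G u v" "A = blob G F u" "B = blob G F v" using a[unfolded adj_contract] by blast
    then show ?thesis using simple vC by (auto simp: adj_def simple_graph_def)
  qed
  have inj: "f A = f B \<longleftrightarrow> A = B" if "A \<in> verts ?C" "B \<in> verts ?C" for A B
    using \<open>inj_on f (verts ?C)\<close> that by (auto simp: inj_on_def)
  have "adj ?C A B \<longleftrightarrow> adj H (f A) (f B)" if AB: "A \<in> verts ?C" "B \<in> verts ?C" for A B
  proof
    assume "adj H (f A) (f B)"
    then obtain A' B' where A'B': "{f A, f B} = {f A', f B'}" "adj ?C A' B'" by (auto simp: H_def adj_def)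
    then have "A = A' \<and> B = B' \<or> A = B' \<and> B = A'"
      using adjV[OF A'B'(2)] inj AB by (auto simp: doubleton_eq_iff)
    then show "adj ?C A B" using A'B' adj_commute by metis
  qed (auto simp: H_def adj_def)
  then have iso: "ugraph_iso ?C H" unfolding ugraph_iso_def using bij by blast
  moreover have "simple_graph H"
    unfolding simple_graph_def
  proof (intro conjI ballI)
    show "finite (verts H)" using simple by (simp add: H_def vC simple_graph_def)
    fix e assume "e \<in> edges H"
    then obtain A B where AB: "e = {f A, f B}" "adj ?C A B" by (auto simp: H_def)
    then have "A \<noteq> B" using adj_contract by simp
    then show "card e = 2" "e \<subseteq> verts H" using AB adjV[OF AB(2)] inj by (auto simp: H_def)
  qed
  ultimately show ?thesis by blast
qed

end

lemma s_club_contraction_iff: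
  fixes G :: "'a ugraph"
  assumes "simple_graph G"
  shows "s_club_contraction s G k \<longleftrightarrow>
    (\<exists>F\<subseteq>edges G. card F \<le> k \<and> (\<forall>u\<in>verts G. \<forall>v\<in>verts G. reach G F u s v))"
proof
  assume "s_club_contraction s G k"
  then obtain H :: "'a ugraph" and F where *: "graph_diameter H \<le> enat s" "F \<subseteq> edges G" "card F \<le> k"
    "ugraph_iso (contract G F) H"
    unfolding s_club_contraction_def contractible_to_def by blast
  then have "graph_diameter (contract G F) \<le> enat s"
    unfolding ugraph_iso_def using iso_diameter_le by blast
  then show "\<exists>F\<subseteq>edges G. card F \<le> k \<and> (\<forall>u\<in>verts G. \<forall>v\<in>verts G. reach G F u s v)"
    using contract_diameter_le[OF assms *(2)] * by blast
next
  assume "\<exists>F\<subseteq>edges G. card F \<le> k \<and> (\<forall>u\<in>verts G. \<forall>v\<in>verts G. reach G F u s v)"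
  then obtain F where F: "F \<subseteq> edges G" "card F \<le> k" "graph_diameter (contract G F) \<le> enat s"
    using contract_diameter_le[OF assms] by blast
  obtain H :: "'a ugraph" where H: "simple_graph H" "ugraph_iso (contract G F) H"
    using contract_copy[OF assms F(1)] by blast
  then have "graph_diameter H \<le> enat s" using F(3) unfolding ugraph_iso_def using iso_diameter_le by blast
  then show "s_club_contraction s G k"
    unfolding s_club_contraction_def contractible_to_def using F H by blast
qed

section \<open>Running programs\<close>

text \<open>A total-correctness triple with a time bound. As \<open>exec\<close> gets stuck on
  overflow, it also certifies that all values fit into a word.\<close>

definition run :: "nat \<Rightarrow> prog \<Rightarrow> state \<Rightarrow> nat \<Rightarrow> (state \<Rightarrow> bool) \<Rightarrow> bool" where
  "run W c \<sigma> T Q \<longleftrightarrow> (\<exists>t \<tau>. exec W c \<sigma> t \<tau> \<and> t \<le> T \<and> Q \<tau>)"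

lemma run_mono: "run W c \<sigma> T Q \<Longrightarrow> T \<le> T' \<Longrightarrow> (\<And>\<tau>. Q \<tau> \<Longrightarrow> Q' \<tau>) \<Longrightarrow> run W c \<sigma> T' Q'"
  unfolding run_def by (meson order_trans)

lemma run_Seq:
  assumes "run W c1 \<sigma> T1 R" "\<And>\<sigma>'. R \<sigma>' \<Longrightarrow> run W c2 \<sigma>' T2 Q"
  shows "run W (Seq c1 c2) \<sigma> (T1 + T2) Q"
proof -
  obtain t1 \<sigma>' where 1: "exec W c1 \<sigma> t1 \<sigma>'" "t1 \<le> T1" "R \<sigma>'" using assms(1) by (auto simp: run_def)
  then obtain t2 \<tau> where 2: "exec W c2 \<sigma>' t2 \<tau>" "t2 \<le> T2" "Q \<tau>"
    using assms(2) unfolding run_def by blast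
  have "exec W (Seq c1 c2) \<sigma> (t1 + t2) \<tau>" using 1(1) 2(1) by (rule exec.Seq)
  moreover have "t1 + t2 \<le> T1 + T2" using 1 2 by simp
  ultimately show ?thesis using 2(3) unfolding run_def by blast
qed

lemma run_Cond:
  assumes "tval \<sigma> b \<Longrightarrow> run W c1 \<sigma> T Q" "\<not> tval \<sigma> b \<Longrightarrow> run W c2 \<sigma> T Q"
  shows "run W (Cond b c1 c2) \<sigma> (Suc T) Q"
proof (cases "tval \<sigma> b")
  case True
  then obtain t \<tau> where "exec W c1 \<sigma> t \<tau>" "t \<le> T" "Q \<tau>" using assms by (auto simp: run_def)
  then show ?thesis unfolding run_def using exec.CondTrue[OF True] by (meson Suc_le_mono)
next
  case False
  then obtain t \<tau> where "exec W c2 \<sigma> t \<tau>" "t \<le> T" "Q \<tau>" using assms by (auto simp: run_def)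
  then show ?thesis unfolding run_def using exec.CondFalse[OF False] by (meson Suc_le_mono)
qed

text \<open>Loop-free programs are evaluated symbolically: \<open>st\<close> computes the final state, \<open>safe\<close> collects
  the word-size conditions, and \<open>tb\<close> bounds the running time.\<close>

fun st :: "prog \<Rightarrow> state \<Rightarrow> state" where
  "st (Assign r f a b) \<sigma> = \<sigma>\<lparr>regs := (regs \<sigma>)(r := apply_op f (oval \<sigma> a) (oval \<sigma> b))\<rparr>"
| "st (Load r A i) \<sigma> = \<sigma>\<lparr>regs := (regs \<sigma>)(r := arrs \<sigma> A (oval \<sigma> i))\<rparr>"
| "st (Store A i a) \<sigma> = \<sigma>\<lparr>arrs := (arrs \<sigma>)(A := (arrs \<sigma> A)(oval \<sigma> i := oval \<sigma> a))\<rparr>"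
| "st (Seq c1 c2) \<sigma> = st c2 (st c1 \<sigma>)"
| "st (Cond b c1 c2) \<sigma> = (if tval \<sigma> b then st c1 \<sigma> else st c2 \<sigma>)"
| "st c \<sigma> = \<sigma>"

fun safe :: "nat \<Rightarrow> prog \<Rightarrow> state \<Rightarrow> bool" where
  "safe W Skip \<sigma> = True"
| "safe W (Assign r f a b) \<sigma> = (apply_op f (oval \<sigma> a) (oval \<sigma> b) \<le> W)"
| "safe W (Load r A i) \<sigma> = (arrs \<sigma> A (oval \<sigma> i) \<le> W)"
| "safe W (Store A i a) \<sigma> = (oval \<sigma> a \<le> W)"
| "safe W (Seq c1 c2) \<sigma> = (safe W c1 \<sigma> \<and> safe W c2 (st c1 \<sigma>))"
| "safe W (Cond b c1 c2) \<sigma> = (if tval \<sigma> b then safe W c1 \<sigma> else safe W c2 \<sigma>)"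
| "safe W (While b c) \<sigma> = False"

fun tb :: "prog \<Rightarrow> nat" where
  "tb (Seq c1 c2) = tb c1 + tb c2"
| "tb (Cond b c1 c2) = Suc (max (tb c1) (tb c2))"
| "tb c = 1"

lemma safe_exec: "safe W c \<sigma> \<Longrightarrow> \<exists>t \<le> tb c. exec W c \<sigma> t (st c \<sigma>)"
proof (induction c arbitrary: \<sigma>)
  case Skip then show ?case using exec.Skip[of W \<sigma>] by (intro exI[of _ 1]) simp
next
  case (Assign r f a b)
  then show ?case using exec.Assign[OF HOL.refl, of f \<sigma> a b W r] by (intro exI[of _ 1]) simp
next
  case (Load r A i)
  then show ?case using exec.Load[OF HOL.refl, of \<sigma> A i W r] by (intro exI[of _ 1]) simp
next
  case (Store A i a)
  then show ?case using exec.Store[OF HOL.refl, of \<sigma> a W A i] by (intro exI[of _ 1]) simp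
next
  case (Seq c1 c2)
  then obtain t1 t2 where "t1 \<le> tb c1" "exec W c1 \<sigma> t1 (st c1 \<sigma>)" "t2 \<le> tb c2"
    "exec W c2 (st c1 \<sigma>) t2 (st c2 (st c1 \<sigma>))" by fastforce
  then show ?case by (intro exI[of _ "t1 + t2"]) (auto intro: exec.Seq)
next
  case (Cond b c1 c2)
  show ?case
  proof (cases "tval \<sigma> b")
    case True
    then obtain t where "t \<le> tb c1" "exec W c1 \<sigma> t (st c1 \<sigma>)" using Cond by fastforce
    then show ?thesis using True by (intro exI[of _ "Suc t"]) (auto intro: exec.CondTrue)
  next
    case False
    then obtain t where "t \<le> tb c2" "exec W c2 \<sigma> t (st c2 \<sigma>)" using Cond by fastforce
    then show ?thesis using False by (intro exI[of _ "Suc t"]) (auto intro: exec.CondFalse)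
  qed
qed simp

lemma run_safe: "safe W c \<sigma> \<Longrightarrow> tb c \<le> T \<Longrightarrow> Q (st c \<sigma>) \<Longrightarrow> run W c \<sigma> T Q"
  unfolding run_def using safe_exec order_trans by blast

fun block :: "prog list \<Rightarrow> prog" where
  "block [] = Skip"
| "block (c # cs) = (if cs = [] then c else Seq c (block cs))"

definition For :: "string \<Rightarrow> string \<Rightarrow> prog \<Rightarrow> prog" where
  "For i b body = Seq (Assign i Add (Imm 0) (Imm 0))
     (While (Less (Reg i) (Reg b)) (Seq body (Assign i Add (Reg i) (Imm 1))))"

text \<open>Each round adds the test and the increment to the body; the initial assignment and the
  last test account for the final 2. The invariant is stated for the state after the increment, so
  it may mention the counter.\<close>

lemma run_For:
  assumes b: "regs \<sigma> b = n" "i \<noteq> b" "n \<le> W"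
    and init: "I 0 (\<sigma>\<lparr>regs := (regs \<sigma>)(i := 0)\<rparr>)"
    and step: "\<And>j \<sigma>. j < n \<Longrightarrow> I j \<sigma> \<Longrightarrow> regs \<sigma> i = j \<Longrightarrow> regs \<sigma> b = n \<Longrightarrow>
      run W body \<sigma> T (\<lambda>\<tau>. regs \<tau> i = j \<and> regs \<tau> b = n \<and> I (Suc j) (\<tau>\<lparr>regs := (regs \<tau>)(i := Suc j)\<rparr>))"
  shows "run W (For i b body) \<sigma> ((T + 2) * n + 2) (\<lambda>\<tau>. I n \<tau> \<and> regs \<tau> i = n)"
proof -
  let ?w = "While (Less (Reg i) (Reg b)) (Seq body (Assign i Add (Reg i) (Imm 1)))"
  have "run W ?w \<sigma> ((T + 2) * (n - j) + 1) (\<lambda>\<tau>. I n \<tau> \<and> regs \<tau> i = n)"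
    if "j \<le> n" "I j \<sigma>" "regs \<sigma> i = j" "regs \<sigma> b = n" for j \<sigma>
    using that
  proof (induction "n - j" arbitrary: j \<sigma>)
    case 0
    then have "\<not> tval \<sigma> (Less (Reg i) (Reg b))" "j = n" by auto
    moreover have "exec W ?w \<sigma> 1 \<sigma>" by (rule exec.WhileFalse) fact
    ultimately show ?case unfolding run_def using 0
      by (intro exI[of _ 1] exI[of _ \<sigma>] conjI) simp_all
  next
    case (Suc d)
    then have j: "j < n" by simp
    obtain t1 \<sigma>1 where 1: "exec W body \<sigma> t1 \<sigma>1" "t1 \<le> T" "regs \<sigma>1 i = j" "regs \<sigma>1 b = n"
      "I (Suc j) (\<sigma>1\<lparr>regs := (regs \<sigma>1)(i := Suc j)\<rparr>)"
      using step[OF j Suc.prems(2-4)] unfolding run_def by blast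
    let ?\<sigma>2 = "\<sigma>1\<lparr>regs := (regs \<sigma>1)(i := Suc j)\<rparr>"
    have 2: "exec W (Assign i Add (Reg i) (Imm 1)) \<sigma>1 1 ?\<sigma>2"
      by (rule exec.Assign) (use 1 j b in auto)
    have "run W ?w ?\<sigma>2 ((T + 2) * (n - Suc j) + 1) (\<lambda>\<tau>. I n \<tau> \<and> regs \<tau> i = n)"
      using Suc.hyps(1)[of "Suc j" ?\<sigma>2] Suc.hyps(2) j 1 b by simp
    then obtain t3 \<tau> where 3: "exec W ?w ?\<sigma>2 t3 \<tau>" "t3 \<le> (T + 2) * (n - Suc j) + 1" "I n \<tau>" "regs \<tau> i = n"
      by (auto simp: run_def)
    have "tval \<sigma> (Less (Reg i) (Reg b))" using Suc.prems j by simp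
    then have "exec W ?w \<sigma> (Suc ((t1 + 1) + t3)) \<tau>"
      by (rule exec.WhileTrue[OF _ exec.Seq[OF 1(1) 2] 3(1)])
    moreover have "Suc ((t1 + 1) + t3) \<le> (T + 2) * (n - j) + 1"
    proof -
      have "n - j = Suc (n - Suc j)" using j by simp
      then have "(T + 2) * (n - j) = (T + 2) + (T + 2) * (n - Suc j)" by simp
      then show ?thesis using 1(2) 3(2) by linarith
    qed
    ultimately show ?case unfolding run_def using 3(3,4) by blast
  qed
  from this[of 0 "\<sigma>\<lparr>regs := (regs \<sigma>)(i := 0)\<rparr>"] init b
  have w: "run W ?w (\<sigma>\<lparr>regs := (regs \<sigma>)(i := 0)\<rparr>) ((T + 2) * n + 1) (\<lambda>\<tau>. I n \<tau> \<and> regs \<tau> i = n)" by simp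
  have a: "run W (Assign i Add (Imm 0) (Imm 0)) \<sigma> 1 (\<lambda>\<tau>. \<tau> = \<sigma>\<lparr>regs := (regs \<sigma>)(i := 0)\<rparr>)"
    by (rule run_safe) auto
  show ?thesis
    unfolding For_def by (rule run_mono[OF run_Seq[OF a, of ?w]]) (use w in auto)
qed

text \<open>The frame condition by which facts on other registers and arrays are carried past a
  subprogram.\<close>

definition same :: "string set \<Rightarrow> string set \<Rightarrow> state \<Rightarrow> state \<Rightarrow> bool" where
  "same R A \<sigma> \<tau> \<longleftrightarrow> (\<forall>r. r \<notin> R \<longrightarrow> regs \<tau> r = regs \<sigma> r) \<and> (\<forall>a. a \<notin> A \<longrightarrow> arrs \<tau> a = arrs \<sigma> a)"

lemma same_trans: "same R A \<sigma> \<tau> \<Longrightarrow> same R' A' \<tau> \<upsilon> \<Longrightarrow> R \<subseteq> S \<Longrightarrow> R' \<subseteq> S \<Longrightarrow> A \<subseteq> B \<Longrightarrow> A' \<subseteq> B \<Longrightarrow> same S B \<sigma> \<upsilon>"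
  unfolding same_def by (metis subsetD)

lemma same_regs: "same R A \<sigma> \<tau> \<Longrightarrow> r \<notin> R \<Longrightarrow> regs \<tau> r = regs \<sigma> r"
  by (simp add: same_def)

definition copy :: "string \<Rightarrow> string \<Rightarrow> prog" where
  "copy X Y = For ''i'' ''N'' (Seq (Load ''v'' X (Reg ''i'')) (Store Y (Reg ''i'') (Reg ''v'')))"

lemma run_copy:
  assumes "regs \<sigma> ''N'' = N" "N \<le> W" "\<And>i. i < N \<Longrightarrow> arrs \<sigma> X i \<le> W" "X \<noteq> Y"
  shows "run W (copy X Y) \<sigma> (4 * N + 2)
    (\<lambda>\<tau>. same {''i'', ''v''} {Y} \<sigma> \<tau> \<and> (\<forall>i<N. arrs \<tau> Y i = arrs \<sigma> X i))"
proof -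
  let ?I = "\<lambda>j \<tau>. same {''i'', ''v''} {Y} \<sigma> \<tau> \<and> (\<forall>i<j. arrs \<tau> Y i = arrs \<sigma> X i)"
  have "run W (copy X Y) \<sigma> ((2 + 2) * N + 2) (\<lambda>\<tau>. ?I N \<tau> \<and> regs \<tau> ''i'' = N)"
    unfolding copy_def
  proof (rule run_For)
    fix j \<tau> assume j: "j < N" and I: "?I j \<tau>" and r: "regs \<tau> ''i'' = j" "regs \<tau> ''N'' = N"
    have X: "arrs \<tau> X = arrs \<sigma> X" using I assms(4) by (simp add: same_def)
    show "run W (Seq (Load ''v'' X (Reg ''i'')) (Store Y (Reg ''i'') (Reg ''v''))) \<tau> 2
      (\<lambda>\<tau>. regs \<tau> ''i'' = j \<and> regs \<tau> ''N'' = N \<and> ?I (Suc j) (\<tau>\<lparr>regs := (regs \<tau>)(''i'' := Suc j)\<rparr>))"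
      by (rule run_safe) (use I r X assms(3)[OF j] in \<open>auto simp: same_def less_Suc_eq\<close>)
  qed (use assms in \<open>auto simp: same_def\<close>)
  then show ?thesis by (rule run_mono) auto
qed

definition all_below :: "string \<Rightarrow> operand \<Rightarrow> prog" where
  "all_below X a = Seq (Assign ''o'' Add (Imm 1) (Imm 0))
     (For ''i'' ''N'' (Seq (Load ''v'' X (Reg ''i''))
       (Cond (Leq (Reg ''v'') a) Skip (Assign ''o'' Add (Imm 0) (Imm 0)))))"

lemma run_all_below:
  assumes "regs \<sigma> ''N'' = N" "N \<le> W" "1 \<le> W" "\<And>i. i < N \<Longrightarrow> arrs \<sigma> X i \<le> W"
    and r: "r \<notin> {''i'', ''v'', ''o''}"
  shows "run W (all_below X (Reg r)) \<sigma> (5 * N + 3)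
    (\<lambda>\<tau>. same {''i'', ''v'', ''o''} {} \<sigma> \<tau> \<and>
       regs \<tau> ''o'' = (if \<forall>i<N. arrs \<sigma> X i \<le> regs \<sigma> r then 1 else 0))"
proof -
  let ?I = "\<lambda>j \<tau>. same {''i'', ''v'', ''o''} {} \<sigma> \<tau> \<and>
       regs \<tau> ''o'' = (if \<forall>i<j. arrs \<sigma> X i \<le> regs \<sigma> r then 1 else 0)"
  let ?body = "Seq (Load ''v'' X (Reg ''i''))
       (Cond (Leq (Reg ''v'') (Reg r)) Skip (Assign ''o'' Add (Imm 0) (Imm 0)))"
  have a: "run W (Assign ''o'' Add (Imm 1) (Imm 0)) \<sigma> 1 (\<lambda>\<tau>. same {''o''} {} \<sigma> \<tau> \<and> regs \<tau> ''o'' = 1)"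
    by (rule run_safe) (use assms in \<open>auto simp: same_def\<close>)
  have b: "run W (For ''i'' ''N'' ?body) \<tau> ((3 + 2) * N + 2) (\<lambda>\<tau>. ?I N \<tau> \<and> regs \<tau> ''i'' = N)"
    if "same {''o''} {} \<sigma> \<tau> \<and> regs \<tau> ''o'' = 1" for \<tau>
  proof (rule run_For)
    fix j \<upsilon> assume j: "j < N" and I: "?I j \<upsilon>" and i: "regs \<upsilon> ''i'' = j" "regs \<upsilon> ''N'' = N"
    have X: "arrs \<upsilon> X = arrs \<sigma> X" "regs \<upsilon> r = regs \<sigma> r" using I r by (auto simp: same_def)
    show "run W ?body \<upsilon> 3
      (\<lambda>\<tau>. regs \<tau> ''i'' = j \<and> regs \<tau> ''N'' = N \<and> ?I (Suc j) (\<tau>\<lparr>regs := (regs \<tau>)(''i'' := Suc j)\<rparr>))"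
      by (rule run_safe) (use I i X r assms(4)[OF j] in \<open>auto simp: same_def less_Suc_eq\<close>)
  qed (use assms that in \<open>auto simp: same_def\<close>)
  show ?thesis unfolding all_below_def
    by (rule run_mono[OF run_Seq[OF a b]]) auto
qed

section \<open>All-pairs distances\<close>

text \<open>One in-place update of Floyd-Warshall. The three nested loops are flattened into a
  single counter \<open>t = r * (n * n) + (u * n + v)\<close>, with the pivot \<open>r\<close> as
  the leading digit.\<close>

definition fw_step :: "nat \<Rightarrow> nat \<Rightarrow> (nat \<Rightarrow> nat) \<Rightarrow> nat \<Rightarrow> nat" where
  "fw_step n t f = (let r = t div (n * n); e = t mod (n * n); u = e div n; v = e mod n in
     f(e := min (f e) (f (u * n + r) + f (r * n + v))))"

fun fw :: "nat \<Rightarrow> nat \<Rightarrow> (nat \<Rightarrow> nat) \<Rightarrow> nat \<Rightarrow> nat" where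
  "fw n 0 f = f"
| "fw n (Suc t) f = fw_step n t (fw n t f)"

definition floyd :: "string \<Rightarrow> prog" where
  "floyd X = For ''t'' ''P'' (block [
     Assign ''r'' Div (Reg ''t'') (Reg ''N''),
     Assign ''e'' Mul (Reg ''r'') (Reg ''N''),
     Assign ''e'' Sub (Reg ''t'') (Reg ''e''),
     Assign ''u'' Div (Reg ''e'') (Reg ''n''),
     Assign ''u'' Mul (Reg ''u'') (Reg ''n''),
     Assign ''v'' Sub (Reg ''e'') (Reg ''u''),
     Assign ''u'' Add (Reg ''u'') (Reg ''r''),
     Assign ''r'' Mul (Reg ''r'') (Reg ''n''),
     Assign ''v'' Add (Reg ''r'') (Reg ''v''),
     Load ''a'' X (Reg ''u''),
     Load ''b'' X (Reg ''v''),
     Assign ''a'' Add (Reg ''a'') (Reg ''b''),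
     Load ''b'' X (Reg ''e''),
     Cond (Less (Reg ''a'') (Reg ''b'')) (Store X (Reg ''e'') (Reg ''a'')) Skip])"

text \<open>Entries never increase, so each sum formed by the program stays below
  \<open>2 * B\<close> and fits into a word.\<close>

lemma fw_bound:
  assumes "\<And>i. i < n * n \<Longrightarrow> f i \<le> B" "i < n * n"
  shows "fw n t f i \<le> B"
  using assms(2) by (induction t arbitrary: i) (auto simp: assms(1) fw_step_def Let_def intro: min.coboundedI1)

lemma fw_index:
  fixes n :: nat
  assumes "t < n * n * n"
  shows "t div (n * n) < n" "t mod (n * n) < n * n" "t mod (n * n) div n < n"
    "t mod (n * n) mod n < n"
proof -
  have n: "0 < n" using assms by (cases n) auto
  then show a: "t mod (n * n) < n * n" "t mod (n * n) mod n < n" by auto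
  show "t div (n * n) < n" by (rule less_mult_imp_div_less) (use assms in \<open>simp add: mult.assoc\<close>)
  show "t mod (n * n) div n < n" by (rule less_mult_imp_div_less[OF a(1)])
qed

lemma index_less: "u < n \<Longrightarrow> v < (n::nat) \<Longrightarrow> u * n + v < n * n"
proof -
  assume "u < n" "v < n"
  then have "u * n + v < Suc u * n" by simp
  also have "\<dots> \<le> n * n" using \<open>u < n\<close> by (intro mult_le_mono1) simp
  finally show ?thesis .
qed

lemma run_floyd:
  assumes R: "regs \<sigma> ''n'' = n" "regs \<sigma> ''N'' = n * n" "regs \<sigma> ''P'' = n * n * n"
    and W: "n * n * n \<le> W" "n * n \<le> W" "2 * B \<le> W"
    and f: "\<And>i. i < n * n \<Longrightarrow> arrs \<sigma> X i = f i" "\<And>i. i < n * n \<Longrightarrow> f i \<le> B"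
  shows "run W (floyd X) \<sigma> (17 * (n * n * n) + 2)
    (\<lambda>\<tau>. same {''t'', ''r'', ''e'', ''u'', ''v'', ''a'', ''b''} {X} \<sigma> \<tau> \<and>
       (\<forall>i<n * n. arrs \<tau> X i = fw n (n * n * n) f i))"
proof -
  let ?R = "{''t'', ''r'', ''e'', ''u'', ''v'', ''a'', ''b''}"
  let ?I = "\<lambda>t \<tau>. same ?R {X} \<sigma> \<tau> \<and> (\<forall>i<n * n. arrs \<tau> X i = fw n t f i)"
  have "run W (floyd X) \<sigma> ((15 + 2) * (n * n * n) + 2) (\<lambda>\<tau>. ?I (n * n * n) \<tau> \<and> regs \<tau> ''t'' = n * n * n)"
    unfolding floyd_def
  proof (rule run_For)
    fix t \<tau> assume t: "t < n * n * n" and I: "?I t \<tau>" and r: "regs \<tau> ''t'' = t" "regs \<tau> ''P'' = n * n * n"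
    let ?r = "t div (n * n)" and ?e = "t mod (n * n)"
    let ?u = "?e div n" and ?v = "?e mod n"
    have reg: "regs \<tau> ''n'' = n" "regs \<tau> ''N'' = n * n" using I R by (auto simp: same_def)
    note ix = fw_index[OF t]
    have e1: "t - ?r * (n * n) = ?e" by (simp add: minus_div_mult_eq_mod)
    have e2: "?e - ?u * n = ?v" by (simp add: minus_div_mult_eq_mod)
    have i1: "?u * n + ?r < n * n" "?r * n + ?v < n * n" using ix by (auto intro: index_less)
    have b1: "?r \<le> W" "?e \<le> W" "?u \<le> W" "?u * n \<le> W" "?v \<le> W" "?r * n \<le> W" "?r * (n * n) \<le> W"
      "?u * n + ?r \<le> W" "?r * n + ?v \<le> W"
    proof -
      have "?r * (n * n) \<le> t" "?e \<le> t" "?r \<le> t" "?u \<le> ?e" "?u * n \<le> ?e" "?v \<le> ?e" by auto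
      then show "?r \<le> W" "?e \<le> W" "?u \<le> W" "?u * n \<le> W" "?v \<le> W" "?r * (n * n) \<le> W"
        using t W by linarith+
      show "?u * n + ?r \<le> W" "?r * n + ?v \<le> W" "?r * n \<le> W" using i1 W by linarith+
    qed
    have ar: "arrs \<tau> X i = fw n t f i" "fw n t f i \<le> B" if "i < n * n" for i
      using I that fw_bound[of n f B, OF f(2) that] by auto
    let ?a = "fw n t f (?u * n + ?r)" and ?b = "fw n t f (?r * n + ?v)" and ?c = "fw n t f ?e"
    have b2: "?a \<le> W" "?b \<le> W" "?a + ?b \<le> W" "?c \<le> W"
      using ar(2)[OF i1(1)] ar(2)[OF i1(2)] ar(2)[OF ix(2)] W(3) by linarith+
    have X: "arrs \<tau> X (?u * n + ?r) = ?a" "arrs \<tau> X (?r * n + ?v) = ?b" "arrs \<tau> X ?e = ?c"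
      using ar(1) i1 ix(2) by auto
    have step: "fw n (Suc t) f = (fw n t f)(?e := min ?c (?a + ?b))"
      by (simp add: fw_step_def Let_def)
    show "run W (block [
     Assign ''r'' Div (Reg ''t'') (Reg ''N''),
     Assign ''e'' Mul (Reg ''r'') (Reg ''N''),
     Assign ''e'' Sub (Reg ''t'') (Reg ''e''),
     Assign ''u'' Div (Reg ''e'') (Reg ''n''),
     Assign ''u'' Mul (Reg ''u'') (Reg ''n''),
     Assign ''v'' Sub (Reg ''e'') (Reg ''u''),
     Assign ''u'' Add (Reg ''u'') (Reg ''r''),
     Assign ''r'' Mul (Reg ''r'') (Reg ''n''),
     Assign ''v'' Add (Reg ''r'') (Reg ''v''),
     Load ''a'' X (Reg ''u''),
     Load ''b'' X (Reg ''v''),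
     Assign ''a'' Add (Reg ''a'') (Reg ''b''),
     Load ''b'' X (Reg ''e''),
     Cond (Less (Reg ''a'') (Reg ''b'')) (Store X (Reg ''e'') (Reg ''a'')) Skip]) \<tau> 15
      (\<lambda>\<tau>. regs \<tau> ''t'' = t \<and> regs \<tau> ''P'' = n * n * n \<and> ?I (Suc t) (\<tau>\<lparr>regs := (regs \<tau>)(''t'' := Suc t)\<rparr>))"
    proof (rule run_safe)
    qed (use I r reg e1 e2 b1 b2 X ar in \<open>auto simp: same_def step simp del: fw.simps\<close>)
  qed (use R W f in \<open>auto simp: same_def\<close>)
  then show ?thesis by (rule run_mono) auto
qed

text \<open>The matrix entry \<open>(u, v)\<close> is stored at index \<open>u * n + v\<close>, and \<open>n * n + 1\<close> stands for an
  infinite distance.\<close>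

definition wt :: "nat ugraph \<Rightarrow> nat \<Rightarrow> nat set set \<Rightarrow> nat \<Rightarrow> nat" where
  "wt G n F e = (let u = e div n; v = e mod n in
     if u = v then 0 else if adj G u v then (if {u, v} \<in> F then 0 else 1) else n * n + 1)"

lemma wt_index: "v < n \<Longrightarrow> wt G n F (u * n + v) =
    (if u = v then 0 else if adj G u v then (if {u, v} \<in> F then 0 else 1) else n * n + 1)"
  by (simp add: wt_def Let_def)

lemma wt_le: "wt G n F e \<le> n * n + 1"
  by (simp add: wt_def Let_def)

lemma index_cases:
  assumes "e < n * (n::nat)"
  obtains u v where "u < n" "v < n" "e = u * n + v"
proof
  have "0 < n" using assms by (cases n) auto
  then show "e div n < n" "e mod n < n" using less_mult_imp_div_less[OF assms] by auto
  show "e = e div n * n + e mod n" by simp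
qed

lemma index_div: "b < n \<Longrightarrow> (a * n + b) div n = (a :: nat)"
  and index_mod: "b < n \<Longrightarrow> (a * n + b) mod n = (b :: nat)"
  by auto

lemma index_eq: "v < n \<Longrightarrow> v' < n \<Longrightarrow> u * n + v = u' * n + v' \<longleftrightarrow> u = u' \<and> v = (v'::nat)"
proof
  assume "v < n" "v' < n" and e: "u * n + v = u' * n + v'"
  then show "u = u' \<and> v = v'" using index_div index_mod by metis
qed auto

lemma fw_step_index:
  assumes "t < n * n * n" "u < n" "v < n" "r < n" "t = r * (n * n) + (u * n + v)"
  shows "fw_step n t f = f(u * n + v := min (f (u * n + v)) (f (u * n + r) + f (r * n + v)))"
proof -
  have e: "u * n + v < n * n" using assms by (intro index_less)
  then have "t div (n * n) = r" "t mod (n * n) = u * n + v" unfolding assms(5) by (simp_all only: index_div index_mod)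
  then show ?thesis using assms by (simp add: fw_step_def Let_def)
qed

lemma fw_time_cases:
  assumes "t < n * n * (n::nat)"
  obtains r u v where "r < n" "u < n" "v < n" "t = r * (n * n) + (u * n + v)"
    "t div (n * n) = r" "t mod (n * n) = u * n + v"
proof -
  have a: "t mod (n * n) < n * n" "t div (n * n) < n" using fw_index[OF assms] by auto
  obtain u v where uv: "u < n" "v < n" "t mod (n * n) = u * n + v" using index_cases[OF a(1)] by blast
  moreover have "t = t div (n * n) * (n * n) + (u * n + v)"
    using div_mult_mod_eq[of t "n * n"] unfolding uv(3) by simp
  ultimately show thesis using that a(2) by blast
qed

text \<open>Restricting the claim to entries of at most \<open>n * n\<close> excludes the value for
  infinity: a sum within the bound has both summands within it.\<close>

lemma fw_sound:
  assumes V: "verts G = {..<n}" and "t \<le> n * n * n" "u < n" "v < n" "fw n t (wt G n F) (u * n + v) \<le> n * n"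
  shows "reach G F u (fw n t (wt G n F) (u * n + v)) v"
  using assms(2-)
proof (induction t arbitrary: u v)
  case 0
  have uv: "u \<in> verts G" "v \<in> verts G" using 0 V by auto
  have "reach G F u 1 v" if "adj G u v"
    using reach.pay[OF reach.stay[OF uv(1), of F 0] uv(2) that] by simp
  moreover have "reach G F u 0 v" if "adj G u v" "{u, v} \<in> F"
    using reach.free[OF reach.stay[OF uv(1), of F 0] uv(2) that] by simp
  ultimately show ?case using 0 uv wt_index[of v n G F u] by (auto intro: reach.stay split: if_splits)
next
  case (Suc t)
  let ?f = "fw n t (wt G n F)"
  have t: "t < n * n * n" using Suc.prems by simp
  obtain r u0 v0 where r: "r < n" "u0 < n" "v0 < n" "t = r * (n * n) + (u0 * n + v0)"
    by (rule fw_time_cases[OF t])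
  have f: "fw n (Suc t) (wt G n F) = ?f(u0 * n + v0 := min (?f (u0 * n + v0)) (?f (u0 * n + r) + ?f (r * n + v0)))"
    using fw_step_index[OF t r(2,3,1,4)] by simp
  have IH: "reach G F u (?f (u * n + v)) v" if "u < n" "v < n" "?f (u * n + v) \<le> n * n" for u v
    by (rule Suc.IH[OF less_imp_le[OF t] that])
  show ?case
  proof (cases "u = u0 \<and> v = v0")
    case False
    then have "u * n + v \<noteq> u0 * n + v0" using index_eq[OF Suc.prems(3) r(3)] by simp
    then show ?thesis using IH Suc.prems unfolding f by simp
  next
    case True
    show ?thesis
    proof (cases "?f (u * n + v) \<le> ?f (u * n + r) + ?f (r * n + v)")
      case True
      then show ?thesis using IH[of u v] Suc.prems \<open>u = u0 \<and> v = v0\<close> unfolding f by simp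
    next
      case False
      then have val: "fw n (Suc t) (wt G n F) (u * n + v) = ?f (u * n + r) + ?f (r * n + v)"
        using \<open>u = u0 \<and> v = v0\<close> unfolding f by simp
      then have "reach G F u (?f (u * n + r)) r" "reach G F r (?f (r * n + v)) v"
        using IH[of u r] IH[of r v] Suc.prems r by simp_all
      then show ?thesis unfolding val using reach_trans by metis
    qed
  qed
qed

text \<open>The completeness half of the Floyd-Warshall invariant. It ranges over walks rather than
  paths, so that splitting at the pivot involves no argument on repetitions.\<close>

definition covers :: "nat ugraph \<Rightarrow> nat \<Rightarrow> nat set set \<Rightarrow> nat \<Rightarrow> (nat \<Rightarrow> nat) \<Rightarrow> nat \<Rightarrow> nat \<Rightarrow> bool" where
  "covers G n F m f u v \<longleftrightarrow> (\<forall>p l. walk G p l \<and> p 0 = u \<and> p l = v \<and> (\<forall>i. 0 < i \<and> i < l \<longrightarrow> p i < m) \<longrightarrow>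
     f (u * n + v) \<le> gaps F p l)"

lemma covers_mono: "covers G n F m f u v \<Longrightarrow> m' \<le> m \<Longrightarrow> f' (u * n + v) \<le> f (u * n + v) \<Longrightarrow> covers G n F m' f' u v"
  unfolding covers_def
proof (intro allI impI)
  fix p l
  assume c: "\<forall>p l. walk G p l \<and> p 0 = u \<and> p l = v \<and> (\<forall>i. 0 < i \<and> i < l \<longrightarrow> p i < m) \<longrightarrow> f (u * n + v) \<le> gaps F p l"
    and le: "m' \<le> m" "f' (u * n + v) \<le> f (u * n + v)"
    and p: "walk G p l \<and> p 0 = u \<and> p l = v \<and> (\<forall>i. 0 < i \<and> i < l \<longrightarrow> p i < m')"
  have "\<forall>i. 0 < i \<and> i < l \<longrightarrow> p i < m" using p le(1) less_le_trans by blast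
  then have "f (u * n + v) \<le> gaps F p l" using c p by blast
  then show "f' (u * n + v) \<le> gaps F p l" using le(2) by simp
qed

lemma covers_wt:
  assumes "verts G = {..<n}" "v < n"
  shows "covers G n F 0 (wt G n F) u v"
  unfolding covers_def
proof (intro allI impI)
  fix p l assume p: "walk G p l \<and> p 0 = u \<and> p l = v \<and> (\<forall>i. 0 < i \<and> i < l \<longrightarrow> p i < 0)"
  then have "l = 0 \<or> l = 1" by (metis less_one nat_neq_iff not_less_zero)
  then show "wt G n F (u * n + v) \<le> gaps F p l"
  proof
    assume "l = 0" then show ?thesis using p assms by (simp add: wt_index)
  next
    assume l: "l = 1"
    then have "adj G u v" using p walkD(2)[of G p l 0] by auto
    then show ?thesis using p assms l by (simp add: wt_index gaps_Suc)
  qed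
qed

text \<open>The walk is cut at its first and at its last visit to \<open>r\<close>. What lies
  between them is skipped, which can only lower the cost.\<close>

lemma covers_split:
  assumes c: "covers G n F r f u v" "covers G n F r f u r" "covers G n F r f r v"
    and f': "f' (u * n + v) = min (f (u * n + v)) (f (u * n + r) + f (r * n + v))"
  shows "covers G n F (Suc r) f' u v"
  unfolding covers_def
proof (intro allI impI)
  fix p l assume p: "walk G p l \<and> p 0 = u \<and> p l = v \<and> (\<forall>i. 0 < i \<and> i < l \<longrightarrow> p i < Suc r)"
  let ?I = "{i. 0 < i \<and> i < l \<and> p i = r}"
  show "f' (u * n + v) \<le> gaps F p l"
  proof (cases "?I = {}")
    case True
    then have "\<forall>i. 0 < i \<and> i < l \<longrightarrow> p i < r" using p by (metis (mono_tags, lifting) empty_Collect_eq less_antisym)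
    then have "f (u * n + v) \<le> gaps F p l" using c(1) p unfolding covers_def by blast
    then show ?thesis using f' by simp
  next
    case False
    have fin: "finite ?I" by simp
    define i where "i = Min ?I"
    define j where "j = Max ?I"
    have i: "0 < i" "i < l" "p i = r" using Min_in[OF fin False] by (auto simp: i_def)
    have j: "0 < j" "j < l" "p j = r" using Max_in[OF fin False] by (auto simp: j_def)
    have imin: "i \<le> x" if "0 < x" "x < l" "p x = r" for x using Min_le[OF fin, of x] that by (simp add: i_def)
    have jmax: "x \<le> j" if "0 < x" "x < l" "p x = r" for x using Max_ge[OF fin, of x] that by (simp add: j_def)
    have W: "walk G p l" using p by simp
    have "walk G p i" using W i by (auto simp: walk_def)
    moreover have "\<forall>x. 0 < x \<and> x < i \<longrightarrow> p x < r"
    proof (intro allI impI)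
      fix x assume x: "0 < x \<and> x < i"
      then have "p x \<noteq> r" using imin[of x] i by auto
      then show "p x < r" using p x i by (metis less_antisym order_less_trans)
    qed
    ultimately have 1: "f (u * n + r) \<le> gaps F p i" using c(2) p i unfolding covers_def by blast
    have "walk G (\<lambda>x. p (j + x)) (l - j)" using W j by (auto simp: walk_def)
    moreover have "\<forall>x. 0 < x \<and> x < l - j \<longrightarrow> p (j + x) < r"
    proof (intro allI impI)
      fix x assume x: "0 < x \<and> x < l - j"
      then have "j + x < l" "\<not> j + x \<le> j" by auto
      then have "p (j + x) \<noteq> r" using jmax[of "j + x"] j by auto
      moreover have "p (j + x) < Suc r" using p x by auto
      ultimately show "p (j + x) < r" by simp
    qed
    moreover have "p (j + 0) = r" "p (j + (l - j)) = v" using j p by auto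
    ultimately have "f (r * n + v) \<le> gaps F (\<lambda>x. p (j + x)) (l - j)" using c(3) unfolding covers_def by blast
    then have "f (r * n + v) + gaps F p j \<le> gaps F p l" using gaps_shift[of F p j "l - j"] j by simp
    moreover have "gaps F p i \<le> gaps F p j" using imin[of j] j by (intro gaps_mono) auto
    ultimately show ?thesis using 1 f' by simp
  qed
qed

text \<open>In round \<open>r\<close>, the entries already treated allow the interior vertex
  \<open>r\<close>, the others do not yet. Updating in place does no harm: an entry that has
  decreased early still satisfies the weaker bound that the update reads.\<close>

lemma fw_complete:
  assumes V: "verts G = {..<n}" and "t \<le> n * n * n" "u < n" "v < n"
  shows "covers G n F (if u * n + v < t mod (n * n) then Suc (t div (n * n)) else t div (n * n)) (fw n t (wt G n F)) u v"
  using assms(2-)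
proof (induction t arbitrary: u v)
  case 0 then show ?case using covers_wt V by simp
next
  case (Suc t)
  let ?f = "fw n t (wt G n F)" and ?f' = "fw n (Suc t) (wt G n F)" and ?N = "n * n"
  have t: "t < n * n * n" using Suc.prems by simp
  obtain r u0 v0 where r: "r < n" "u0 < n" "v0 < n" "t = r * ?N + (u0 * n + v0)"
    "t div ?N = r" "t mod ?N = u0 * n + v0"
    using fw_time_cases[OF t] by blast
  let ?e = "u0 * n + v0"
  have f: "?f' = ?f(?e := min (?f ?e) (?f (u0 * n + r) + ?f (r * n + v0)))"
    using fw_step_index[OF t r(2,3,1,4)] by simp
  have IH: "covers G n F (if u * n + v < ?e then Suc r else r) ?f u v" if "u < n" "v < n" for u v
    using Suc.IH[of u v] that t unfolding r(5,6) by simp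
  have IHr: "covers G n F r ?f u v" if "u < n" "v < n" for u v
    by (rule covers_mono[OF IH[OF that]]) auto
  have le: "?f' x \<le> ?f x" for x unfolding f by simp
  have new: "covers G n F (if u * n + v \<le> ?e then Suc r else r) ?f' u v" if uv: "u < n" "v < n" for u v
  proof (cases "u * n + v = ?e")
    case True
    then have eq: "u = u0" "v = v0" using index_eq[OF uv(2) r(3)] by auto
    have "?f' (u * n + v) = min (?f (u * n + v)) (?f (u * n + r) + ?f (r * n + v))"
      unfolding f eq by simp
    from covers_split[where f' = ?f', OF IHr[OF uv] IHr[OF uv(1) r(1)] IHr[OF r(1) uv(2)] this] True
    show ?thesis by (simp only: order_refl if_True)
  next
    case False
    then have "(if u * n + v \<le> ?e then Suc r else r) = (if u * n + v < ?e then Suc r else r)" by auto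
    then show ?thesis using covers_mono[where f' = ?f', OF IH[OF uv] order_refl le] by (simp only:)
  qed
  have eN: "?e < ?N" using r by (intro index_less)
  show ?case
  proof (cases "Suc ?e < ?N")
    case True
    have "Suc t = r * ?N + Suc ?e" using r(4) by simp
    then have "Suc t div ?N = r" "Suc t mod ?N = Suc ?e" using index_div[OF True, of r] index_mod[OF True, of r] by (simp_all only:)
    then show ?thesis using new[OF Suc.prems(2,3)] by (simp only: less_Suc_eq_le)
  next
    case False
    then have N: "Suc ?e = ?N" using eN by simp
    have "0 < ?N" using eN by linarith
    have "Suc t = Suc r * ?N + 0" using r(4) N by simp
    then have d: "Suc t div ?N = Suc r" "Suc t mod ?N = 0"
      using index_div[OF \<open>0 < ?N\<close>, of "Suc r"] index_mod[OF \<open>0 < ?N\<close>, of "Suc r"] by (simp_all only:)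
    have "u * n + v \<le> ?e" using index_less[OF Suc.prems(2,3)] N by simp
    then show ?thesis using new[OF Suc.prems(2,3)] d by (simp only: not_less_zero if_False if_True)
  qed
qed

definition apsp :: "nat ugraph \<Rightarrow> nat \<Rightarrow> nat set set \<Rightarrow> nat \<Rightarrow> nat" where
  "apsp G n F = fw n (n * n * n) (wt G n F)"

lemma apsp_le: "e < n * n \<Longrightarrow> apsp G n F e \<le> n * n + 1"
  unfolding apsp_def by (rule fw_bound) (rule wt_le)

lemma apsp_sound:
  assumes "verts G = {..<n}" "u < n" "v < n" "apsp G n F (u * n + v) \<le> n * n"
  shows "reach G F u (apsp G n F (u * n + v)) v"
  using assms(4) unfolding apsp_def by (rule fw_sound[OF assms(1) order_refl assms(2,3)])

lemma apsp_complete: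
  assumes V: "verts G = {..<n}" and r: "reach G F u c v"
  shows "apsp G n F (u * n + v) \<le> c"
proof -
  have uv: "u < n" "v < n" using reach_verts[OF r] by (simp_all add: V)
  then have "0 < n * n" by (cases n) auto
  then have "n * n * n = n * (n * n) + 0" by simp
  then have "(n * n * n) mod (n * n) = 0" "(n * n * n) div (n * n) = n"
    using index_div[OF \<open>0 < n * n\<close>, of n] index_mod[OF \<open>0 < n * n\<close>, of n] by (simp_all only:)
  then have "covers G n F n (apsp G n F) u v"
    using fw_complete[OF V order_refl uv, of F] unfolding apsp_def by (simp only: not_less_zero if_False)
  moreover obtain p l where p: "walk G p l" "p 0 = u" "p l = v" "gaps F p l \<le> c"
    using reach_imp_walk[OF r] by blast
  moreover have "\<forall>i. 0 < i \<and> i < l \<longrightarrow> p i < n" using walkD(1)[OF p(1)] V by auto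
  ultimately have "apsp G n F (u * n + v) \<le> gaps F p l" unfolding covers_def by blast
  then show ?thesis using p(4) by simp
qed

text \<open>The length of a shortest connection is at most the number of ordered adjacent pairs.
  Hence finite costs are at most \<open>n * n\<close> and never collide with
  \<open>n * n + 1\<close>.\<close>

lemma reach_short:
  assumes V: "verts G = {..<n}" and r: "reach G F u c v"
  shows "\<exists>c\<le>n * n. reach G F u c v"
proof -
  let ?R = "{(a, b). a < n \<and> b < n \<and> adj G a b}"
  have sub: "?R \<subseteq> {..<n} \<times> {..<n}" by auto
  then have fin: "finite ?R" by (rule finite_subset) simp
  have cR: "card ?R \<le> n * n" using card_mono[OF _ sub] by simp
  have "u \<in> verts G" by (rule reach_verts(1)[OF r])
  have "(u, v) \<in> ?R\<^sup>*"
    using r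
  proof (induction rule: reach.induct)
    case (free c v w)
    then have "(v, w) \<in> ?R" using reach_verts(2)[OF free(1)] V by auto
    then show ?case using free by (meson rtrancl.rtrancl_into_rtrancl)
  next
    case (pay c v w)
    then have "(v, w) \<in> ?R" using reach_verts(2)[OF pay(1)] V by auto
    then show ?case using pay by (meson rtrancl.rtrancl_into_rtrancl)
  qed simp
  then obtain k where k: "k \<le> card ?R" "(u, v) \<in> ?R ^^ k"
    using rtrancl_finite_eq_relpow[OF fin] by auto
  have "reach G F u k v" using k(2)
  proof (induction k arbitrary: v)
    case 0 then show ?case using \<open>u \<in> verts G\<close> by (auto intro: reach.stay)
  next
    case (Suc k)
    then obtain w where "(u, w) \<in> ?R ^^ k" "(w, v) \<in> ?R" by auto
    then show ?case using Suc.IH V by (auto intro: reach.pay)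
  qed
  then show ?thesis using k(1) cR by (meson order_trans)
qed

lemma apsp_le_iff:
  assumes V: "verts G = {..<n}" and conn: "\<And>u v. u < n \<Longrightarrow> v < n \<Longrightarrow> \<exists>c. reach G {} u c v"
    and uv: "u < n" "v < n"
  shows "apsp G n F (u * n + v) \<le> c \<longleftrightarrow> reach G F u c v"
proof
  assume le: "apsp G n F (u * n + v) \<le> c"
  obtain c0 where "reach G {} u c0 v" using conn uv by blast
  then have "reach G F u c0 v" by (rule reach_mono) auto
  from reach_short[OF V this] obtain c' where c': "c' \<le> n * n" "reach G F u c' v" by blast
  have "apsp G n F (u * n + v) \<le> n * n" using apsp_complete[OF V c'(2)] c'(1) by simp
  from apsp_sound[OF V uv this] show "reach G F u c v" using le by (rule reach_mono) simp
qed (rule apsp_complete[OF V])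

lemma apsp_connected_iff:
  assumes V: "verts G = {..<n}"
  shows "(\<forall>e<n * n. apsp G n {} e \<le> n * n) \<longleftrightarrow> (\<forall>u<n. \<forall>v<n. \<exists>c. reach G {} u c v)"
proof
  assume "\<forall>e<n * n. apsp G n {} e \<le> n * n"
  then have "apsp G n {} (u * n + v) \<le> n * n" if "u < n" "v < n" for u v
    using index_less[OF that] by simp
  then show "\<forall>u<n. \<forall>v<n. \<exists>c. reach G {} u c v" using apsp_sound[OF V, of _ _ "{}"] by metis
next
  assume c: "\<forall>u<n. \<forall>v<n. \<exists>c. reach G {} u c v"
  show "\<forall>e<n * n. apsp G n {} e \<le> n * n"
  proof (intro allI impI)
    fix e assume "e < n * n"
    then obtain u v where uv: "u < n" "v < n" "e = u * n + v" by (rule index_cases)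
    then obtain c0 where "reach G {} u c0 v" using c by blast
    from reach_short[OF V this] obtain c' where c': "c' \<le> n * n" "reach G {} u c' v" by blast
    show "apsp G n {} e \<le> n * n" using apsp_complete[OF V c'(2)] c'(1) uv(3) by simp
  qed
qed

section \<open>The search program\<close>

text \<open>Array \<open>A\<close> holds the weights of the input graph and \<open>D\<close> its distances, \<open>T\<close> and \<open>H\<close> the tails
  and heads of the directed edges. In \<open>B\<close> the chosen edges are free, and register \<open>C\<close> counts them.\<close>

definition mark :: prog where
  "mark = block [
     Assign ''e'' Mul (Reg ''x'') (Reg ''n''),
     Assign ''e'' Add (Reg ''e'') (Reg ''y''),
     Load ''v'' ''B'' (Reg ''e''),
     Cond (Eq (Reg ''v'') (Imm 0)) Skip (Assign ''C'' Add (Reg ''C'') (Imm 1)),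
     Store ''B'' (Reg ''e'') (Imm 0),
     Assign ''e'' Mul (Reg ''y'') (Reg ''n''),
     Assign ''e'' Add (Reg ''e'') (Reg ''x''),
     Store ''B'' (Reg ''e'') (Imm 0)]"

text \<open>Splits off the last digit of \<open>q\<close> in base \<open>M\<close> and loads the directed edge it names.\<close>

definition pick :: prog where
  "pick = block [
     Assign ''z'' Div (Reg ''q'') (Reg ''M''),
     Assign ''v'' Mul (Reg ''z'') (Reg ''M''),
     Assign ''v'' Sub (Reg ''q'') (Reg ''v''),
     Assign ''q'' Add (Reg ''z'') (Imm 0),
     Load ''x'' ''T'' (Reg ''v''),
     Load ''y'' ''H'' (Reg ''v'')]"

definition check :: prog where
  "check = Seq (copy ''B'' ''E'') (Seq (floyd ''E'') (Seq (all_below ''E'' (Reg ''s''))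
     (Cond (Eq (Reg ''o'') (Imm 1))
       (Cond (Leq (Reg ''C'') (Reg ''k'')) (Assign ''out'' Add (Imm 1) (Imm 0)) Skip) Skip)))"

definition find_next :: prog where
  "find_next = For ''i'' ''n'' (block [
     Assign ''e'' Mul (Reg ''g'') (Reg ''n''),
     Assign ''e'' Add (Reg ''e'') (Reg ''i''),
     Load ''a'' ''A'' (Reg ''e''),
     Cond (Eq (Reg ''a'') (Imm 1)) (block [
       Assign ''e'' Mul (Reg ''i'') (Reg ''n''),
       Assign ''e'' Add (Reg ''e'') (Reg ''h''),
       Load ''a'' ''D'' (Reg ''e''),
       Assign ''a'' Add (Reg ''a'') (Imm 1),
       Assign ''e'' Mul (Reg ''g'') (Reg ''n''),
       Assign ''e'' Add (Reg ''e'') (Reg ''h''),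
       Load ''b'' ''D'' (Reg ''e''),
       Cond (Eq (Reg ''a'') (Reg ''b'')) (Assign ''z'' Add (Reg ''i'') (Imm 0)) Skip]) Skip])"

text \<open>The loop always makes \<open>n * n\<close> rounds, idling once the target is reached;
  with \<open>O(n)\<close> per round it stays within the \<open>O(n\<^sup>3)\<close> of one distance
  computation.\<close>

definition trace :: prog where
  "trace = For ''j'' ''N'' (Cond (Eq (Reg ''g'') (Reg ''h'')) Skip
     (Seq find_next (Seq (Seq (Assign ''x'' Add (Reg ''g'') (Imm 0)) (Assign ''y'' Add (Reg ''z'') (Imm 0)))
       (Seq mark (Assign ''g'' Add (Reg ''z'') (Imm 0))))))"

text \<open>\<open>de\<close> lists the \<open>2 * m\<close> directed edges, possibly in any order.
  The bounds on \<open>W\<close> cover the loop counters, sums of two matrix entries, and the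
  counter of free edges.\<close>

locale ram_graph = cgraph G for G :: "nat ugraph" +
  fixes n m k s W :: nat and de :: "nat \<Rightarrow> nat \<times> nat"
  assumes verts: "verts G = {..<n}" and n: "1 \<le> n" and m: "1 \<le> m"
    and de: "j < 2 * m \<Longrightarrow> adj G (fst (de j)) (snd (de j))"
    and de_onto: "adj G u v \<Longrightarrow> \<exists>j<2 * m. de j = (u, v)"
    and W: "n * n * n \<le> W" "2 * (n * n + 1) \<le> W" "n * n + 10 \<le> W" "(2 * m) ^ 4 \<le> W" "k \<le> W" "s \<le> W"
begin

lemma V_iff: "u \<in> V \<longleftrightarrow> u < n"
  using verts by simp

lemma apsp_h: "u < n \<Longrightarrow> v < n \<Longrightarrow> apsp G n F (u * n + v) \<le> c \<longleftrightarrow> h F u v \<le> c"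
  using apsp_le_iff[OF verts, of u v F c] conn h_le_iff[of u v F c] by (simp add: V_iff)

lemma apsp_d: "u < n \<Longrightarrow> v < n \<Longrightarrow> apsp G n {} (u * n + v) = d u v"
  using apsp_h[of u v "{}" "d u v"] apsp_h[of u v "{}" "apsp G n {} (u * n + v)"] by simp

lemma apsp_good: "(\<forall>i<n * n. apsp G n F i \<le> s) \<longleftrightarrow> good s F"
proof
  assume "\<forall>i<n * n. apsp G n F i \<le> s"
  then have "h F u v \<le> s" if "u < n" "v < n" for u v
    using index_less[OF that] apsp_h[OF that, of F s] by simp
  then show "good s F" by (simp add: good_def V_iff)
next
  assume g: "good s F"
  show "\<forall>i<n * n. apsp G n F i \<le> s"
  proof (intro allI impI)
    fix i assume "i < n * n"
    then obtain u v where "u < n" "v < n" "i = u * n + v" by (rule index_cases)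
    then show "apsp G n F i \<le> s" using g apsp_h[of u v F s] by (simp add: good_def V_iff)
  qed
qed

lemma d_le_nn: "u < n \<Longrightarrow> v < n \<Longrightarrow> d u v \<le> n * n"
proof -
  assume uv: "u < n" "v < n"
  obtain c where "reach G {} u c v" using conn[of u v] uv by (auto simp: V_iff)
  from reach_short[OF verts this] obtain c' where "c' \<le> n * n" "reach G {} u c' v" by blast
  then show ?thesis using h_le_iff[of u v "{}" c'] uv by (simp add: V_iff)
qed

text \<open>What the whole search leaves unchanged: the parameters, the two matrices of the input
  graph and the list of directed edges.\<close>

definition fixed :: "state \<Rightarrow> bool" where
  "fixed \<sigma> \<longleftrightarrow> regs \<sigma> ''n'' = n \<and> regs \<sigma> ''N'' = n * n \<and> regs \<sigma> ''P'' = n * n * n \<and> regs \<sigma> ''M'' = 2 * m \<and>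
     regs \<sigma> ''Q'' = (2 * m) ^ 4 \<and> regs \<sigma> ''k'' = k \<and> regs \<sigma> ''s'' = s \<and>
     (\<forall>i<n * n. arrs \<sigma> ''A'' i = wt G n {} i) \<and> (\<forall>i<n * n. arrs \<sigma> ''D'' i = apsp G n {} i) \<and>
     (\<forall>j<2 * m. arrs \<sigma> ''T'' j = fst (de j) \<and> arrs \<sigma> ''H'' j = snd (de j))"

lemma fixed_same:
  assumes "same R A \<sigma> \<tau>" "R \<inter> {''n'', ''N'', ''P'', ''M'', ''Q'', ''k'', ''s''} = {}"
    "A \<inter> {''A'', ''D'', ''T'', ''H''} = {}" "fixed \<sigma>"
  shows "fixed \<tau>"
proof -
  have "regs \<tau> r = regs \<sigma> r" if "r \<in> {''n'', ''N'', ''P'', ''M'', ''Q'', ''k'', ''s''}" for r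
    using that assms(1,2) unfolding same_def by blast
  moreover have "arrs \<tau> r = arrs \<sigma> r" if "r \<in> {''A'', ''D'', ''T'', ''H''}" for r
    using that assms(1,3) unfolding same_def by blast
  ultimately show ?thesis using assms(4) unfolding fixed_def by simp
qed

definition marked :: "nat set set \<Rightarrow> state \<Rightarrow> bool" where
  "marked F \<sigma> \<longleftrightarrow> (\<forall>i<n * n. arrs \<sigma> ''B'' i = wt G n F i) \<and> regs \<sigma> ''C'' = card F"

lemma marked_same: "same R A \<sigma> \<tau> \<Longrightarrow> ''C'' \<notin> R \<Longrightarrow> ''B'' \<notin> A \<Longrightarrow> marked F \<sigma> \<Longrightarrow> marked F \<tau>"
  by (simp add: same_def marked_def)

lemma wt_insert:
  assumes "adj G x y" "i < n * n"
  shows "wt G n (insert {x, y} F) i = ((wt G n F)(x * n + y := 0, y * n + x := 0)) i"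
proof -
  obtain u v where uv: "u < n" "v < n" "i = u * n + v" using assms(2) by (rule index_cases)
  have xy: "x < n" "y < n" "x \<noteq> y" using adj_V[OF assms(1)] by (auto simp: V_iff)
  have "(u * n + v = x * n + y) = (u = x \<and> v = y)" "(u * n + v = y * n + x) = (u = y \<and> v = x)"
    using index_eq[OF uv(2) xy(2), of u x] index_eq[OF uv(2) xy(1), of u y] by auto
  then show ?thesis using assms(1) xy unfolding uv(3)
    by (auto simp: wt_index[OF uv(2)] doubleton_eq_iff adj_commute)
qed

text \<open>An adjacent pair has weight 0 exactly if its edge is already free, so the counter rises
  for new edges only and equals the size of the set even if chosen edges coincide or lie on the
  traced path.\<close>

lemma run_mark:
  assumes f: "fixed \<sigma>" and mk: "marked F \<sigma>" and xy: "regs \<sigma> ''x'' = x" "regs \<sigma> ''y'' = y" "adj G x y"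
    and F: "finite F" "card F < n * n + 10"
  shows "run W mark \<sigma> 9 (\<lambda>\<tau>. same {''e'', ''v'', ''C''} {''B''} \<sigma> \<tau> \<and> marked (insert {x, y} F) \<tau>)"
proof -
  have lt: "x < n" "y < n" "x \<noteq> y" using adj_V[OF xy(3)] by (auto simp: V_iff)
  have i: "x * n + y < n * n" "y * n + x < n * n" using lt by (auto intro: index_less)
  have ne: "x * n + y \<noteq> y * n + x" using index_eq[OF lt(2,1)] lt by simp
  have w: "wt G n F (x * n + y) = (if {x, y} \<in> F then 0 else 1)" using wt_index[OF lt(2)] lt xy by simp
  have B: "arrs \<sigma> ''B'' (x * n + y) = (if {x, y} \<in> F then 0 else 1)" using mk i w by (simp add: marked_def)
  have r: "regs \<sigma> ''n'' = n" "regs \<sigma> ''C'' = card F" using f mk by (auto simp: fixed_def marked_def)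
  have b: "x * n \<le> W" "y * n \<le> W" "x * n + y \<le> W" "y * n + x \<le> W" "Suc (card F) \<le> W" "1 \<le> W"
    using i W F by linarith+
  have c: "card (insert {x, y} F) = (if {x, y} \<in> F then card F else Suc (card F))" using F by (simp add: insert_absorb)
  have new: "wt G n (insert {x, y} F) j = (if j = y * n + x then 0 else if j = x * n + y then 0 else arrs \<sigma> ''B'' j)"
    if "j < n * n" for j
    using wt_insert[OF xy(3) that, of F] mk that by (simp add: marked_def)
  show ?thesis
    unfolding mark_def
    by (rule run_safe) (use xy r b B c new ne in \<open>auto simp: same_def marked_def\<close>)
qed

lemma run_pick:
  assumes f: "fixed \<sigma>" and q: "regs \<sigma> ''q'' = q" "q \<le> (2 * m) ^ 4"
  shows "run W pick \<sigma> 6 (\<lambda>\<tau>. same {''z'', ''v'', ''q'', ''x'', ''y''} {} \<sigma> \<tau> \<and>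
    regs \<tau> ''q'' = q div (2 * m) \<and> regs \<tau> ''x'' = fst (de (q mod (2 * m))) \<and> regs \<tau> ''y'' = snd (de (q mod (2 * m))))"
proof -
  have r: "regs \<sigma> ''M'' = 2 * m" using f by (simp add: fixed_def)
  have lt: "q mod (2 * m) < 2 * m" using m by simp
  then have a: "adj G (fst (de (q mod (2 * m)))) (snd (de (q mod (2 * m))))" by (rule de)
  have arr: "arrs \<sigma> ''T'' (q mod (2 * m)) = fst (de (q mod (2 * m)))" "arrs \<sigma> ''H'' (q mod (2 * m)) = snd (de (q mod (2 * m)))"
    using f lt by (auto simp: fixed_def)
  have nW: "n \<le> W" using W(1) n by (metis le_square mult.assoc order_trans mult_le_mono2)
  have de_W: "fst (de (q mod (2 * m))) \<le> W" "snd (de (q mod (2 * m))) \<le> W"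
    using adj_V[OF a] nW by (auto simp: V_iff)
  have e: "q - q div (2 * m) * (2 * m) = q mod (2 * m)" by (simp add: minus_div_mult_eq_mod)
  have b: "q div (2 * m) * (2 * m) \<le> W" "q div (2 * m) \<le> W" "q mod (2 * m) \<le> W" "q \<le> W"
  proof -
    show "q \<le> W" using q W by simp
    have "q div (2 * m) * (2 * m) \<le> q" "q div (2 * m) \<le> q" "q mod (2 * m) \<le> q" by auto
    then show "q div (2 * m) * (2 * m) \<le> W" "q div (2 * m) \<le> W" "q mod (2 * m) \<le> W"
      using \<open>q \<le> W\<close> by linarith+
  qed
  define M where "M = 2 * m"
  show ?thesis
    using r q(1) arr de_W e b unfolding pick_def M_def[symmetric]
    by (intro run_safe) (auto simp: same_def)
qed

lemma run_check:
  assumes f: "fixed \<sigma>" and mk: "marked F \<sigma>"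
  shows "run W check \<sigma> (17 * (n * n * n) + 9 * (n * n) + 10)
    (\<lambda>\<tau>. same {''i'', ''v'', ''t'', ''r'', ''e'', ''u'', ''a'', ''b'', ''o'', ''out''} {''E''} \<sigma> \<tau> \<and>
       regs \<tau> ''out'' = (if card F \<le> k \<and> good s F then 1 else regs \<sigma> ''out''))"
proof -
  have B: "arrs \<sigma> ''B'' i = wt G n F i" if "i < n * n" for i using mk that by (simp add: marked_def)
  have bW: "n * n + 1 \<le> W" using W by simp
  have wW: "wt G n F i \<le> W" for i using wt_le[of G n F i] bW by linarith
  let ?R = "{''i'', ''v'', ''t'', ''r'', ''e'', ''u'', ''a'', ''b'', ''o''}"
  have 1: "run W (copy ''B'' ''E'') \<sigma> (4 * (n * n) + 2)
    (\<lambda>\<tau>. same {''i'', ''v''} {''E''} \<sigma> \<tau> \<and> (\<forall>i<n * n. arrs \<tau> ''E'' i = arrs \<sigma> ''B'' i))"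
    by (rule run_copy) (use f B wW W in \<open>auto simp: fixed_def\<close>)
  have 2: "run W (floyd ''E'') \<tau> (17 * (n * n * n) + 2)
    (\<lambda>\<upsilon>. same ?R {''E''} \<sigma> \<upsilon> \<and> (\<forall>i<n * n. arrs \<upsilon> ''E'' i = apsp G n F i))"
    if t: "same {''i'', ''v''} {''E''} \<sigma> \<tau> \<and> (\<forall>i<n * n. arrs \<tau> ''E'' i = arrs \<sigma> ''B'' i)" for \<tau>
  proof -
    have "fixed \<tau>" using fixed_same[OF conjunct1[OF t] _ _ f] by simp
    then have "run W (floyd ''E'') \<tau> (17 * (n * n * n) + 2)
      (\<lambda>\<upsilon>. same {''t'', ''r'', ''e'', ''u'', ''v'', ''a'', ''b''} {''E''} \<tau> \<upsilon> \<and>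
        (\<forall>i<n * n. arrs \<upsilon> ''E'' i = fw n (n * n * n) (wt G n F) i))"
      using t B wt_le W by (intro run_floyd[where B = "n * n + 1"]) (auto simp: fixed_def)
    then show ?thesis
    proof (rule run_mono)
      fix \<upsilon> assume u: "same {''t'', ''r'', ''e'', ''u'', ''v'', ''a'', ''b''} {''E''} \<tau> \<upsilon> \<and>
        (\<forall>i<n * n. arrs \<upsilon> ''E'' i = fw n (n * n * n) (wt G n F) i)"
      have "same ?R {''E''} \<sigma> \<upsilon>" by (rule same_trans[OF conjunct1[OF t] conjunct1[OF u]]) auto
      then show "same ?R {''E''} \<sigma> \<upsilon> \<and> (\<forall>i<n * n. arrs \<upsilon> ''E'' i = apsp G n F i)" using u by (simp add: apsp_def)
    qed simp
  qed
  have 3: "run W (all_below ''E'' (Reg ''s'')) \<tau> (5 * (n * n) + 3)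
    (\<lambda>\<upsilon>. same ?R {''E''} \<sigma> \<upsilon> \<and> regs \<upsilon> ''o'' = (if good s F then 1 else 0))"
    if t: "same ?R {''E''} \<sigma> \<tau> \<and> (\<forall>i<n * n. arrs \<tau> ''E'' i = apsp G n F i)" for \<tau>
  proof -
    have fx: "fixed \<tau>" using fixed_same[OF conjunct1[OF t] _ _ f] by simp
    have "run W (all_below ''E'' (Reg ''s'')) \<tau> (5 * (n * n) + 3)
      (\<lambda>\<upsilon>. same {''i'', ''v'', ''o''} {} \<tau> \<upsilon> \<and>
         regs \<upsilon> ''o'' = (if \<forall>i<n * n. arrs \<tau> ''E'' i \<le> regs \<tau> ''s'' then 1 else 0))"
    proof (rule run_all_below)
      fix i assume "i < n * n"
      then have "arrs \<tau> ''E'' i \<le> n * n + 1" using t apsp_le by simp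
      then show "arrs \<tau> ''E'' i \<le> W" using bW by simp
    qed (use fx W in \<open>auto simp: fixed_def\<close>)
    then show ?thesis
    proof (rule run_mono)
      fix \<upsilon> assume u: "same {''i'', ''v'', ''o''} {} \<tau> \<upsilon> \<and>
         regs \<upsilon> ''o'' = (if \<forall>i<n * n. arrs \<tau> ''E'' i \<le> regs \<tau> ''s'' then 1 else 0)"
      have "same ?R {''E''} \<sigma> \<upsilon>" by (rule same_trans[OF conjunct1[OF t] conjunct1[OF u]]) auto
      moreover have "(\<forall>i<n * n. arrs \<tau> ''E'' i \<le> regs \<tau> ''s'') \<longleftrightarrow> good s F"
        using t fx apsp_good[of F] by (auto simp: fixed_def)
      ultimately show "same ?R {''E''} \<sigma> \<upsilon> \<and> regs \<upsilon> ''o'' = (if good s F then 1 else 0)" using u by simp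
    qed simp
  qed
  have 4: "run W (Cond (Eq (Reg ''o'') (Imm 1))
       (Cond (Leq (Reg ''C'') (Reg ''k'')) (Assign ''out'' Add (Imm 1) (Imm 0)) Skip) Skip) \<tau> 3
    (\<lambda>\<tau>. same (insert ''out'' ?R) {''E''} \<sigma> \<tau> \<and>
       regs \<tau> ''out'' = (if card F \<le> k \<and> good s F then 1 else regs \<sigma> ''out''))"
    if t: "same ?R {''E''} \<sigma> \<tau> \<and> regs \<tau> ''o'' = (if good s F then 1 else 0)" for \<tau>
  proof -
    have "regs \<tau> ''C'' = card F" "regs \<tau> ''k'' = k" "regs \<tau> ''out'' = regs \<sigma> ''out''"
      using t mk f by (auto simp: same_def marked_def fixed_def)
    then show ?thesis by (intro run_safe) (use t W in \<open>auto simp: same_def\<close>)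
  qed
  have "run W check \<sigma> (4 * (n * n) + 2 + (17 * (n * n * n) + 2 + (5 * (n * n) + 3 + 3)))
    (\<lambda>\<tau>. same (insert ''out'' ?R) {''E''} \<sigma> \<tau> \<and>
       regs \<tau> ''out'' = (if card F \<le> k \<and> good s F then 1 else regs \<sigma> ''out''))"
    unfolding check_def
    by (rule run_Seq[OF 1 run_Seq[OF 2 run_Seq[OF 3 4]]])
  then show ?thesis by (rule run_mono) (auto simp: insert_commute)
qed

text \<open>The second vertex of a geodesic is a neighbour one step closer to the target, so the
  scan succeeds; among several such neighbours it keeps the last one.\<close>

lemma run_find_next:
  assumes f: "fixed \<sigma>" and g: "regs \<sigma> ''g'' = g" "g < n" and h': "regs \<sigma> ''h'' = t" "t < n" and gt: "g \<noteq> t"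
  shows "run W find_next \<sigma> (16 * n + 2)
    (\<lambda>\<tau>. same {''i'', ''e'', ''a'', ''b'', ''z''} {} \<sigma> \<tau> \<and> adj G g (regs \<tau> ''z'') \<and> d (regs \<tau> ''z'') t + 1 = d g t)"
proof -
  let ?R = "{''i'', ''e'', ''a'', ''b'', ''z''}"
  let ?P = "\<lambda>z. adj G g z \<and> d z t + 1 = d g t"
  let ?I = "\<lambda>j \<tau>. same ?R {} \<sigma> \<tau> \<and> ((\<exists>z<j. ?P z) \<longrightarrow> ?P (regs \<tau> ''z''))"
  have nW: "n \<le> W" using W(1) n by (metis le_square mult.assoc order_trans mult_le_mono2)
  have "run W find_next \<sigma> ((14 + 2) * n + 2) (\<lambda>\<tau>. ?I n \<tau> \<and> regs \<tau> ''i'' = n)"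
    unfolding find_next_def
  proof (rule run_For)
    fix j \<tau> assume j: "j < n" and I: "?I j \<tau>" and r: "regs \<tau> ''i'' = j" "regs \<tau> ''n'' = n"
    have reg: "regs \<tau> ''g'' = g" "regs \<tau> ''h'' = t" using I g h' by (auto simp: same_def)
    have ix: "g * n + j < n * n" "j * n + t < n * n" "g * n + t < n * n" using g h' j by (auto intro: index_less)
    have A: "arrs \<tau> ''A'' (g * n + j) = (if g = j then 0 else if adj G g j then 1 else n * n + 1)"
      using I f ix(1) j by (auto simp: same_def fixed_def wt_index)
    have D: "arrs \<tau> ''D'' (j * n + t) = d j t" "arrs \<tau> ''D'' (g * n + t) = d g t"
      using I f ix apsp_d[OF j h'(2)] apsp_d[OF g(2) h'(2)] by (auto simp: same_def fixed_def)
    have b: "g * n \<le> W" "g * n + j \<le> W" "j * n \<le> W" "j * n + t \<le> W" "g * n + t \<le> W" "n * n + 1 \<le> W"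
      "d j t + 1 \<le> W" "d g t \<le> W" "j \<le> W" "Suc 0 \<le> W"
      using ix W d_le_nn[OF j h'(2)] d_le_nn[OF g(2) h'(2)] j nW by linarith+
    have na: "\<not> adj G j j" using adj_V(3) by blast
    have one: "arrs \<tau> ''A'' (g * n + j) = 1 \<longleftrightarrow> adj G g j" using A na n by auto
    have AW: "arrs \<tau> ''A'' (g * n + j) \<le> W" using A b by auto
    show "run W (block [
     Assign ''e'' Mul (Reg ''g'') (Reg ''n''),
     Assign ''e'' Add (Reg ''e'') (Reg ''i''),
     Load ''a'' ''A'' (Reg ''e''),
     Cond (Eq (Reg ''a'') (Imm 1)) (block [
       Assign ''e'' Mul (Reg ''i'') (Reg ''n''),
       Assign ''e'' Add (Reg ''e'') (Reg ''h''),
       Load ''a'' ''D'' (Reg ''e''),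
       Assign ''a'' Add (Reg ''a'') (Imm 1),
       Assign ''e'' Mul (Reg ''g'') (Reg ''n''),
       Assign ''e'' Add (Reg ''e'') (Reg ''h''),
       Load ''b'' ''D'' (Reg ''e''),
       Cond (Eq (Reg ''a'') (Reg ''b'')) (Assign ''z'' Add (Reg ''i'') (Imm 0)) Skip]) Skip]) \<tau> 14
      (\<lambda>\<tau>. regs \<tau> ''i'' = j \<and> regs \<tau> ''n'' = n \<and> ?I (Suc j) (\<tau>\<lparr>regs := (regs \<tau>)(''i'' := Suc j)\<rparr>))"
    proof (cases "adj G g j")
      case True
      then have "arrs \<tau> ''A'' (g * n + j) = 1" using one by simp
      then show ?thesis
        by (intro run_safe) (use I r reg D b True in \<open>auto simp: same_def less_Suc_eq\<close>)
    next
      case False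
      then have "arrs \<tau> ''A'' (g * n + j) \<noteq> Suc 0" using one by simp
      then show ?thesis
        by (intro run_safe) (use I r reg AW b False in \<open>auto simp: same_def less_Suc_eq\<close>)
    qed
  qed (use f nW in \<open>auto simp: same_def fixed_def\<close>)
  then show ?thesis
  proof (rule run_mono)
    fix \<tau> assume t: "?I n \<tau> \<and> regs \<tau> ''i'' = n"
    have V: "g \<in> V" "t \<in> V" using g h' by (auto simp: V_iff)
    obtain p where p: "walk G p (d g t)" "p 0 = g" "p (d g t) = t" using geodesic_ex[OF V] by blast
    have pos: "0 < d g t" using d_0[OF V] gt by simp
    have a: "adj G g (p 1)" using walkD(2)[OF p(1) pos] p by simp
    then have V1: "p 1 \<in> V" using adj_V by blast
    have "d (p 1) t + 1 \<le> d g t" using d_walk[OF p(1), of 1 "d g t"] pos p by simp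
    moreover have "d g t \<le> d g (p 1) + d (p 1) t" using V V1 by (intro h_tri)
    moreover have "d g (p 1) \<le> 1" using h_adj[OF a] by simp
    ultimately have "?P (p 1)" using a by linarith
    moreover have "p 1 < n" using V1 by (simp add: V_iff)
    ultimately show "same ?R {} \<sigma> \<tau> \<and> adj G g (regs \<tau> ''z'') \<and> d (regs \<tau> ''z'') t + 1 = d g t" using t by blast
  qed simp
qed

lemma pedges_Suc: "pedges (q(Suc l := z)) (Suc l) = insert {q l, z} (pedges q l)"
proof -
  have "pedges (q(Suc l := z)) (Suc l) = insert {q l, z} ((\<lambda>i. {(q(Suc l := z)) i, (q(Suc l := z)) (Suc i)}) ` {..<l})"
    by (simp add: pedges_def lessThan_Suc)
  also have "(\<lambda>i. {(q(Suc l := z)) i, (q(Suc l := z)) (Suc i)}) ` {..<l} = pedges q l"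
    unfolding pedges_def by (rule image_cong) auto
  finally show ?thesis .
qed

lemma run_trace:
  assumes f: "fixed \<sigma>" and mk: "marked F \<sigma>" and g: "regs \<sigma> ''g'' = c" "c < n" and h': "regs \<sigma> ''h'' = t" "t < n"
    and F: "finite F" "card F \<le> 4"
  shows "run W trace \<sigma> ((16 * n + 17) * (n * n) + 2)
    (\<lambda>\<tau>. same {''i'', ''j'', ''e'', ''a'', ''b'', ''z'', ''x'', ''y'', ''v'', ''C'', ''g''} {''B''} \<sigma> \<tau> \<and>
      (\<exists>q l. walk G q l \<and> q 0 = c \<and> q l = t \<and> l = d c t \<and> marked (F \<union> pedges q l) \<tau>))"
proof -
  let ?R = "{''i'', ''j'', ''e'', ''a'', ''b'', ''z'', ''x'', ''y'', ''v'', ''C'', ''g''}"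
  \<comment> \<open>After \<open>j\<close> rounds the traced path has \<open>min j (d c t)\<close>
    edges, and its end is exactly that much closer to the target. The minimum accounts for the idle
    rounds.\<close>
  let ?I = "\<lambda>j \<tau>. same ?R {''B''} \<sigma> \<tau> \<and>
    (\<exists>q l. walk G q l \<and> q 0 = c \<and> q l = regs \<tau> ''g'' \<and> l + d (regs \<tau> ''g'') t = d c t \<and> l = min j (d c t) \<and>
       marked (F \<union> pedges q l) \<tau>)"
  have V: "c \<in> V" "t \<in> V" using g h' by (auto simp: V_iff)
  have dn: "d c t \<le> n * n" by (rule d_le_nn[OF g(2) h'(2)])
  have nW: "n \<le> W" using W(1) n by (metis le_square mult.assoc order_trans mult_le_mono2)
  have "run W trace \<sigma> ((16 * n + 15 + 2) * (n * n) + 2) (\<lambda>\<tau>. ?I (n * n) \<tau> \<and> regs \<tau> ''j'' = n * n)"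
    unfolding trace_def
  proof (rule run_For)
    show "?I 0 (\<sigma>\<lparr>regs := (regs \<sigma>)(''j'' := 0)\<rparr>)"
      using mk g V by (auto simp: same_def walk_def pedges_def marked_def intro!: exI[of _ "\<lambda>_. c"])
  next
    fix j \<tau> assume j: "j < n * n" and I: "?I j \<tau>" and r: "regs \<tau> ''j'' = j" "regs \<tau> ''N'' = n * n"
    obtain q l where q: "walk G q l" "q 0 = c" "q l = regs \<tau> ''g''" "l + d (regs \<tau> ''g'') t = d c t"
      "l = min j (d c t)" "marked (F \<union> pedges q l) \<tau>" using I by blast
    have sm: "same ?R {''B''} \<sigma> \<tau>" using I by blast
    have fx: "fixed \<tau>" using fixed_same[OF sm _ _ f] by simp
    have ht: "regs \<tau> ''h'' = t" using sm h' by (simp add: same_def)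
    have gV: "regs \<tau> ''g'' \<in> V" using walkD(1)[OF q(1), of l] q(3) by simp
    then have gn: "regs \<tau> ''g'' < n" by (simp add: V_iff)
    have cardF: "card (F \<union> pedges q l) < n * n + 10"
      using card_Un_le[of F "pedges q l"] card_pedges[of q l] q(5) dn F by simp
    have finF: "finite (F \<union> pedges q l)" using F by (simp add: pedges_def)
    let ?Q = "\<lambda>\<tau>. regs \<tau> ''j'' = j \<and> regs \<tau> ''N'' = n * n \<and> ?I (Suc j) (\<tau>\<lparr>regs := (regs \<tau>)(''j'' := Suc j)\<rparr>)"
    have "run W (Cond (Eq (Reg ''g'') (Reg ''h'')) Skip
     (Seq find_next (Seq (Seq (Assign ''x'' Add (Reg ''g'') (Imm 0)) (Assign ''y'' Add (Reg ''z'') (Imm 0)))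
       (Seq mark (Assign ''g'' Add (Reg ''z'') (Imm 0)))))) \<tau> (Suc (16 * n + 2 + (2 + (9 + 1)))) ?Q"
    proof (rule run_Cond)
      assume "tval \<tau> (Eq (Reg ''g'') (Reg ''h''))"
      then have gt: "regs \<tau> ''g'' = t" using ht by simp
      then have "l = d c t" using q(4) V by simp
      then have "l = min (Suc j) (d c t)" using q(5) by simp
      then have "?Q \<tau>" using sm q r by (auto simp: same_def marked_def intro!: exI[of _ q] exI[of _ l])
      then show "run W Skip \<tau> (16 * n + 2 + (2 + (9 + 1))) ?Q" by (intro run_safe) simp_all
    next
      assume "\<not> tval \<tau> (Eq (Reg ''g'') (Reg ''h''))"
      then have gt: "regs \<tau> ''g'' \<noteq> t" using ht by simp
      have lj: "l = j" "j < d c t"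
        using q(4,5) d_0[OF gV V(2)] gt by auto
      have 1: "run W find_next \<tau> (16 * n + 2)
        (\<lambda>\<upsilon>. same {''i'', ''e'', ''a'', ''b'', ''z''} {} \<tau> \<upsilon> \<and> adj G (regs \<tau> ''g'') (regs \<upsilon> ''z'') \<and>
          d (regs \<upsilon> ''z'') t + 1 = d (regs \<tau> ''g'') t)"
        by (rule run_find_next[OF fx HOL.refl gn ht h'(2) gt])
      show "run W (Seq find_next (Seq (Seq (Assign ''x'' Add (Reg ''g'') (Imm 0)) (Assign ''y'' Add (Reg ''z'') (Imm 0)))
         (Seq mark (Assign ''g'' Add (Reg ''z'') (Imm 0))))) \<tau> (16 * n + 2 + (2 + (9 + 1))) ?Q"
      proof (rule run_Seq[OF 1])
        fix \<upsilon> assume u: "same {''i'', ''e'', ''a'', ''b'', ''z''} {} \<tau> \<upsilon> \<and> adj G (regs \<tau> ''g'') (regs \<upsilon> ''z'') \<and>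
          d (regs \<upsilon> ''z'') t + 1 = d (regs \<tau> ''g'') t"
        define z where "z = regs \<upsilon> ''z''"
        have z: "adj G (regs \<tau> ''g'') z" "d z t + 1 = d (regs \<tau> ''g'') t" "z < n"
          using u adj_V(2)[of "regs \<tau> ''g''" z] by (auto simp: z_def V_iff)
        have ug: "regs \<upsilon> ''g'' = regs \<tau> ''g''" using u by (simp add: same_def)
        have 2: "run W (Seq (Assign ''x'' Add (Reg ''g'') (Imm 0)) (Assign ''y'' Add (Reg ''z'') (Imm 0))) \<upsilon> 2
          (\<lambda>\<phi>. same {''x'', ''y''} {} \<upsilon> \<phi> \<and> regs \<phi> ''x'' = regs \<tau> ''g'' \<and> regs \<phi> ''y'' = z)"
          by (rule run_safe) (use gn nW ug z in \<open>auto simp: same_def z_def\<close>)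
        show "run W (Seq (Seq (Assign ''x'' Add (Reg ''g'') (Imm 0)) (Assign ''y'' Add (Reg ''z'') (Imm 0)))
          (Seq mark (Assign ''g'' Add (Reg ''z'') (Imm 0)))) \<upsilon> (2 + (9 + 1)) ?Q"
        proof (rule run_Seq[OF 2])
          fix \<phi> assume p: "same {''x'', ''y''} {} \<upsilon> \<phi> \<and> regs \<phi> ''x'' = regs \<tau> ''g'' \<and> regs \<phi> ''y'' = z"
          have s1: "same {''i'', ''e'', ''a'', ''b'', ''z'', ''x'', ''y''} {} \<tau> \<phi>"
            by (rule same_trans[OF conjunct1[OF u] conjunct1[OF p]]) auto
          have "fixed \<phi>" using fixed_same[OF s1 _ _ fx] by simp
          moreover have "marked (F \<union> pedges q l) \<phi>" using marked_same[OF s1 _ _ q(6)] by simp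
          ultimately have 3: "run W mark \<phi> 9 (\<lambda>\<psi>. same {''e'', ''v'', ''C''} {''B''} \<phi> \<psi> \<and>
            marked (insert {regs \<tau> ''g'', z} (F \<union> pedges q l)) \<psi>)"
            using p z(1) finF cardF by (intro run_mark) auto
          show "run W (Seq mark (Assign ''g'' Add (Reg ''z'') (Imm 0))) \<phi> (9 + 1) ?Q"
          proof (rule run_Seq[OF 3])
            fix \<psi> assume ps: "same {''e'', ''v'', ''C''} {''B''} \<phi> \<psi> \<and>
              marked (insert {regs \<tau> ''g'', z} (F \<union> pedges q l)) \<psi>"
            have s2: "same {''i'', ''e'', ''a'', ''b'', ''z'', ''x'', ''y'', ''v'', ''C''} {''B''} \<tau> \<psi>"
              by (rule same_trans[OF s1 conjunct1[OF ps]]) auto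
            have s3: "same ?R {''B''} \<sigma> \<psi>" by (rule same_trans[OF sm s2]) auto
            have z': "regs \<psi> ''z'' = z" using p ps by (simp add: same_def z_def)
            have rj: "regs \<psi> ''j'' = j" "regs \<psi> ''N'' = n * n" using s2 r by (auto simp: same_def)
            let ?\<psi> = "\<psi>\<lparr>regs := (regs \<psi>)(''g'' := z)\<rparr>"
            let ?q = "q(Suc l := z)"
            have "walk G ?q (Suc l)"
              using q(1,3) z adj_V[OF z(1)] by (auto simp: walk_def le_Suc_eq less_Suc_eq)
            moreover have "F \<union> pedges ?q (Suc l) = insert {regs \<tau> ''g'', z} (F \<union> pedges q l)"
              unfolding pedges_Suc q(3) by simp
            moreover have "Suc l + d z t = d c t" "Suc l = min (Suc j) (d c t)" using q(4) z(2) lj by auto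
            ultimately have "?I (Suc j) (?\<psi>\<lparr>regs := (regs ?\<psi>)(''j'' := Suc j)\<rparr>)"
              using s3 ps q(2) by (intro conjI exI[of _ ?q] exI[of _ "Suc l"]) (auto simp: same_def marked_def)
            then show "run W (Assign ''g'' Add (Reg ''z'') (Imm 0)) \<psi> 1 ?Q"
              by (intro run_safe) (use z' z(3) nW rj in auto)
          qed
        qed
      qed
    qed
    then show "run W (Cond (Eq (Reg ''g'') (Reg ''h'')) Skip
     (Seq find_next (Seq (Seq (Assign ''x'' Add (Reg ''g'') (Imm 0)) (Assign ''y'' Add (Reg ''z'') (Imm 0)))
       (Seq mark (Assign ''g'' Add (Reg ''z'') (Imm 0)))))) \<tau> (16 * n + 15) ?Q"
      by (rule run_mono) simp_all
  qed (use f W in \<open>auto simp: fixed_def\<close>)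
  then show ?thesis
  proof (rule run_mono)
    fix \<tau> assume t: "?I (n * n) \<tau> \<and> regs \<tau> ''j'' = n * n"
    then obtain q l where q: "walk G q l" "q 0 = c" "q l = regs \<tau> ''g''" "l + d (regs \<tau> ''g'') t = d c t"
      "l = min (n * n) (d c t)" "marked (F \<union> pedges q l) \<tau>" by blast
    have "l = d c t" using q(5) dn by simp
    moreover have "regs \<tau> ''g'' \<in> V" using walkD(1)[OF q(1), of l] q(3) by simp
    ultimately have "q l = t" using q(3,4) d_0[OF _ V(2)] by simp
    then show "same ?R {''B''} \<sigma> \<tau> \<and>
      (\<exists>q l. walk G q l \<and> q 0 = c \<and> q l = t \<and> l = d c t \<and> marked (F \<union> pedges q l) \<tau>)"
      using t q \<open>l = d c t\<close> by blast
  qed simp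
qed

end

text \<open>The four edges alone are checked before the path is traced and checked with them.
  \<open>g\<close> and \<open>h\<close> save the ends of the path, because \<open>pick\<close>
  overwrites \<open>x\<close> and \<open>y\<close> with each edge.\<close>

definition attempt :: prog where
  "attempt = Seq (copy ''A'' ''B'')
    (Seq (Seq (Assign ''C'' Add (Imm 0) (Imm 0)) (Assign ''q'' Add (Reg ''l'') (Imm 0)))
    (Seq (Seq pick mark) (Seq (Seq pick mark) (Seq (Assign ''g'' Add (Reg ''y'') (Imm 0))
    (Seq (Seq pick mark) (Seq (Assign ''h'' Add (Reg ''x'') (Imm 0))
    (Seq (Seq pick mark) (Seq check (Seq trace check)))))))))"

definition search :: prog where
  "search = For ''l'' ''Q'' attempt"

section \<open>Correctness of the exhaustive search\<close>

context ram_graph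
begin

definition sol :: bool where
  "sol \<longleftrightarrow> (\<exists>F\<subseteq>edges G. card F \<le> k \<and> good s F)"

text \<open>The condition inside \<open>found\<close>, restated for connected graphs in general,
  because runs of the program are analysed without assuming that the graph is AT-free.\<close>

definition candidate :: "nat \<times> nat \<Rightarrow> nat \<times> nat \<Rightarrow> nat \<times> nat \<Rightarrow> nat \<times> nat \<Rightarrow> bool" where
  "candidate g1 g2 g3 g4 \<longleftrightarrow> (let E = {pe g1, pe g2, pe g3, pe g4} in
     card E \<le> k \<and> good s E \<or>
     (\<forall>q l. walk G q l \<and> q 0 = snd g2 \<and> q l = fst g3 \<and> l = d (snd g2) (fst g3) \<longrightarrow>
        card (E \<union> pedges q l) \<le> k \<and> good s (E \<union> pedges q l)))"

definition digit :: "nat \<Rightarrow> nat \<Rightarrow> nat" where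
  "digit t i = (((\<lambda>q. q div (2 * m)) ^^ i) t) mod (2 * m)"

definition quad :: "nat \<Rightarrow> bool" where
  "quad t \<longleftrightarrow> candidate (de (digit t 0)) (de (digit t 1)) (de (digit t 2)) (de (digit t 3))"

lemma run_pick_mark:
  assumes f: "fixed \<sigma>" and mk: "marked F \<sigma>" and q: "regs \<sigma> ''q'' = q" "q \<le> (2 * m) ^ 4"
    and F: "finite F" "card F \<le> 3"
  shows "run W (Seq pick mark) \<sigma> 15 (\<lambda>\<tau>. same {''z'', ''v'', ''q'', ''x'', ''y'', ''e'', ''C''} {''B''} \<sigma> \<tau> \<and>
    regs \<tau> ''q'' = q div (2 * m) \<and> regs \<tau> ''x'' = fst (de (q mod (2 * m))) \<and>
    regs \<tau> ''y'' = snd (de (q mod (2 * m))) \<and> marked (insert (pe (de (q mod (2 * m)))) F) \<tau>)"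
proof -
  have lt: "q mod (2 * m) < 2 * m" using m by simp
  have "run W (Seq pick mark) \<sigma> (6 + 9) (\<lambda>\<tau>. same {''z'', ''v'', ''q'', ''x'', ''y'', ''e'', ''C''} {''B''} \<sigma> \<tau> \<and>
    regs \<tau> ''q'' = q div (2 * m) \<and> regs \<tau> ''x'' = fst (de (q mod (2 * m))) \<and>
    regs \<tau> ''y'' = snd (de (q mod (2 * m))) \<and> marked (insert (pe (de (q mod (2 * m)))) F) \<tau>)"
  proof (rule run_Seq[OF run_pick[OF f q]])
    fix \<tau> assume t: "same {''z'', ''v'', ''q'', ''x'', ''y''} {} \<sigma> \<tau> \<and> regs \<tau> ''q'' = q div (2 * m) \<and>
      regs \<tau> ''x'' = fst (de (q mod (2 * m))) \<and> regs \<tau> ''y'' = snd (de (q mod (2 * m)))"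
    have "fixed \<tau>" using fixed_same[OF conjunct1[OF t] _ _ f] by simp
    moreover have "marked F \<tau>" using marked_same[OF conjunct1[OF t] _ _ mk] by simp
    ultimately have "run W mark \<tau> 9 (\<lambda>\<upsilon>. same {''e'', ''v'', ''C''} {''B''} \<tau> \<upsilon> \<and>
      marked (insert {fst (de (q mod (2 * m))), snd (de (q mod (2 * m)))} F) \<upsilon>)"
      using conjunct2[OF t] de[OF lt] F by (intro run_mark) simp_all
    then show "run W mark \<tau> 9 (\<lambda>\<tau>. same {''z'', ''v'', ''q'', ''x'', ''y'', ''e'', ''C''} {''B''} \<sigma> \<tau> \<and>
      regs \<tau> ''q'' = q div (2 * m) \<and> regs \<tau> ''x'' = fst (de (q mod (2 * m))) \<and>
      regs \<tau> ''y'' = snd (de (q mod (2 * m))) \<and> marked (insert (pe (de (q mod (2 * m)))) F) \<tau>)"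
    proof (rule run_mono)
      fix \<upsilon> assume u: "same {''e'', ''v'', ''C''} {''B''} \<tau> \<upsilon> \<and>
        marked (insert {fst (de (q mod (2 * m))), snd (de (q mod (2 * m)))} F) \<upsilon>"
      have "same {''z'', ''v'', ''q'', ''x'', ''y'', ''e'', ''C''} {''B''} \<sigma> \<upsilon>"
        by (rule same_trans[OF conjunct1[OF t] conjunct1[OF u]]) auto
      then show "same {''z'', ''v'', ''q'', ''x'', ''y'', ''e'', ''C''} {''B''} \<sigma> \<upsilon> \<and>
        regs \<upsilon> ''q'' = q div (2 * m) \<and> regs \<upsilon> ''x'' = fst (de (q mod (2 * m))) \<and>
        regs \<upsilon> ''y'' = snd (de (q mod (2 * m))) \<and> marked (insert (pe (de (q mod (2 * m)))) F) \<upsilon>"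
        using conjunct2[OF t] conjunct1[OF u] conjunct2[OF u] by (simp add: same_def pe_def)
    qed simp
  qed
  then show ?thesis by (rule run_mono) simp_all
qed

abbreviation "scratch \<equiv> {''i'', ''v'', ''C'', ''q'', ''z'', ''x'', ''y'', ''e'', ''g'', ''h'', ''t'', ''r'', ''u'', ''a'', ''b'',
  ''o'', ''out'', ''j''}"

lemma same_subset: "same R A \<sigma> \<tau> \<Longrightarrow> R \<subseteq> R' \<Longrightarrow> A \<subseteq> A' \<Longrightarrow> same R' A' \<sigma> \<tau>"
  unfolding same_def by blast

lemma fixed_scratch: "same R A \<sigma> \<tau> \<Longrightarrow> R \<subseteq> scratch \<Longrightarrow> A \<subseteq> {''B'', ''E''} \<Longrightarrow> fixed \<sigma> \<Longrightarrow> fixed \<tau>"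
proof -
  assume a: "same R A \<sigma> \<tau>" "R \<subseteq> scratch" "A \<subseteq> {''B'', ''E''}" "fixed \<sigma>"
  show "fixed \<tau>" by (rule fixed_same[OF same_subset[OF a(1-3)] _ _ a(4)]) simp_all
qed

lemma card_le4: "card {a, b, c, e :: 'b} \<le> 4" "card {a, b, c :: 'b} \<le> 3" "card {a, b :: 'b} \<le> 3" "card {a :: 'b} \<le> 3"
  using card_length[of "[a, b, c, e]"] card_length[of "[a, b, c]"] card_length[of "[a, b]"] by auto

text \<open>The two directions speak of different paths. A positive answer is sound because the set
  actually tested is a solution; it is certain to occur for a candidate because there every shortest
  path works, in particular the traced one.\<close>

lemma run_attempt:
  assumes f: "fixed \<sigma>" and t: "regs \<sigma> ''l'' = t" "t < (2 * m) ^ 4"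
  shows "run W attempt \<sigma> (34 * (n * n * n) + 22 * (n * n) + (16 * n + 17) * (n * n) + 90)
    (\<lambda>\<tau>. same scratch {''B'', ''E''} \<sigma> \<tau> \<and>
      (regs \<tau> ''out'' = 1 \<and> sol \<or> regs \<tau> ''out'' = regs \<sigma> ''out'' \<and> \<not> quad t))"
proof -
  let ?M = "2 * m"
  define t1 where "t1 = t div ?M"
  define t2 where "t2 = t1 div ?M"
  define t3 where "t3 = t2 div ?M"
  have le: "t \<le> ?M ^ 4" "t1 \<le> ?M ^ 4" "t2 \<le> ?M ^ 4" "t3 \<le> ?M ^ 4"
  proof -
    have "t1 \<le> t" "t2 \<le> t1" "t3 \<le> t2" by (simp_all add: t1_def t2_def t3_def)
    then show "t \<le> ?M ^ 4" "t1 \<le> ?M ^ 4" "t2 \<le> ?M ^ 4" "t3 \<le> ?M ^ 4" using t(2) by linarith+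
  qed
  define g1 where "g1 = de (t mod ?M)"
  define g2 where "g2 = de (t1 mod ?M)"
  define g3 where "g3 = de (t2 mod ?M)"
  define g4 where "g4 = de (t3 mod ?M)"
  have quad: "quad t \<longleftrightarrow> candidate g1 g2 g3 g4"
    by (simp add: quad_def digit_def g1_def g2_def g3_def g4_def t1_def t2_def t3_def numeral_2_eq_2 numeral_3_eq_3)
  have adjs: "adj G (fst g) (snd g)" if "g \<in> {g1, g2, g3, g4}" for g
    using that m by (auto simp: g1_def g2_def g3_def g4_def intro!: de)
  let ?E1 = "{pe g1}" and ?E2 = "{pe g2, pe g1}" and ?E3 = "{pe g3, pe g2, pe g1}" and ?E = "{pe g4, pe g3, pe g2, pe g1}"
  have Eedges: "?E \<subseteq> edges G" using adjs by (auto simp: pe_def adj_def)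
  have gn: "snd g2 < n" "fst g3 < n" using adj_V(2)[OF adjs[of g2]] adj_V(1)[OF adjs[of g3]] by (auto simp: V_iff)
  have nW: "n \<le> W" using W(1) n by (metis le_square mult.assoc order_trans mult_le_mono2)
  define J where "J F q \<tau> \<longleftrightarrow> same scratch {''B'', ''E''} \<sigma> \<tau> \<and> regs \<tau> ''out'' = regs \<sigma> ''out'' \<and> fixed \<tau> \<and> marked F \<tau> \<and> regs \<tau> ''q'' = q" for F q \<tau>
  have s0: "run W (copy ''A'' ''B'') \<sigma> (4 * (n * n) + 2)
    (\<lambda>\<tau>. same {''i'', ''v''} {''B''} \<sigma> \<tau> \<and> (\<forall>i<n * n. arrs \<tau> ''B'' i = arrs \<sigma> ''A'' i))"
  proof (rule run_copy)
    fix i assume "i < n * n"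
    then have "arrs \<sigma> ''A'' i \<le> n * n + 1" using f wt_le[of G n "{}" i] by (simp add: fixed_def)
    then show "arrs \<sigma> ''A'' i \<le> W" using W by simp
  qed (use f W in \<open>auto simp: fixed_def\<close>)
  have s1: "run W (Seq (Assign ''C'' Add (Imm 0) (Imm 0)) (Assign ''q'' Add (Reg ''l'') (Imm 0))) \<tau> 2 (J {} t)"
    if a: "same {''i'', ''v''} {''B''} \<sigma> \<tau> \<and> (\<forall>i<n * n. arrs \<tau> ''B'' i = arrs \<sigma> ''A'' i)" for \<tau>
  proof (rule run_safe)
    let ?\<tau> = "st (Seq (Assign ''C'' Add (Imm 0) (Imm 0)) (Assign ''q'' Add (Reg ''l'') (Imm 0))) \<tau>"
    have sm: "same scratch {''B'', ''E''} \<sigma> ?\<tau>" using a by (auto simp: same_def)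
    then have "fixed ?\<tau>" using fixed_scratch[OF sm _ _ f] by simp
    then show "J {} t ?\<tau>" unfolding J_def using sm a t f by (auto simp: same_def marked_def fixed_def)
  qed (use a t le W in \<open>auto simp: same_def\<close>)
  have pm: "run W (Seq pick mark) \<tau> 15 (\<lambda>\<upsilon>. J (insert (pe (de (q mod ?M))) F) (q div ?M) \<upsilon> \<and>
      regs \<upsilon> ''x'' = fst (de (q mod ?M)) \<and> regs \<upsilon> ''y'' = snd (de (q mod ?M)) \<and> regs \<upsilon> ''g'' = regs \<tau> ''g'' \<and> regs \<upsilon> ''h'' = regs \<tau> ''h'')"
    if a: "J F q \<tau>" "q \<le> ?M ^ 4" "finite F" "card F \<le> 3" for F q \<tau>
  proof -
    have fx: "fixed \<tau>" and mk: "marked F \<tau>" and q: "regs \<tau> ''q'' = q" using a(1) by (auto simp: J_def)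
    show ?thesis
    proof (rule run_mono[OF run_pick_mark[OF fx mk q a(2-4)]])
      fix \<upsilon> assume u: "same {''z'', ''v'', ''q'', ''x'', ''y'', ''e'', ''C''} {''B''} \<tau> \<upsilon> \<and>
        regs \<upsilon> ''q'' = q div ?M \<and> regs \<upsilon> ''x'' = fst (de (q mod ?M)) \<and>
        regs \<upsilon> ''y'' = snd (de (q mod ?M)) \<and> marked (insert (pe (de (q mod ?M))) F) \<upsilon>"
      have sm: "same scratch {''B'', ''E''} \<sigma> \<upsilon>"
        by (rule same_trans[OF _ conjunct1[OF u], of scratch "{''B'', ''E''}"]) (use a(1) in \<open>auto simp: J_def\<close>)
      have "fixed \<upsilon>" using fixed_scratch[OF conjunct1[OF u] _ _ fx] by simp
      moreover have "regs \<upsilon> ''out'' = regs \<sigma> ''out''" using u a(1) by (simp add: same_def J_def)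
      ultimately show "J (insert (pe (de (q mod ?M))) F) (q div ?M) \<upsilon> \<and>
      regs \<upsilon> ''x'' = fst (de (q mod ?M)) \<and> regs \<upsilon> ''y'' = snd (de (q mod ?M)) \<and> regs \<upsilon> ''g'' = regs \<tau> ''g'' \<and> regs \<upsilon> ''h'' = regs \<tau> ''h''"
        unfolding J_def using u sm by (simp add: same_def)
    qed simp
  qed
  have as: "run W (Assign r Add (Reg r') (Imm 0)) \<tau> 1
      (\<lambda>\<upsilon>. J F q \<upsilon> \<and> regs \<upsilon> r = regs \<tau> r' \<and> (r = ''h'' \<longrightarrow> regs \<upsilon> ''g'' = regs \<tau> ''g''))"
    if a: "J F q \<tau>" "regs \<tau> r' \<le> W" "r \<in> {''g'', ''h''}" for F q \<tau> r r'
  proof (rule run_safe)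
    let ?\<tau> = "st (Assign r Add (Reg r') (Imm 0)) \<tau>"
    have sm: "same {r} {} \<tau> ?\<tau>" by (simp add: same_def)
    have fx: "fixed \<tau>" using a(1) by (simp add: J_def)
    have "same scratch {''B'', ''E''} \<sigma> ?\<tau>"
      by (rule same_trans[OF _ sm, of scratch "{''B'', ''E''}"]) (use a in \<open>auto simp: J_def\<close>)
    moreover have "fixed ?\<tau>" using fixed_scratch[OF sm _ _ fx] a(3) by blast
    ultimately show "J F q ?\<tau> \<and> regs ?\<tau> r = regs \<tau> r' \<and> (r = ''h'' \<longrightarrow> regs ?\<tau> ''g'' = regs \<tau> ''g'')"
      using a unfolding J_def by (auto simp: marked_def)
  qed (use a in auto)
  let ?fin = "\<lambda>\<tau>. same scratch {''B'', ''E''} \<sigma> \<tau> \<and>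
      (regs \<tau> ''out'' = 1 \<and> sol \<or> regs \<tau> ''out'' = regs \<sigma> ''out'' \<and> \<not> quad t)"
  let ?tc = "17 * (n * n * n) + 9 * (n * n) + 10" and ?tt = "(16 * n + 17) * (n * n) + 2"
  have last: "run W (Seq check (Seq trace check)) \<tau> (?tc + (?tt + ?tc)) ?fin"
    if a: "J ?E q \<tau>" "regs \<tau> ''g'' = snd g2" "regs \<tau> ''h'' = fst g3" for q \<tau>
  proof -
    have fx: "fixed \<tau>" and mk: "marked ?E \<tau>" using a(1) by (auto simp: J_def)
    let ?R1 = "{''i'', ''v'', ''t'', ''r'', ''e'', ''u'', ''a'', ''b'', ''o'', ''out''}"
    let ?R2 = "{''i'', ''j'', ''e'', ''a'', ''b'', ''z'', ''x'', ''y'', ''v'', ''C'', ''g''}"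
    show ?thesis
    proof (rule run_Seq[OF run_check[OF fx mk]])
      fix \<upsilon> assume u: "same ?R1 {''E''} \<tau> \<upsilon> \<and> regs \<upsilon> ''out'' = (if card ?E \<le> k \<and> good s ?E then 1 else regs \<tau> ''out'')"
      have fu: "fixed \<upsilon>" using fixed_scratch[OF conjunct1[OF u] _ _ fx] by simp
      have mu: "marked ?E \<upsilon>" using marked_same[OF conjunct1[OF u] _ _ mk] by simp
      have gu: "regs \<upsilon> ''g'' = snd g2" "regs \<upsilon> ''h'' = fst g3" using u a by (auto simp: same_def)
      show "run W (Seq trace check) \<upsilon> (?tt + ?tc) ?fin"
      proof (rule run_Seq[OF run_trace[OF fu mu gu(1) gn(1) gu(2) gn(2)]])
        show "finite ?E" "card ?E \<le> 4" using card_le4 by auto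
        fix \<phi> assume p: "same ?R2 {''B''} \<upsilon> \<phi> \<and>
          (\<exists>q l. walk G q l \<and> q 0 = snd g2 \<and> q l = fst g3 \<and> l = d (snd g2) (fst g3) \<and> marked (?E \<union> pedges q l) \<phi>)"
        have fp: "fixed \<phi>" using fixed_scratch[OF conjunct1[OF p] _ _ fu] by simp
        obtain q l where q: "walk G q l" "q 0 = snd g2" "q l = fst g3" "l = d (snd g2) (fst g3)"
          "marked (?E \<union> pedges q l) \<phi>" using p by blast
        have qE: "?E \<union> pedges q l \<subseteq> edges G" using Eedges walkD(2)[OF q(1)] by (auto simp: pedges_def adj_def)
        show "run W check \<phi> ?tc ?fin"
        proof (rule run_mono[OF run_check[OF fp q(5)]])
          fix \<psi> assume ps: "same ?R1 {''E''} \<phi> \<psi> \<and>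
            regs \<psi> ''out'' = (if card (?E \<union> pedges q l) \<le> k \<and> good s (?E \<union> pedges q l) then 1 else regs \<phi> ''out'')"
          have m1: "same scratch {''B'', ''E''} \<sigma> \<upsilon>"
            by (rule same_trans[OF _ conjunct1[OF u], of scratch "{''B'', ''E''}"]) (use a(1) in \<open>auto simp: J_def\<close>)
          have m2: "same scratch {''B'', ''E''} \<sigma> \<phi>" by (rule same_trans[OF m1 conjunct1[OF p]]) auto
          have m3: "same scratch {''B'', ''E''} \<sigma> \<psi>" by (rule same_trans[OF m2 conjunct1[OF ps]]) auto
          have o: "regs \<phi> ''out'' = regs \<upsilon> ''out''" using p by (simp add: same_def)
          have o': "regs \<tau> ''out'' = regs \<sigma> ''out''" using a(1) by (simp add: J_def)
          have Eeq: "{pe g1, pe g2, pe g3, pe g4} = ?E" by auto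
          consider "card ?E \<le> k \<and> good s ?E" | "card (?E \<union> pedges q l) \<le> k \<and> good s (?E \<union> pedges q l)"
            | "\<not> (card ?E \<le> k \<and> good s ?E)" "\<not> (card (?E \<union> pedges q l) \<le> k \<and> good s (?E \<union> pedges q l))" by blast
          then show "?fin \<psi>"
          proof cases
            case 1
            then have "sol" unfolding sol_def using Eedges by blast
            moreover have "regs \<psi> ''out'' = 1" using ps o u 1 by (auto split: if_splits)
            ultimately show ?thesis using m3 by blast
          next
            case 2
            then have "sol" unfolding sol_def using qE by blast
            moreover have "regs \<psi> ''out'' = 1" using ps 2 by auto
            ultimately show ?thesis using m3 by blast
          next
            case 3
            have "\<not> candidate g1 g2 g3 g4"
              unfolding candidate_def Let_def Eeq using 3 q(1-4) by blast
            moreover have "regs \<psi> ''out'' = regs \<sigma> ''out''" using ps o o' u 3 by (auto split: if_splits)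
            ultimately show ?thesis using m3 quad by blast
          qed
        qed simp
      qed
    qed
  qed
  have "run W attempt \<sigma> (4 * (n * n) + 2 + (2 + (15 + (15 + (1 + (15 + (1 + (15 + (?tc + (?tt + ?tc)))))))))) ?fin"
    unfolding attempt_def
  proof (rule run_Seq[OF s0], rule run_Seq[OF s1])
    fix \<tau>1 assume 1: "J {} t \<tau>1"
    show "run W (Seq (Seq pick mark) (Seq (Seq pick mark) (Seq (Assign ''g'' Add (Reg ''y'') (Imm 0))
      (Seq (Seq pick mark) (Seq (Assign ''h'' Add (Reg ''x'') (Imm 0))
      (Seq (Seq pick mark) (Seq check (Seq trace check)))))))) \<tau>1 (15 + (15 + (1 + (15 + (1 + (15 + (?tc + (?tt + ?tc)))))))) ?fin"
    proof (rule run_Seq[OF pm[OF 1 le(1)]], simp, simp, elim conjE)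
      fix \<tau>2 assume "J (insert (pe (de (t mod ?M))) {}) (t div ?M) \<tau>2"
      then have 2: "J ?E1 t1 \<tau>2" by (simp add: g1_def t1_def)
      show "run W (Seq (Seq pick mark) (Seq (Assign ''g'' Add (Reg ''y'') (Imm 0))
        (Seq (Seq pick mark) (Seq (Assign ''h'' Add (Reg ''x'') (Imm 0))
        (Seq (Seq pick mark) (Seq check (Seq trace check))))))) \<tau>2 (15 + (1 + (15 + (1 + (15 + (?tc + (?tt + ?tc))))))) ?fin"
      proof (rule run_Seq[OF pm[OF 2 le(2)]], simp, simp, elim conjE)
        fix \<tau>3 assume "J (insert (pe (de (t1 mod ?M))) ?E1) (t1 div ?M) \<tau>3" and y: "regs \<tau>3 ''y'' = snd (de (t1 mod ?M))"
        then have 3: "J ?E2 t2 \<tau>3" "regs \<tau>3 ''y'' = snd g2" by (simp_all add: g2_def t2_def)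
        show "run W (Seq (Assign ''g'' Add (Reg ''y'') (Imm 0)) (Seq (Seq pick mark) (Seq (Assign ''h'' Add (Reg ''x'') (Imm 0))
          (Seq (Seq pick mark) (Seq check (Seq trace check)))))) \<tau>3 (1 + (15 + (1 + (15 + (?tc + (?tt + ?tc)))))) ?fin"
        proof (rule run_Seq[OF as[OF 3(1)]], use 3 gn nW in simp, simp, elim conjE)
          fix \<tau>4 assume 4: "J ?E2 t2 \<tau>4" and "regs \<tau>4 ''g'' = regs \<tau>3 ''y''"
          then have g4': "regs \<tau>4 ''g'' = snd g2" using 3 by simp
          show "run W (Seq (Seq pick mark) (Seq (Assign ''h'' Add (Reg ''x'') (Imm 0))
            (Seq (Seq pick mark) (Seq check (Seq trace check))))) \<tau>4 (15 + (1 + (15 + (?tc + (?tt + ?tc))))) ?fin"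
          proof (rule run_Seq[OF pm[OF 4 le(3)]], simp, rule card_le4, elim conjE)
            fix \<tau>5 assume "J (insert (pe (de (t2 mod ?M))) ?E2) (t2 div ?M) \<tau>5" "regs \<tau>5 ''x'' = fst (de (t2 mod ?M))"
              "regs \<tau>5 ''g'' = regs \<tau>4 ''g''"
            then have 5: "J ?E3 t3 \<tau>5" "regs \<tau>5 ''x'' = fst g3" "regs \<tau>5 ''g'' = snd g2"
              using g4' by (simp_all add: g3_def t3_def)
            show "run W (Seq (Assign ''h'' Add (Reg ''x'') (Imm 0)) (Seq (Seq pick mark) (Seq check (Seq trace check)))) \<tau>5
              (1 + (15 + (?tc + (?tt + ?tc)))) ?fin"
            proof (rule run_Seq[OF as[OF 5(1)]], use 5 gn nW in simp, simp, elim conjE)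
              fix \<tau>6 assume 6: "J ?E3 t3 \<tau>6" and "regs \<tau>6 ''h'' = regs \<tau>5 ''x''"
                "''h'' = ''h'' \<longrightarrow> regs \<tau>6 ''g'' = regs \<tau>5 ''g''"
              then have gh: "regs \<tau>6 ''g'' = snd g2" "regs \<tau>6 ''h'' = fst g3" using 5 by auto
              show "run W (Seq (Seq pick mark) (Seq check (Seq trace check))) \<tau>6 (15 + (?tc + (?tt + ?tc))) ?fin"
              proof (rule run_Seq[OF pm[OF 6 le(4)]], simp, rule card_le4, elim conjE)
                fix \<tau>7 assume "J (insert (pe (de (t3 mod ?M))) ?E3) (t3 div ?M) \<tau>7"
                  "regs \<tau>7 ''g'' = regs \<tau>6 ''g''" "regs \<tau>7 ''h'' = regs \<tau>6 ''h''"
                then show "run W (Seq check (Seq trace check)) \<tau>7 (?tc + (?tt + ?tc)) ?fin"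
                  using gh by (intro last[of "t3 div ?M"]) (simp_all add: g4_def)
              qed
            qed
          qed
        qed
      qed
    qed
  qed
  then show ?thesis by (rule run_mono) simp_all
qed

lemma run_search:
  assumes f: "fixed \<sigma>" and out: "regs \<sigma> ''out'' = 0"
  shows "run W search \<sigma> ((34 * (n * n * n) + 22 * (n * n) + (16 * n + 17) * (n * n) + 92) * (2 * m) ^ 4 + 2)
    (\<lambda>\<tau>. (regs \<tau> ''out'' = 0 \<or> regs \<tau> ''out'' = 1 \<and> sol) \<and> (\<forall>t<(2 * m) ^ 4. quad t \<longrightarrow> regs \<tau> ''out'' = 1))"
proof -
  let ?I = "\<lambda>j \<tau>. fixed \<tau> \<and> (regs \<tau> ''out'' = 0 \<or> regs \<tau> ''out'' = 1 \<and> sol) \<and> (\<forall>t<j. quad t \<longrightarrow> regs \<tau> ''out'' = 1)"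
  let ?T = "34 * (n * n * n) + 22 * (n * n) + (16 * n + 17) * (n * n) + 90"
  have "run W search \<sigma> ((?T + 2) * (2 * m) ^ 4 + 2) (\<lambda>\<tau>. ?I ((2 * m) ^ 4) \<tau> \<and> regs \<tau> ''l'' = (2 * m) ^ 4)"
    unfolding search_def
  proof (rule run_For)
    show "regs \<sigma> ''Q'' = (2 * m) ^ 4" using f by (simp add: fixed_def)
    show "?I 0 (\<sigma>\<lparr>regs := (regs \<sigma>)(''l'' := 0)\<rparr>)" using f out by (simp add: fixed_def)
    fix j \<tau> assume j: "j < (2 * m) ^ 4" and I: "?I j \<tau>" and r: "regs \<tau> ''l'' = j" "regs \<tau> ''Q'' = (2 * m) ^ 4"
    show "run W attempt \<tau> ?T (\<lambda>\<tau>. regs \<tau> ''l'' = j \<and> regs \<tau> ''Q'' = (2 * m) ^ 4 \<and>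
      ?I (Suc j) (\<tau>\<lparr>regs := (regs \<tau>)(''l'' := Suc j)\<rparr>))"
    proof (rule run_mono[OF run_attempt[OF conjunct1[OF I] r(1) j]])
      fix \<upsilon> assume u: "same scratch {''B'', ''E''} \<tau> \<upsilon> \<and>
        (regs \<upsilon> ''out'' = 1 \<and> sol \<or> regs \<upsilon> ''out'' = regs \<tau> ''out'' \<and> \<not> quad j)"
      have "fixed \<upsilon>" using fixed_scratch[OF conjunct1[OF u] _ _ conjunct1[OF I]] by simp
      then have "fixed (\<upsilon>\<lparr>regs := (regs \<upsilon>)(''l'' := Suc j)\<rparr>)" by (simp add: fixed_def)
      moreover have "regs \<upsilon> ''l'' = regs \<tau> ''l''" "regs \<upsilon> ''Q'' = regs \<tau> ''Q''"
        using conjunct1[OF u] by (simp_all add: same_def)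
      moreover have "(regs \<upsilon> ''out'' = 0 \<or> regs \<upsilon> ''out'' = 1 \<and> sol) \<and> (\<forall>t<Suc j. quad t \<longrightarrow> regs \<upsilon> ''out'' = 1)"
      proof (cases "regs \<upsilon> ''out'' = 1 \<and> sol")
        case False
        then have "regs \<upsilon> ''out'' = regs \<tau> ''out''" "\<not> quad j" using conjunct2[OF u] by blast+
        then show ?thesis using conjunct2[OF I] by (simp add: less_Suc_eq all_conj_distrib)
      qed simp
      ultimately show "regs \<upsilon> ''l'' = j \<and> regs \<upsilon> ''Q'' = (2 * m) ^ 4 \<and>
        ?I (Suc j) (\<upsilon>\<lparr>regs := (regs \<upsilon>)(''l'' := Suc j)\<rparr>)"
        using r by simp
    qed (rule order_refl)
  next
    show "(2 * m) ^ 4 \<le> W" by (rule W(4))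
  qed simp
  then show ?thesis
  proof (rule run_mono)
    show "(?T + 2) * (2 * m) ^ 4 + 2 \<le> (34 * (n * n * n) + 22 * (n * n) + (16 * n + 17) * (n * n) + 92) * (2 * m) ^ 4 + 2"
      by (simp only: add.assoc) simp
  qed blast
qed

text \<open>Writing a number in base \<open>2 * m\<close> makes one loop counter run through all
  quadruples of directed edges.\<close>

lemma digits_ex:
  assumes "a < 2 * m" "b < 2 * m" "c < 2 * m" "e < 2 * m"
  shows "\<exists>t<(2 * m) ^ 4. digit t 0 = a \<and> digit t 1 = b \<and> digit t 2 = c \<and> digit t 3 = e"
proof -
  define M where "M = 2 * m"
  have lt: "a < M" "b < M" "c < M" "e < M" using assms by (auto simp: M_def)
  define t3 where "t3 = e"
  define t2 where "t2 = t3 * M + c"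
  define t1 where "t1 = t2 * M + b"
  define t where "t = t1 * M + a"
  have step: "q' * M + r < M ^ Suc i" if "q' < M ^ i" "r < M" for q' r i
  proof -
    have "q' * M + r < Suc q' * M" using that by simp
    also have "\<dots> \<le> M ^ i * M" using that by (intro mult_le_mono1) simp
    finally show ?thesis by (simp add: mult.commute)
  qed
  have "t3 < M ^ 1" using lt by (simp add: t3_def)
  then have "t2 < M ^ Suc 1" unfolding t2_def using lt by (intro step)
  then have "t1 < M ^ Suc (Suc 1)" unfolding t1_def using lt by (intro step)
  then have "t < M ^ Suc (Suc (Suc 1))" unfolding t_def using lt by (intro step)
  then have tM: "t < M ^ 4" by (simp add: eval_nat_numeral)
  have q: "t div M = t1" "t mod M = a" "t1 div M = t2" "t1 mod M = b" "t2 div M = t3" "t2 mod M = c" "t3 mod M = e"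
    using lt by (simp_all only: t_def t1_def t2_def t3_def) (simp_all add: div_add1_eq)
  have "digit t 0 = a \<and> digit t 1 = b \<and> digit t 2 = c \<and> digit t 3 = e"
    unfolding digit_def M_def[symmetric] by (simp add: numeral_2_eq_2 numeral_3_eq_3 q)
  then show ?thesis using tM unfolding M_def by blast
qed

lemma sol_imp_quad:
  assumes "AT_free G" "sol" "\<not> good s {}" "2 \<le> s"
  shows "\<exists>t<(2 * m) ^ 4. quad t"
proof -
  interpret atgraph G using assms(1) verts n by unfold_locales (auto simp: lessThan_empty_iff)
  obtain F where "F \<subseteq> edges G" "card F \<le> k" "good s F" using assms(2) by (auto simp: sol_def)
  then have "found k s" using found_if_good assms(3,4) by blast
  then obtain g1 g2 g3 g4 where g: "dedge g1" "dedge g2" "dedge g3" "dedge g4" "candidate g1 g2 g3 g4"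
    unfolding found_def candidate_def by blast
  have ex: "\<exists>j<2 * m. de j = g" if "dedge g" for g
    using de_onto[of "fst g" "snd g"] that by (simp add: dedge_def)
  obtain a b c e where "a < 2 * m" "de a = g1" "b < 2 * m" "de b = g2" "c < 2 * m" "de c = g3" "e < 2 * m" "de e = g4"
    using ex[OF g(1)] ex[OF g(2)] ex[OF g(3)] ex[OF g(4)] by blast
  moreover then obtain t where "t < (2 * m) ^ 4" "digit t 0 = a" "digit t 1 = b" "digit t 2 = c" "digit t 3 = e"
    using digits_ex by blast
  ultimately show ?thesis using g(5) unfolding quad_def by blast
qed

end

section \<open>The complete program\<close>

text \<open>\<open>ps\<close> is a program that puts \<open>s\<close> into its register: a constant, or the last input number.\<close>

definition read_input :: "prog \<Rightarrow> prog" where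
  "read_input ps = Seq (block [
     Load ''n'' ''in'' (Imm 0),
     Load ''m'' ''in'' (Imm 1),
     Assign ''N'' Mul (Reg ''n'') (Reg ''n''),
     Assign ''P'' Mul (Reg ''N'') (Reg ''n''),
     Assign ''I'' Add (Reg ''N'') (Imm 1),
     Assign ''M'' Mul (Reg ''m'') (Imm 2),
     Assign ''Q'' Mul (Reg ''M'') (Reg ''M''),
     Assign ''Q'' Mul (Reg ''Q'') (Reg ''Q''),
     Assign ''w'' Add (Reg ''M'') (Imm 2),
     Load ''k'' ''in'' (Reg ''w'')]) ps"

definition fill :: prog where
  "fill = For ''i'' ''N'' (Store ''A'' (Reg ''i'') (Reg ''I''))"

definition clear_diagonal :: prog where
  "clear_diagonal = For ''i'' ''n'' (block [
     Assign ''e'' Mul (Reg ''i'') (Reg ''n''),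
     Assign ''e'' Add (Reg ''e'') (Reg ''i''),
     Store ''A'' (Reg ''e'') (Imm 0)])"

definition load_edge :: prog where
  "load_edge = block [
     Assign ''e'' Mul (Reg ''j'') (Imm 2),
     Assign ''e'' Add (Reg ''e'') (Imm 2),
     Load ''x'' ''in'' (Reg ''e''),
     Assign ''e'' Add (Reg ''e'') (Imm 1),
     Load ''y'' ''in'' (Reg ''e'')]"

definition list_edge :: prog where
  "list_edge = block [
     Store ''T'' (Reg ''j'') (Reg ''x''),
     Store ''H'' (Reg ''j'') (Reg ''y''),
     Assign ''e'' Add (Reg ''j'') (Reg ''m''),
     Store ''T'' (Reg ''e'') (Reg ''y''),
     Store ''H'' (Reg ''e'') (Reg ''x'')]"

definition weigh_edge :: prog where
  "weigh_edge = block [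
     Assign ''e'' Mul (Reg ''x'') (Reg ''n''),
     Assign ''e'' Add (Reg ''e'') (Reg ''y''),
     Store ''A'' (Reg ''e'') (Imm 1),
     Assign ''e'' Mul (Reg ''y'') (Reg ''n''),
     Assign ''e'' Add (Reg ''e'') (Reg ''x''),
     Store ''A'' (Reg ''e'') (Imm 1)]"

definition enter_edge :: prog where
  "enter_edge = Seq load_edge (Seq list_edge weigh_edge)"

definition build :: prog where
  "build = Seq fill (Seq clear_diagonal (Seq (For ''j'' ''m'' enter_edge) (Seq (copy ''A'' ''D'') (floyd ''D''))))"

text \<open>The value for infinity exceeds \<open>N\<close>, so the first test is one for
  connectedness. The empty edge set is tested separately, as every candidate contains an
  edge.\<close>

definition decide :: prog where
  "decide = Seq (all_below ''D'' (Reg ''N'')) (Cond (Eq (Reg ''o'') (Imm 1))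
     (Seq (all_below ''D'' (Reg ''s'')) (Cond (Eq (Reg ''o'') (Imm 1)) (Assign ''out'' Add (Imm 1) (Imm 0)) search)) Skip)"

text \<open>Edgeless graphs are decided at once: their time bound is constant, so not even the
  matrices may be built.\<close>

definition solver :: "prog \<Rightarrow> prog" where
  "solver ps = Seq (read_input ps) (Cond (Eq (Reg ''m'') (Imm 0))
     (Cond (Leq (Reg ''n'') (Imm 1)) (Assign ''out'' Add (Imm 1) (Imm 0)) Skip) (Seq build decide))"

section \<open>Reading the input and building the matrices\<close>

locale ram_input =
  fixes G :: "nat ugraph" and n :: nat and es :: "(nat \<times> nat) list" and k s W m :: nat
  assumes simple: "simple_graph G" and verts: "verts G = {..<n}"
    and edges: "edges G = set (map (\<lambda>(u, v). {u, v}) es)" and m: "m = length es"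
    and W: "n * n * n \<le> W" "2 * (n * n + 1) \<le> W" "n * n + 10 \<le> W" "(2 * m) ^ 4 \<le> W" "k \<le> W" "s \<le> W"
      "2 * m + 3 \<le> W" "n \<le> W"
begin

lemma adj_iff: "adj G u v \<longleftrightarrow> (u, v) \<in> set es \<or> (v, u) \<in> set es"
  by (force simp: adj_def edges doubleton_eq_iff)

lemma adj_bounds: "adj G u v \<Longrightarrow> u < n \<and> v < n \<and> u \<noteq> v"
  using simple verts unfolding simple_graph_def adj_def by fastforce

lemma adj_nth: "j < m \<Longrightarrow> adj G (fst (es ! j)) (snd (es ! j))"
  using adj_iff nth_mem m by (metis prod.collapse)

text \<open>The order in which \<open>list_edge\<close> stores the directed edges: the input edges
  as given, and then their reversals, shifted by \<open>m\<close>.\<close>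

definition dir :: "nat \<Rightarrow> nat \<times> nat" where
  "dir j = (if j < m then es ! j else prod.swap (es ! (j - m)))"

lemma adj_dir: "j < 2 * m \<Longrightarrow> adj G (fst (dir j)) (snd (dir j))"
  using adj_nth[of j] adj_nth[of "j - m"] adj_commute[of G "snd (es ! (j - m))"] by (auto simp: dir_def)

lemma dir_onto: "adj G u v \<Longrightarrow> \<exists>j<2 * m. dir j = (u, v)"
proof -
  assume "adj G u v"
  then consider "(u, v) \<in> set es" | "(v, u) \<in> set es" using adj_iff by blast
  then show ?thesis
  proof cases
    case 1
    then obtain j where "j < m" "es ! j = (u, v)" by (auto simp: in_set_conv_nth m)
    then show ?thesis by (intro exI[of _ j]) (simp add: dir_def)
  next
    case 2
    then obtain j where "j < m" "es ! j = (v, u)" by (auto simp: in_set_conv_nth m)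
    then show ?thesis by (intro exI[of _ "j + m"]) (simp add: dir_def)
  qed
qed

definition has_input :: "state \<Rightarrow> bool" where
  "has_input \<sigma> \<longleftrightarrow> arrs \<sigma> ''in'' 0 = n \<and> arrs \<sigma> ''in'' 1 = m \<and> arrs \<sigma> ''in'' (2 * m + 2) = k \<and>
     (\<forall>j<m. arrs \<sigma> ''in'' (2 * j + 2) = fst (es ! j) \<and> arrs \<sigma> ''in'' (2 * j + 3) = snd (es ! j))"

definition ready :: "state \<Rightarrow> bool" where
  "ready \<sigma> \<longleftrightarrow> has_input \<sigma> \<and> regs \<sigma> ''n'' = n \<and> regs \<sigma> ''N'' = n * n \<and> regs \<sigma> ''P'' = n * n * n \<and>
     regs \<sigma> ''I'' = n * n + 1 \<and> regs \<sigma> ''m'' = m \<and> regs \<sigma> ''M'' = 2 * m \<and>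
     regs \<sigma> ''Q'' = (2 * m) ^ 4 \<and> regs \<sigma> ''k'' = k \<and> regs \<sigma> ''s'' = s \<and> regs \<sigma> ''out'' = 0"

lemma ready_same:
  assumes "same R A \<sigma> \<tau>" "R \<inter> {''n'', ''N'', ''P'', ''I'', ''m'', ''M'', ''Q'', ''k'', ''s'', ''out''} = {}"
    "''in'' \<notin> A" "ready \<sigma>"
  shows "ready \<tau>"
proof -
  have "regs \<tau> r = regs \<sigma> r" if "r \<in> {''n'', ''N'', ''P'', ''I'', ''m'', ''M'', ''Q'', ''k'', ''s'', ''out''}" for r
  proof (rule same_regs[OF assms(1)])
    show "r \<notin> R" using IntI[of r R, OF _ that] unfolding assms(2) by blast
  qed
  moreover have "arrs \<tau> ''in'' = arrs \<sigma> ''in''" using assms(1,3) by (simp add: same_def)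
  ultimately show ?thesis using assms(4) unfolding ready_def has_input_def by simp
qed

lemma run_read_input:
  assumes i: "has_input \<sigma>" and out: "regs \<sigma> ''out'' = 0"
    and ps: "\<And>\<tau>. arrs \<tau> = arrs \<sigma> \<Longrightarrow> regs \<tau> ''w'' = 2 * m + 2 \<Longrightarrow>
      run W ps \<tau> 2 (\<lambda>\<upsilon>. same {''w'', ''s''} {} \<tau> \<upsilon> \<and> regs \<upsilon> ''s'' = s)"
  shows "run W (read_input ps) \<sigma> 12 ready"
proof -
  let ?J = "\<lambda>\<tau> :: state. arrs \<tau> = arrs \<sigma> \<and> regs \<tau> ''w'' = 2 * m + 2 \<and> regs \<tau> ''n'' = n \<and> regs \<tau> ''N'' = n * n \<and>
     regs \<tau> ''P'' = n * n * n \<and> regs \<tau> ''I'' = n * n + 1 \<and> regs \<tau> ''m'' = m \<and> regs \<tau> ''M'' = 2 * m \<and>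
     regs \<tau> ''Q'' = (2 * m) ^ 4 \<and> regs \<tau> ''k'' = k \<and> regs \<tau> ''out'' = 0"
  have p4: "m * 2 * (m * 2) * (m * 2 * (m * 2)) = (2 * m) ^ 4"
    by (simp only: power4_eq_xxxx mult.commute[of 2 m] mult.assoc)
  have p2: "m * 2 * (m * 2) \<le> W"
    by (rule le_trans[OF le_square]) (simp only: p4 W(4))
  have in': "arrs \<sigma> ''in'' 0 = n" "arrs \<sigma> ''in'' (Suc 0) = m" "arrs \<sigma> ''in'' (Suc (Suc (m * 2))) = k"
    using i by (simp_all add: has_input_def mult.commute)
  have "run W (read_input ps) \<sigma> (10 + 2) ready"
    unfolding read_input_def
  proof (rule run_Seq)
    show "run W (block [Load ''n'' ''in'' (Imm 0), Load ''m'' ''in'' (Imm 1), Assign ''N'' Mul (Reg ''n'') (Reg ''n''),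
      Assign ''P'' Mul (Reg ''N'') (Reg ''n''), Assign ''I'' Add (Reg ''N'') (Imm 1), Assign ''M'' Mul (Reg ''m'') (Imm 2),
      Assign ''Q'' Mul (Reg ''M'') (Reg ''M''), Assign ''Q'' Mul (Reg ''Q'') (Reg ''Q''),
      Assign ''w'' Add (Reg ''M'') (Imm 2), Load ''k'' ''in'' (Reg ''w'')]) \<sigma> 10 ?J"
    proof (rule run_safe)
      have "m \<le> W" "m * 2 \<le> W" "Suc (Suc (m * 2)) \<le> W" "n * n \<le> W" "Suc (n * n) \<le> W" using W(2,3,7) by simp_all
      then show "safe W (block [Load ''n'' ''in'' (Imm 0), Load ''m'' ''in'' (Imm 1), Assign ''N'' Mul (Reg ''n'') (Reg ''n''),
        Assign ''P'' Mul (Reg ''N'') (Reg ''n''), Assign ''I'' Add (Reg ''N'') (Imm 1), Assign ''M'' Mul (Reg ''m'') (Imm 2),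
        Assign ''Q'' Mul (Reg ''M'') (Reg ''M''), Assign ''Q'' Mul (Reg ''Q'') (Reg ''Q''),
        Assign ''w'' Add (Reg ''M'') (Imm 2), Load ''k'' ''in'' (Reg ''w'')]) \<sigma>"
        using W(1,5,8) p2 W(4)[folded p4] by (simp add: in' del: mult_Suc_right)
    qed (simp_all add: in' out power4_eq_xxxx del: mult_Suc_right)
  next
    fix \<tau> assume J: "?J \<tau>"
    show "run W ps \<tau> 2 ready"
    proof (rule run_mono[OF ps])
      fix \<upsilon> assume u: "same {''w'', ''s''} {} \<tau> \<upsilon> \<and> regs \<upsilon> ''s'' = s"
      have "arrs \<upsilon> = arrs \<sigma>" using conjunct1[OF u] conjunct1[OF J] by (auto simp: same_def)
      moreover have "regs \<upsilon> r = regs \<tau> r" if "r \<notin> {''w'', ''s''}" for r using conjunct1[OF u] that by (simp add: same_def)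
      ultimately show "ready \<upsilon>" using conjunct2[OF u] conjunct2[OF J] i unfolding ready_def has_input_def by simp
    qed (use J in simp_all)
  qed
  then show ?thesis by simp
qed

lemma run_fill:
  assumes r: "ready \<sigma>"
  shows "run W fill \<sigma> (3 * (n * n) + 2) (\<lambda>\<tau>. same {''i''} {''A''} \<sigma> \<tau> \<and> (\<forall>e<n * n. arrs \<tau> ''A'' e = n * n + 1))"
proof -
  let ?I = "\<lambda>j \<tau>. same {''i''} {''A''} \<sigma> \<tau> \<and> (\<forall>e<j. arrs \<tau> ''A'' e = n * n + 1)"
  have I: "regs \<sigma> ''I'' = n * n + 1" "regs \<sigma> ''N'' = n * n" using r by (simp_all add: ready_def)
  have nW: "n * n + 1 \<le> W" using W(2) by simp
  have "run W fill \<sigma> ((1 + 2) * (n * n) + 2) (\<lambda>\<tau>. ?I (n * n) \<tau> \<and> regs \<tau> ''i'' = n * n)"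
    unfolding fill_def
  proof (rule run_For[where I = ?I])
    fix j \<tau> assume j: "j < n * n" and H: "?I j \<tau>" and q: "regs \<tau> ''i'' = j" "regs \<tau> ''N'' = n * n"
    have "regs \<tau> ''I'' = n * n + 1" using H I by (simp add: same_def)
    then show "run W (Store ''A'' (Reg ''i'') (Reg ''I'')) \<tau> 1
      (\<lambda>\<tau>. regs \<tau> ''i'' = j \<and> regs \<tau> ''N'' = n * n \<and> ?I (Suc j) (\<tau>\<lparr>regs := (regs \<tau>)(''i'' := Suc j)\<rparr>))"
      by (intro run_safe) (use H q nW in \<open>simp_all add: same_def less_Suc_eq\<close>)
  qed (use I nW in \<open>simp_all add: same_def\<close>)
  then show ?thesis by (rule run_mono) simp_all
qed

lemma run_clear_diagonal:
  assumes r: "ready \<sigma>" and A: "\<forall>e<n * n. arrs \<sigma> ''A'' e = n * n + 1"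
  shows "run W clear_diagonal \<sigma> (5 * n + 2) (\<lambda>\<tau>. same {''i'', ''e''} {''A''} \<sigma> \<tau> \<and>
    (\<forall>u<n. \<forall>v<n. arrs \<tau> ''A'' (u * n + v) = (if u = v then 0 else n * n + 1)))"
proof -
  let ?I = "\<lambda>j \<tau>. same {''i'', ''e''} {''A''} \<sigma> \<tau> \<and>
    (\<forall>u<n. \<forall>v<n. arrs \<tau> ''A'' (u * n + v) = (if u = v \<and> u < j then 0 else n * n + 1))"
  let ?b = "block [Assign ''e'' Mul (Reg ''i'') (Reg ''n''), Assign ''e'' Add (Reg ''e'') (Reg ''i''),
     Store ''A'' (Reg ''e'') (Imm 0)]"
  have I: "regs \<sigma> ''n'' = n" using r by (simp add: ready_def)
  have "run W clear_diagonal \<sigma> ((3 + 2) * n + 2) (\<lambda>\<tau>. ?I n \<tau> \<and> regs \<tau> ''i'' = n)"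
    unfolding clear_diagonal_def
  proof (rule run_For[where I = ?I])
    show "?I 0 (\<sigma>\<lparr>regs := (regs \<sigma>)(''i'' := 0)\<rparr>)"
      using A index_less[of _ n] by (simp add: same_def)
    fix j \<tau> assume j: "j < n" and H: "?I j \<tau>" and q: "regs \<tau> ''i'' = j" "regs \<tau> ''n'' = n"
    have lt: "j * n + j < n * n" using index_less[OF j j] .
    have e: "u * n + v = j * n + j \<longleftrightarrow> u = j \<and> v = j" if "v < n" for u v
      by (rule index_eq[OF that j])
    show "run W ?b \<tau> 3
      (\<lambda>\<tau>. regs \<tau> ''i'' = j \<and> regs \<tau> ''n'' = n \<and> ?I (Suc j) (\<tau>\<lparr>regs := (regs \<tau>)(''i'' := Suc j)\<rparr>))"
    proof (rule run_safe)
      have "j * n \<le> W" "j * n + j \<le> W" using lt W(3) by linarith+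
      then show "safe W ?b \<tau>" using q by simp
      show "regs (st ?b \<tau>) ''i'' = j \<and> regs (st ?b \<tau>) ''n'' = n \<and>
        ?I (Suc j) ((st ?b \<tau>)\<lparr>regs := (regs (st ?b \<tau>))(''i'' := Suc j)\<rparr>)"
        using H q by (auto simp: same_def e less_Suc_eq)
    qed simp
  qed (use I W(8) in simp_all)
  then show ?thesis by (rule run_mono) simp_all
qed

lemma run_enter_edges:
  assumes r: "ready \<sigma>" and A: "\<forall>u<n. \<forall>v<n. arrs \<sigma> ''A'' (u * n + v) = (if u = v then 0 else n * n + 1)"
  shows "run W (For ''j'' ''m'' enter_edge) \<sigma> (18 * m + 2)
    (\<lambda>\<tau>. same {''j'', ''e'', ''x'', ''y''} {''A'', ''T'', ''H''} \<sigma> \<tau> \<and>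
      (\<forall>i<n * n. arrs \<tau> ''A'' i = wt G n {} i) \<and>
      (\<forall>j<2 * m. arrs \<tau> ''T'' j = fst (dir j) \<and> arrs \<tau> ''H'' j = snd (dir j)))"
proof -
  let ?I = "\<lambda>j \<tau>. same {''j'', ''e'', ''x'', ''y''} {''A'', ''T'', ''H''} \<sigma> \<tau> \<and>
    (\<forall>u<n. \<forall>v<n. arrs \<tau> ''A'' (u * n + v) =
      (if u = v then 0 else if \<exists>i<j. es ! i = (u, v) \<or> es ! i = (v, u) then 1 else n * n + 1)) \<and>
    (\<forall>i<j. arrs \<tau> ''T'' i = fst (es ! i) \<and> arrs \<tau> ''H'' i = snd (es ! i) \<and>
       arrs \<tau> ''T'' (i + m) = snd (es ! i) \<and> arrs \<tau> ''H'' (i + m) = fst (es ! i))"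
  have I: "regs \<sigma> ''m'' = m" using r by (simp add: ready_def)
  have "run W (For ''j'' ''m'' enter_edge) \<sigma> ((16 + 2) * m + 2) (\<lambda>\<tau>. ?I m \<tau> \<and> regs \<tau> ''j'' = m)"
  proof (rule run_For[where I = ?I])
    show "?I 0 (\<sigma>\<lparr>regs := (regs \<sigma>)(''j'' := 0)\<rparr>)" using A by (simp add: same_def)
    fix j \<tau> assume j: "j < m" and H: "?I j \<tau>" and q: "regs \<tau> ''j'' = j" "regs \<tau> ''m'' = m"
    have m0: "0 < m" using j by simp
    define x where "x = fst (es ! j)"
    define y where "y = snd (es ! j)"
    have esj: "es ! j = (x, y)" by (simp add: x_def y_def)
    have xy: "x < n" "y < n" "x \<noteq> y" using adj_bounds[OF adj_nth[OF j]] by (auto simp: x_def y_def)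
    have sm: "same {''j'', ''e'', ''x'', ''y''} {''A'', ''T'', ''H''} \<sigma> \<tau>" using H by blast
    have "ready \<tau>" using ready_same[OF sm _ _ r] by simp
    then have n: "regs \<tau> ''n'' = n" and
      inp: "arrs \<tau> ''in'' (Suc (Suc (j * 2))) = x" "arrs \<tau> ''in'' (Suc (Suc (Suc (j * 2)))) = y"
      using j unfolding ready_def has_input_def by (simp_all add: x_def y_def mult.commute eval_nat_numeral)
    define \<tau>1 where "\<tau>1 = st load_edge \<tau>"
    define \<tau>2 where "\<tau>2 = st list_edge \<tau>1"
    define \<tau>3 where "\<tau>3 = st weigh_edge \<tau>2"
    have 1: "arrs \<tau>1 = arrs \<tau>" "regs \<tau>1 = (regs \<tau>)(''x'' := x, ''y'' := y, ''e'' := Suc (Suc (Suc (j * 2))))"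
      using q inp by (auto simp: \<tau>1_def load_edge_def)
    have 2: "arrs \<tau>2 ''T'' = (arrs \<tau> ''T'')(j := x, j + m := y)"
      "arrs \<tau>2 ''H'' = (arrs \<tau> ''H'')(j := y, j + m := x)"
      "\<And>a. a \<notin> {''T'', ''H''} \<Longrightarrow> arrs \<tau>2 a = arrs \<tau> a" "\<And>r. r \<noteq> ''e'' \<Longrightarrow> regs \<tau>2 r = regs \<tau>1 r"
      using q by (simp_all add: \<tau>2_def list_edge_def 1)
    have r2: "regs \<tau>2 ''x'' = x" "regs \<tau>2 ''y'' = y" "regs \<tau>2 ''n'' = n" using n by (simp_all add: 2(4) 1(2))
    have 3: "arrs \<tau>3 ''A'' = (arrs \<tau>2 ''A'')(x * n + y := 1, y * n + x := 1)"
      "\<And>a. a \<noteq> ''A'' \<Longrightarrow> arrs \<tau>3 a = arrs \<tau>2 a" "\<And>r. r \<noteq> ''e'' \<Longrightarrow> regs \<tau>3 r = regs \<tau>2 r"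
      by (simp_all add: \<tau>3_def weigh_edge_def r2)
    have regs: "regs \<tau>3 r = regs \<tau> r" if "r \<notin> {''e'', ''x'', ''y''}" for r
      using that by (simp add: 1 2 3)
    have arrs: "arrs \<tau>3 ''A'' = (arrs \<tau> ''A'')(x * n + y := 1, y * n + x := 1)"
      "arrs \<tau>3 ''T'' = (arrs \<tau> ''T'')(j := x, j + m := y)"
      "arrs \<tau>3 ''H'' = (arrs \<tau> ''H'')(j := y, j + m := x)"
      "\<And>a. a \<notin> {''A'', ''T'', ''H''} \<Longrightarrow> arrs \<tau>3 a = arrs \<tau> a"
      by (simp_all add: 2 3)
    have tau: "st enter_edge \<tau> = \<tau>3" by (simp add: enter_edge_def \<tau>1_def \<tau>2_def \<tau>3_def)
    show "run W enter_edge \<tau> 16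
      (\<lambda>\<tau>. regs \<tau> ''j'' = j \<and> regs \<tau> ''m'' = m \<and> ?I (Suc j) (\<tau>\<lparr>regs := (regs \<tau>)(''j'' := Suc j)\<rparr>))"
    proof (rule run_safe)
      have b: "x * n + y \<le> W" "y * n + x \<le> W" using index_less[OF xy(1,2)] index_less[OF xy(2,1)] W(3) by linarith+
      then have "x * n \<le> W" "y * n \<le> W" "x \<le> W" "y \<le> W" by linarith+
      moreover have "j * 2 \<le> W" "Suc (Suc (j * 2)) \<le> W" "Suc (Suc (Suc (j * 2))) \<le> W" "j + m \<le> W" "1 \<le> W"
        using j W(7) by linarith+
      moreover from this have "safe W load_edge \<tau>" "safe W weigh_edge \<tau>2"
        using b q inp by (simp_all add: load_edge_def weigh_edge_def r2)
      moreover from calculation have "safe W list_edge \<tau>1" using q by (simp add: list_edge_def 1)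
      ultimately show "safe W enter_edge \<tau>" by (simp add: enter_edge_def \<tau>1_def \<tau>2_def)
      let ?\<upsilon> = "\<tau>3\<lparr>regs := (regs \<tau>3)(''j'' := Suc j)\<rparr>"
      have "same {''j'', ''e'', ''x'', ''y''} {''A'', ''T'', ''H''} \<tau> ?\<upsilon>"
        unfolding same_def using regs arrs(4) by simp
      then have "same {''j'', ''e'', ''x'', ''y''} {''A'', ''T'', ''H''} \<sigma> ?\<upsilon>"
        by (rule same_trans[OF sm]) simp_all
      moreover have "arrs \<tau>3 ''A'' (u * n + v) =
        (if u = v then 0 else if \<exists>i<Suc j. es ! i = (u, v) \<or> es ! i = (v, u) then 1 else n * n + 1)"
        if uv: "u < n" "v < n" for u v
      proof -
        have old: "arrs \<tau> ''A'' (u * n + v) =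
          (if u = v then 0 else if \<exists>i<j. es ! i = (u, v) \<or> es ! i = (v, u) then 1 else n * n + 1)"
          using conjunct1[OF conjunct2[OF H]] uv by blast
        have e: "u * n + v = x * n + y \<longleftrightarrow> u = x \<and> v = y" "u * n + v = y * n + x \<longleftrightarrow> u = y \<and> v = x"
          using index_eq[OF uv(2) xy(2)] index_eq[OF uv(2) xy(1)] by blast+
        have ex: "(\<exists>i<Suc j. es ! i = (u, v) \<or> es ! i = (v, u)) \<longleftrightarrow>
          (\<exists>i<j. es ! i = (u, v) \<or> es ! i = (v, u)) \<or> (u = x \<and> v = y) \<or> (u = y \<and> v = x)"
          using esj by (auto simp: less_Suc_eq)
        show ?thesis unfolding arrs(1) fun_upd_apply e ex old using xy(3) by auto
      qed
      moreover have "arrs \<tau>3 ''T'' i = fst (es ! i) \<and> arrs \<tau>3 ''H'' i = snd (es ! i) \<and>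
        arrs \<tau>3 ''T'' (i + m) = snd (es ! i) \<and> arrs \<tau>3 ''H'' (i + m) = fst (es ! i)" if i: "i < Suc j" for i
      proof (cases "i = j")
        case True
        then show ?thesis using m0 unfolding arrs by (simp add: esj)
      next
        case False
        then have "i < j" "i \<noteq> j + m" "i + m \<noteq> j" "i + m \<noteq> j + m" using i j by simp_all
        moreover from this have "arrs \<tau> ''T'' i = fst (es ! i)" "arrs \<tau> ''H'' i = snd (es ! i)"
          "arrs \<tau> ''T'' (i + m) = snd (es ! i)" "arrs \<tau> ''H'' (i + m) = fst (es ! i)" 
          using conjunct2[OF conjunct2[OF H]] by simp_all
        ultimately show ?thesis unfolding arrs by simp
      qed
      ultimately show "regs (st enter_edge \<tau>) ''j'' = j \<and> regs (st enter_edge \<tau>) ''m'' = m \<and>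
          ?I (Suc j) ((st enter_edge \<tau>)\<lparr>regs := (regs (st enter_edge \<tau>))(''j'' := Suc j)\<rparr>)"
        unfolding tau using q regs[of "''j''"] regs[of "''m''"] by simp
    qed (simp add: enter_edge_def load_edge_def list_edge_def weigh_edge_def)
  qed (use I W(7) in simp_all)
  then show ?thesis
  proof (rule run_mono)
    fix \<tau> assume I: "?I m \<tau> \<and> regs \<tau> ''j'' = m"
    note a = conjunct1[OF conjunct1[OF I]] conjunct1[OF conjunct2[OF conjunct1[OF I]]] conjunct2[OF conjunct2[OF conjunct1[OF I]]]
    have "arrs \<tau> ''A'' i = wt G n {} i" if i: "i < n * n" for i
    proof -
      obtain u v where uv: "u < n" "v < n" "i = u * n + v" using index_cases[OF i] .
      have ex: "(\<exists>i<m. es ! i = (u, v) \<or> es ! i = (v, u)) \<longleftrightarrow> adj G u v"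
        unfolding adj_iff in_set_conv_nth m[symmetric] ex_disj_distrib conj_disj_distribL by (rule refl)
      have "arrs \<tau> ''A'' (u * n + v) =
        (if u = v then 0 else if \<exists>i<m. es ! i = (u, v) \<or> es ! i = (v, u) then 1 else n * n + 1)"
        by (rule a(2)[rule_format, OF uv(1,2)])
      then show ?thesis unfolding uv(3) wt_index[OF uv(2)] ex by simp
    qed
    moreover have "arrs \<tau> ''T'' j = fst (dir j) \<and> arrs \<tau> ''H'' j = snd (dir j)" if j: "j < 2 * m" for j
    proof (cases "j < m")
      case True
      then show ?thesis using a(3) by (simp add: dir_def)
    next
      case False
      then have "j - m < m" "j = j - m + m" using j by auto
      then have "arrs \<tau> ''T'' j = snd (es ! (j - m)) \<and> arrs \<tau> ''H'' j = fst (es ! (j - m))" using spec[OF a(3), of "j - m"] by simp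
      then show ?thesis using False by (simp add: dir_def)
    qed
    ultimately show "same {''j'', ''e'', ''x'', ''y''} {''A'', ''T'', ''H''} \<sigma> \<tau> \<and>
      (\<forall>i<n * n. arrs \<tau> ''A'' i = wt G n {} i) \<and>
      (\<forall>j<2 * m. arrs \<tau> ''T'' j = fst (dir j) \<and> arrs \<tau> ''H'' j = snd (dir j))" using a(1) by simp
  qed simp
qed

definition built :: "state \<Rightarrow> bool" where
  "built \<sigma> \<longleftrightarrow> ready \<sigma> \<and> (\<forall>i<n * n. arrs \<sigma> ''A'' i = wt G n {} i) \<and> (\<forall>i<n * n. arrs \<sigma> ''D'' i = apsp G n {} i) \<and>
     (\<forall>j<2 * m. arrs \<sigma> ''T'' j = fst (dir j) \<and> arrs \<sigma> ''H'' j = snd (dir j))"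

lemma run_build:
  assumes r: "ready \<sigma>"
  shows "run W build \<sigma> (17 * (n * n * n) + 7 * (n * n) + 5 * n + 18 * m + 10) built"
proof -
  have "run W build \<sigma> (3 * (n * n) + 2 + (5 * n + 2 + (18 * m + 2 + (4 * (n * n) + 2 + (17 * (n * n * n) + 2))))) built"
    unfolding build_def
  proof (rule run_Seq[OF run_fill[OF r]], elim conjE)
    fix \<tau>1 assume 1: "same {''i''} {''A''} \<sigma> \<tau>1" "\<forall>e<n * n. arrs \<tau>1 ''A'' e = n * n + 1"
    have r1: "ready \<tau>1" using ready_same[OF 1(1) _ _ r] by simp
    show "run W (Seq clear_diagonal (Seq (For ''j'' ''m'' enter_edge) (Seq (copy ''A'' ''D'') (floyd ''D'')))) \<tau>1
      (5 * n + 2 + (18 * m + 2 + (4 * (n * n) + 2 + (17 * (n * n * n) + 2)))) built"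
    proof (rule run_Seq[OF run_clear_diagonal[OF r1 1(2)]], elim conjE)
      fix \<tau>2 assume 2: "same {''i'', ''e''} {''A''} \<tau>1 \<tau>2"
        "\<forall>u<n. \<forall>v<n. arrs \<tau>2 ''A'' (u * n + v) = (if u = v then 0 else n * n + 1)"
      have r2: "ready \<tau>2" using ready_same[OF 2(1) _ _ r1] by simp
      show "run W (Seq (For ''j'' ''m'' enter_edge) (Seq (copy ''A'' ''D'') (floyd ''D''))) \<tau>2
        (18 * m + 2 + (4 * (n * n) + 2 + (17 * (n * n * n) + 2))) built"
      proof (rule run_Seq[OF run_enter_edges[OF r2 2(2)]], elim conjE)
        fix \<tau>3 assume 3: "same {''j'', ''e'', ''x'', ''y''} {''A'', ''T'', ''H''} \<tau>2 \<tau>3"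
          "\<forall>i<n * n. arrs \<tau>3 ''A'' i = wt G n {} i"
          "\<forall>j<2 * m. arrs \<tau>3 ''T'' j = fst (dir j) \<and> arrs \<tau>3 ''H'' j = snd (dir j)"
        have r3: "ready \<tau>3" using ready_same[OF 3(1) _ _ r2] by simp
        have b: "wt G n {} i \<le> W" for i by (rule le_trans[OF wt_le]) (use W(2) in simp)
        have c: "run W (copy ''A'' ''D'') \<tau>3 (4 * (n * n) + 2)
          (\<lambda>\<tau>. same {''i'', ''v''} {''D''} \<tau>3 \<tau> \<and> (\<forall>i<n * n. arrs \<tau> ''D'' i = arrs \<tau>3 ''A'' i))"
          by (rule run_copy) (use r3 3(2) b W(3) in \<open>simp_all add: ready_def\<close>)
        show "run W (Seq (copy ''A'' ''D'') (floyd ''D'')) \<tau>3 (4 * (n * n) + 2 + (17 * (n * n * n) + 2)) built"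
        proof (rule run_Seq[OF c], elim conjE)
          fix \<tau>4 assume 4: "same {''i'', ''v''} {''D''} \<tau>3 \<tau>4" "\<forall>i<n * n. arrs \<tau>4 ''D'' i = arrs \<tau>3 ''A'' i"
          have r4: "ready \<tau>4" using ready_same[OF 4(1) _ _ r3] by simp
          have f: "run W (floyd ''D'') \<tau>4 (17 * (n * n * n) + 2)
            (\<lambda>\<tau>. same {''t'', ''r'', ''e'', ''u'', ''v'', ''a'', ''b''} {''D''} \<tau>4 \<tau> \<and>
              (\<forall>i<n * n. arrs \<tau> ''D'' i = fw n (n * n * n) (wt G n {}) i))"
            by (rule run_floyd[where B = "n * n + 1"]) (use r4 3(2) 4(2) W(1-3) wt_le[of G n "{}"] in \<open>simp_all add: ready_def\<close>)
          show "run W (floyd ''D'') \<tau>4 (17 * (n * n * n) + 2) built"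
          proof (rule run_mono[OF f order_refl], elim conjE)
            fix \<tau>5 assume 5: "same {''t'', ''r'', ''e'', ''u'', ''v'', ''a'', ''b''} {''D''} \<tau>4 \<tau>5"
              "\<forall>i<n * n. arrs \<tau>5 ''D'' i = fw n (n * n * n) (wt G n {}) i"
            have "ready \<tau>5" using ready_same[OF 5(1) _ _ r4] by simp
            moreover have "arrs \<tau>5 X = arrs \<tau>3 X" if "X \<noteq> ''D''" for X
              using 4(1) 5(1) that by (simp add: same_def)
            ultimately show "built \<tau>5" using 3(2,3) 5(2) by (simp add: built_def apsp_def)
          qed
        qed
      qed
    qed
  qed
  then show ?thesis by (rule run_mono) (simp_all add: algebra_simps)
qed

lemma card_edges_pos: "0 < m \<Longrightarrow> 0 < n"
  using adj_bounds[OF adj_nth[of 0]] by simp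

lemma reach_unmarked: "reach G F u c v \<Longrightarrow> \<exists>c. reach G {} u c v"
  by (induction rule: reach.induct) (blast intro: reach.stay reach.pay)+

text \<open>Contraction never joins components, so a disconnected graph can be rejected before the
  search.\<close>

lemma connected_if_solvable:
  assumes "s_club_contraction s G k" "u < n" "v < n"
  shows "\<exists>c. reach G {} u c v"
proof -
  obtain F where "F \<subseteq> edges G" "reach G F u s v"
    using assms s_club_contraction_iff[OF simple, of s k] verts by blast
  then show ?thesis using reach_unmarked by blast
qed

lemma run_decide:
  assumes b: "built \<sigma>" and at: "AT_free G" and s: "2 \<le> s" and m0: "0 < m"
  shows "run W decide \<sigma> (10 * (n * n) + 10 + ((34 * (n * n * n) + 22 * (n * n) + (16 * n + 17) * (n * n) + 92) * (2 * m) ^ 4 + 2))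
    (\<lambda>\<tau>. regs \<tau> ''out'' = (if s_club_contraction s G k then 1 else 0))"
proof -
  let ?S = "(34 * (n * n * n) + 22 * (n * n) + (16 * n + 17) * (n * n) + 92) * (2 * m) ^ 4 + 2"
  let ?Q = "\<lambda>\<tau>. regs \<tau> ''out'' = (if s_club_contraction s G k then 1 else 0)"
  have below: "run W (all_below ''D'' (Reg r)) \<tau> (5 * (n * n) + 3)
    (\<lambda>\<upsilon>. same {''i'', ''v'', ''o''} {} \<tau> \<upsilon> \<and>
       regs \<upsilon> ''o'' = (if \<forall>i<n * n. apsp G n {} i \<le> regs \<tau> r then 1 else 0))"
    if "built \<tau>" "r \<notin> {''i'', ''v'', ''o''}" for r \<tau>
  proof -
    have D: "arrs \<tau> ''D'' i = apsp G n {} i" if "i < n * n" for i using that \<open>built \<tau>\<close> by (simp add: built_def)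
    have bd: "arrs \<tau> ''D'' i \<le> W" if "i < n * n" for i
      unfolding D[OF that] by (rule le_trans[OF apsp_le[OF that]]) (use W(2) in simp)
    have "regs \<tau> ''N'' = n * n" using \<open>built \<tau>\<close> by (simp add: built_def ready_def)
    then show ?thesis using run_all_below[of \<tau> "n * n" W "''D''" r] bd that(2) W(3) by (simp add: D cong: if_cong)
  qed
  have keep: "built \<upsilon>" if "same {''i'', ''v'', ''o''} {} \<tau> \<upsilon>" "built \<tau>" for \<tau> \<upsilon>
    using ready_same[OF that(1)] that by (simp add: built_def same_def)
  have rN: "regs \<tau> ''N'' = n * n" and rs: "regs \<tau> ''s'' = s" and ro: "regs \<tau> ''out'' = 0" if "built \<tau>" for \<tau>
    using that by (simp_all add: built_def ready_def)
  have W1: "1 \<le> W" using W(3) by linarith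
  have "run W decide \<sigma> (5 * (n * n) + 3 + Suc (5 * (n * n) + 3 + Suc ?S)) ?Q"
    unfolding decide_def
  proof (rule run_Seq[OF below[OF b]], simp, elim conjE)
    fix \<tau> assume t: "same {''i'', ''v'', ''o''} {} \<sigma> \<tau>"
      "regs \<tau> ''o'' = (if \<forall>i<n * n. apsp G n {} i \<le> regs \<sigma> ''N'' then 1 else 0)"
    have bt: "built \<tau>" by (rule keep[OF t(1) b])
    have conn: "regs \<tau> ''o'' = 1 \<longleftrightarrow> (\<forall>u<n. \<forall>v<n. \<exists>c. reach G {} u c v)"
      using t(2) apsp_connected_iff[OF verts] rN[OF b] by simp
    show "run W (Cond (Eq (Reg ''o'') (Imm 1)) (Seq (all_below ''D'' (Reg ''s''))
      (Cond (Eq (Reg ''o'') (Imm 1)) (Assign ''out'' Add (Imm 1) (Imm 0)) search)) Skip) \<tau>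
      (Suc (5 * (n * n) + 3 + Suc ?S)) ?Q"
    proof (rule run_Cond)
      assume "\<not> tval \<tau> (Eq (Reg ''o'') (Imm 1))"
      then have "\<not> s_club_contraction s G k" using conn connected_if_solvable by simp blast
      then show "run W Skip \<tau> (5 * (n * n) + 3 + Suc ?S) ?Q"
        by (intro run_safe) (simp_all add: ro[OF bt])
    next
      assume "tval \<tau> (Eq (Reg ''o'') (Imm 1))"
      then have c: "\<forall>u<n. \<forall>v<n. \<exists>c. reach G {} u c v" using conn by simp
      \<comment> \<open>The locale presupposes connectedness, which the test has just established in
        this branch.\<close>
      interpret R: ram_graph G n m k s W dir
        using simple verts c adj_dir dir_onto W m0 card_edges_pos[OF m0] by unfold_locales auto
      have sol: "R.sol \<longleftrightarrow> s_club_contraction s G k"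
        unfolding R.sol_def s_club_contraction_iff[OF simple] R.good_def by (simp add: R.h_le_iff)
      show "run W (Seq (all_below ''D'' (Reg ''s''))
        (Cond (Eq (Reg ''o'') (Imm 1)) (Assign ''out'' Add (Imm 1) (Imm 0)) search)) \<tau> (5 * (n * n) + 3 + Suc ?S) ?Q"
      proof (rule run_Seq[OF below[OF bt]], simp, elim conjE)
        fix \<upsilon> assume u: "same {''i'', ''v'', ''o''} {} \<tau> \<upsilon>"
          "regs \<upsilon> ''o'' = (if \<forall>i<n * n. apsp G n {} i \<le> regs \<tau> ''s'' then 1 else 0)"
        have bu: "built \<upsilon>" by (rule keep[OF u(1) bt])
        have o: "regs \<upsilon> ''o'' = 1 \<longleftrightarrow> R.good s {}" using u(2) R.apsp_good rs[OF bt] by simp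
        show "run W (Cond (Eq (Reg ''o'') (Imm 1)) (Assign ''out'' Add (Imm 1) (Imm 0)) search) \<upsilon> (Suc ?S) ?Q"
        proof (rule run_Cond)
          assume "tval \<upsilon> (Eq (Reg ''o'') (Imm 1))"
          then have "R.good s {}" using o by simp
          then have "s_club_contraction s G k" unfolding sol[symmetric] R.sol_def by (intro exI[of _ "{}"]) simp
          then show "run W (Assign ''out'' Add (Imm 1) (Imm 0)) \<upsilon> ?S ?Q" using W1 by (intro run_safe) simp_all
        next
          assume "\<not> tval \<upsilon> (Eq (Reg ''o'') (Imm 1))"
          then have ng: "\<not> R.good s {}" using o by simp
          have fx: "R.fixed \<upsilon>" using bu by (simp add: R.fixed_def built_def ready_def)
          show "run W search \<upsilon> ?S ?Q"
          proof (rule run_mono[OF R.run_search[OF fx ro[OF bu]] order_refl])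
            fix \<phi> assume p: "(regs \<phi> ''out'' = 0 \<or> regs \<phi> ''out'' = 1 \<and> R.sol) \<and>
              (\<forall>t<(2 * m) ^ 4. R.quad t \<longrightarrow> regs \<phi> ''out'' = 1)"
            then show "?Q \<phi>" using R.sol_imp_quad[OF at _ ng s] sol by auto
          qed
        qed
      qed
    qed
  qed
  then show ?thesis by (rule run_mono) simp_all
qed

lemma solvable_edgeless:
  assumes "m = 0"
  shows "s_club_contraction s G k \<longleftrightarrow> n \<le> 1"
proof
  assume sc: "s_club_contraction s G k"
  have no: "\<not> adj G u v" for u v using adj_iff assms m by simp
  have eq: "u = v" if "reach G F u c v" for F u c v using that by induction (use no in auto)
  show "n \<le> 1"
  proof (rule ccontr)
    assume "\<not> n \<le> 1"
    then obtain c where "reach G {} 0 c 1" using connected_if_solvable[OF sc, of 0 1] by auto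
    then show False using eq by fastforce
  qed
next
  assume n: "n \<le> 1"
  have "reach G {} u s v" if "u \<in> verts G" "v \<in> verts G" for u v
  proof -
    have "u = v" using that n verts by auto
    then show ?thesis using reach.stay[OF that(1)] by blast
  qed
  then show "s_club_contraction s G k" unfolding s_club_contraction_iff[OF simple] by (intro exI[of _ "{}"]) simp
qed

lemma run_solver:
  assumes i: "has_input \<sigma>" and out: "regs \<sigma> ''out'' = 0"
    and ps: "\<And>\<tau>. arrs \<tau> = arrs \<sigma> \<Longrightarrow> regs \<tau> ''w'' = 2 * m + 2 \<Longrightarrow>
      run W ps \<tau> 2 (\<lambda>\<upsilon>. same {''w'', ''s''} {} \<tau> \<upsilon> \<and> regs \<upsilon> ''s'' = s)"
    and at: "AT_free G" and s: "2 \<le> s"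
  shows "run W (solver ps) \<sigma> (3000 * max 1 (m ^ 4 * n ^ 3)) (\<lambda>\<tau>. regs \<tau> ''out'' = (if s_club_contraction s G k then 1 else 0))"
proof -
  let ?Q = "\<lambda>\<tau>. regs \<tau> ''out'' = (if s_club_contraction s G k then 1 else 0)"
  let ?X = "max 1 (m ^ 4 * n ^ 3)"
  have W1: "1 \<le> W" using W(3) by linarith
  \<comment> \<open>Twelve steps read the input and one is the first test; these 13 are absorbed by
    \<open>?X \<ge> 1\<close>, leaving 2987 of the 3000.\<close>
  have "run W (solver ps) \<sigma> (12 + Suc (2987 * ?X)) ?Q"
    unfolding solver_def
  proof (rule run_Seq[OF run_read_input[OF i out ps]])
    fix \<tau> assume r: "ready \<tau>"
    then have rt: "regs \<tau> ''m'' = m" "regs \<tau> ''n'' = n" "regs \<tau> ''out'' = 0" by (simp_all add: ready_def)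
    show "run W (Cond (Eq (Reg ''m'') (Imm 0))
     (Cond (Leq (Reg ''n'') (Imm 1)) (Assign ''out'' Add (Imm 1) (Imm 0)) Skip) (Seq build decide)) \<tau> (Suc (2987 * ?X)) ?Q"
    proof (rule run_Cond)
      assume "tval \<tau> (Eq (Reg ''m'') (Imm 0))"
      then have "s_club_contraction s G k \<longleftrightarrow> n \<le> 1" using rt solvable_edgeless by simp
      then show "run W (Cond (Leq (Reg ''n'') (Imm 1)) (Assign ''out'' Add (Imm 1) (Imm 0)) Skip) \<tau> (2987 * ?X) ?Q"
        using rt W1 by (intro run_safe) auto
    next
      assume "\<not> tval \<tau> (Eq (Reg ''m'') (Imm 0))"
      then have m0: "0 < m" using rt by simp
      have n0: "0 < n" by (rule card_edges_pos[OF m0])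
      define c where "c = n * n * n"
      have c: "n * n \<le> c" "n \<le> c" "1 \<le> c" using n0 by (auto simp: c_def)
      have mX: "m ^ 4 * n ^ 3 = m ^ 4 * c" by (simp add: c_def eval_nat_numeral)
      have m1: "m \<le> m ^ 4" "1 \<le> m ^ 4" using m0 by (simp_all add: self_le_power)
      have X: "?X = m ^ 4 * c" unfolding mX using m1(2) c(3) by (simp add: max_def)
      have cX: "c \<le> m ^ 4 * c" "m ^ 4 \<le> m ^ 4 * c" using m1(2) c(3) by simp_all
      \<comment> \<open>The coefficients add up: \<open>34 + 22 + 16 + 17 + 92 = 181\<close>. The
        factor 16 of \<open>(2 * m) ^ 4\<close> then yields 2896.\<close>
      have "34 * (n * n * n) + 22 * (n * n) + (16 * n + 17) * (n * n) + 92 \<le> 181 * c"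
      proof -
        have "(16 * n + 17) * (n * n) = 16 * c + 17 * (n * n)" by (simp add: c_def add_mult_distrib)
        then show ?thesis using c unfolding c_def[symmetric] by linarith
      qed
      then have "(34 * (n * n * n) + 22 * (n * n) + (16 * n + 17) * (n * n) + 92) * (2 * m) ^ 4 \<le> 181 * c * (2 * m) ^ 4"
        by (rule mult_le_mono1)
      also have "181 * c * (2 * m) ^ 4 = 2896 * (m ^ 4 * c)" by (simp add: power_mult_distrib)
      finally have S: "(34 * (n * n * n) + 22 * (n * n) + (16 * n + 17) * (n * n) + 92) * (2 * m) ^ 4 \<le> 2896 * (m ^ 4 * c)" .
      have T: "17 * c + 7 * (n * n) + 5 * n + 18 * m + 10 + (10 * (n * n) + 10 +
        ((34 * (n * n * n) + 22 * (n * n) + (16 * n + 17) * (n * n) + 92) * (2 * m) ^ 4 + 2)) \<le> 2987 * (m ^ 4 * c)"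
        using S c cX m1 by linarith
      show "run W (Seq build decide) \<tau> (2987 * ?X) ?Q"
        unfolding X by (rule run_mono[OF run_Seq[OF run_build[OF r] run_decide[OF _ at s m0]]])
          (use T in \<open>simp_all only: c_def\<close>)
    qed
  qed
  then show ?thesis by (rule run_mono) simp_all
qed

end

section \<open>From encoded graphs to the time bound\<close>

lemma nth_concat_pairs:
  "j < length es \<Longrightarrow> concat (map (\<lambda>(u, v). [u, v]) es) ! (2 * j) = fst (es ! j) \<and>
     concat (map (\<lambda>(u, v). [u, v]) es) ! (2 * j + 1) = snd (es ! j)"
proof (induction es arbitrary: j)
  case (Cons e es)
  obtain u v where "e = (u, v)" by (cases e)
  then show ?case using Cons by (cases j) simp_all
qed simp

lemma length_concat_pairs: "length (concat (map (\<lambda>(u, v). [u, v]) es)) = 2 * length es"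
  by (induction es) auto

text \<open>\<open>ps\<close> and \<open>ys\<close> leave open where \<open>s\<close> comes from: a
  constant of the program with \<open>ys\<close> empty, or the input entry after
  \<open>k\<close>.\<close>

lemma decides_solver:
  fixes G :: "nat ugraph"
  assumes simple: "simple_graph G" and at: "AT_free G" and enc: "encodes G xs" and k: "1 \<le> k" and s: "2 \<le> s"
    and d: "6 \<le> d" and sW: "s \<le> word_bound d (xs @ k # ys)"
    and ps: "\<And>W \<sigma>. s \<le> W \<Longrightarrow> regs \<sigma> ''w'' + 1 \<le> W \<Longrightarrow> arrs \<sigma> = arrs (init_state (xs @ k # ys)) \<Longrightarrow>
      regs \<sigma> ''w'' = length xs \<Longrightarrow> run W ps \<sigma> 2 (\<lambda>\<tau>. same {''w'', ''s''} {} \<sigma> \<tau> \<and> regs \<tau> ''s'' = s)"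
  shows "decides_within d (solver ps) (xs @ k # ys) (time_bound 3000 G) (s_club_contraction s G k)"
proof -
  obtain n es where V: "verts G = {..<n}" and E: "distinct (map (\<lambda>(u, v). {u, v}) es)"
      "edges G = set (map (\<lambda>(u, v). {u, v}) es)"
    and xs: "xs = n # length es # concat (map (\<lambda>(u, v). [u, v]) es)"
    using enc unfolding encodes_def by blast
  define m where "m = length es"
  let ?in = "xs @ k # ys" and ?\<sigma> = "init_state (xs @ k # ys)"
  define W where "W = word_bound d ?in"
  have len: "length xs = 2 * m + 2" by (simp add: xs m_def length_concat_pairs)
  have nth: "?in ! (2 * j + 2) = fst (es ! j)" "?in ! (2 * j + 3) = snd (es ! j)" if "j < m" for j
    using nth_concat_pairs[of j es] that by (simp_all add: xs m_def nth_append length_concat_pairs eval_nat_numeral)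
  define b where "b = length ?in + sum_list ?in + 2"
  \<comment> \<open>The length contributes \<open>2 * m + 3\<close>, the entries at least
    \<open>n + k\<close>, and 2 is added by \<open>word_bound\<close>. The bounds on
    \<open>W\<close> from the graph and \<open>k\<close> then follow from powers of
    \<open>b\<close>.\<close>
  have b: "n + 2 * m + k + 5 \<le> b" using len by (simp add: b_def xs)
  have pow: "b ^ i \<le> W" if "i \<le> 6" for i
    unfolding W_def word_bound_def b_def[symmetric] using b that d by (intro power_increasing) simp_all
  have W: "n * n * n \<le> W" "2 * (n * n + 1) \<le> W" "n * n + 10 \<le> W" "(2 * m) ^ 4 \<le> W" "k \<le> W" "s \<le> W"
    "2 * m + 3 \<le> W" "n \<le> W"
  proof -
    have n2: "(n + 5) * (n + 5) \<le> b ^ 2" unfolding power2_eq_square using b by (intro mult_le_mono) simp_all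
    have "n * n * n \<le> b ^ 3" unfolding power3_eq_cube using b by (intro mult_le_mono) simp_all
    then show "n * n * n \<le> W" using pow[of 3] by simp
    have "(n + 5) * (n + 5) * 2 \<le> b ^ 2 * b" using n2 b by (intro mult_le_mono) simp_all
    then have "(n + 5) * (n + 5) * 2 \<le> W" using pow[of 3] by (simp add: power3_eq_cube power2_eq_square)
    then show "2 * (n * n + 1) \<le> W" "n * n + 10 \<le> W" by (simp_all add: algebra_simps)
    have "(2 * m) ^ 4 \<le> b ^ 4" using b by (intro power_mono) simp_all
    then show "(2 * m) ^ 4 \<le> W" using pow[of 4] by simp
    show "k \<le> W" "2 * m + 3 \<le> W" "n \<le> W" using pow[of 1] b by simp_all
    show "s \<le> W" using sW by (simp add: W_def)
  qed
  interpret ram_input G n es k s W m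
    using simple V E(2) W by unfold_locales (simp_all add: m_def)
  have inp: "has_input ?\<sigma>"
    unfolding has_input_def using nth len by (simp add: init_state_def xs m_def nth_append)
  have "run W (solver ps) ?\<sigma> (3000 * max 1 (m ^ 4 * n ^ 3))
    (\<lambda>\<tau>. regs \<tau> ''out'' = (if s_club_contraction s G k then 1 else 0))"
  proof (rule run_solver[OF inp _ _ at s])
    show "regs ?\<sigma> ''out'' = 0" by (simp add: init_state_def)
    fix \<tau> :: state assume "arrs \<tau> = arrs ?\<sigma>" "regs \<tau> ''w'' = 2 * m + 2"
    then show "run W ps \<tau> 2 (\<lambda>\<upsilon>. same {''w'', ''s''} {} \<tau> \<upsilon> \<and> regs \<upsilon> ''s'' = s)"
      using W(6,7) len by (intro ps) simp_all
  qed
  moreover have "card (edges G) = m" "card (verts G) = n"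
    using distinct_card[OF E(1)] by (simp_all add: E(2) V m_def)
  ultimately show ?thesis
    unfolding decides_within_def run_def time_bound_def W_def by (simp only:)
qed

theorem theorem4:
  shows "(\<forall>s\<ge>2. \<exists>c d C. \<forall>(G :: nat ugraph) xs k.
            simple_graph G \<and> AT_free G \<and> encodes G xs \<and> k \<ge> 1 \<longrightarrow>
            decides_within d c (xs @ [k]) (time_bound C G) (s_club_contraction s G k))
       \<and> (\<exists>c d C. \<forall>s\<ge>2. \<forall>(G :: nat ugraph) xs k.
            simple_graph G \<and> AT_free G \<and> encodes G xs \<and> k \<ge> 1 \<longrightarrow>
            decides_within d c (xs @ [k, s]) (time_bound C G) (s_club_contraction s G k))"
proof (intro conjI allI impI)
  fix s :: nat assume s: "2 \<le> s"
  let ?c = "solver (Assign ''s'' Add (Imm s) (Imm 0))"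
  show "\<exists>c d C. \<forall>(G :: nat ugraph) xs k. simple_graph G \<and> AT_free G \<and> encodes G xs \<and> k \<ge> 1 \<longrightarrow>
    decides_within d c (xs @ [k]) (time_bound C G) (s_club_contraction s G k)"
  \<comment> \<open>The constant \<open>s\<close> of the program must fit into a word even for the
    smallest inputs. As the base of \<open>word_bound\<close> is at least 2, the exponent
    \<open>6 + s\<close> ensures this by \<open>s \<le> 2 ^ s\<close>.\<close>
  proof (rule exI[of _ ?c], rule exI[of _ "6 + s"], rule exI[of _ 3000], intro allI impI, elim conjE)
    fix G :: "nat ugraph" and xs :: "nat list" and k :: nat
    assume a: "simple_graph G" "AT_free G" "encodes G xs" "1 \<le> k"
    show "decides_within (6 + s) ?c (xs @ [k]) (time_bound 3000 G) (s_club_contraction s G k)"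
    proof (rule decides_solver[OF a s])
      have "s \<le> 2 ^ s" using less_exp[of s] by simp
      also have "\<dots> \<le> 2 ^ (6 + s)" by (intro power_increasing) simp_all
      also have "\<dots> \<le> word_bound (6 + s) (xs @ [k])" unfolding word_bound_def by (intro power_mono) simp_all
      finally show "s \<le> word_bound (6 + s) (xs @ [k])" .
    next
      fix W :: nat and \<sigma> :: state assume "s \<le> W"
      then show "run W (Assign ''s'' Add (Imm s) (Imm 0)) \<sigma> 2 (\<lambda>\<tau>. same {''w'', ''s''} {} \<sigma> \<tau> \<and> regs \<tau> ''s'' = s)"
        by (intro run_safe) (simp_all add: same_def)
    qed simp
  qed
next
  let ?p = "Seq (Assign ''w'' Add (Reg ''w'') (Imm 1)) (Load ''s'' ''in'' (Reg ''w''))"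
  show "\<exists>c d C. \<forall>s\<ge>2. \<forall>(G :: nat ugraph) xs k. simple_graph G \<and> AT_free G \<and> encodes G xs \<and> k \<ge> 1 \<longrightarrow>
    decides_within d c (xs @ [k, s]) (time_bound C G) (s_club_contraction s G k)"
  proof (rule exI[of _ "solver ?p"], rule exI[of _ 6], rule exI[of _ 3000], intro allI impI, elim conjE)
    fix s k :: nat and G :: "nat ugraph" and xs :: "nat list"
    assume s: "2 \<le> s" and a: "simple_graph G" "AT_free G" "encodes G xs" "1 \<le> k"
    show "decides_within 6 (solver ?p) (xs @ [k, s]) (time_bound 3000 G) (s_club_contraction s G k)"
    proof (rule decides_solver[OF a s order_refl])
      let ?b = "length (xs @ [k, s]) + sum_list (xs @ [k, s]) + 2"
      have "s \<le> ?b" by simp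
      also have "?b \<le> ?b ^ 6" by (rule self_le_power) simp_all
      finally show "s \<le> word_bound 6 (xs @ [k, s])" unfolding word_bound_def .
    next
      fix W :: nat and \<sigma> :: state
      assume b: "s \<le> W" "regs \<sigma> ''w'' + 1 \<le> W" and w: "arrs \<sigma> = arrs (init_state (xs @ [k, s]))" "regs \<sigma> ''w'' = length xs"
      have "arrs \<sigma> ''in'' (Suc (length xs)) = s" unfolding w by (simp add: init_state_def nth_append)
      then show "run W ?p \<sigma> 2 (\<lambda>\<tau>. same {''w'', ''s''} {} \<sigma> \<tau> \<and> regs \<tau> ''s'' = s)"
        using b w(2) by (intro run_safe) (simp_all add: same_def)
    qed
  qed
qed

end
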